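(* Let $g\ge1$ be an integer. 1) $U_{h,h'}(\mathfrak{sl}_2,g)$ is a trivial formal deformation of $U(\mathfrak{sl}_2)$ along $h,h'$. 2) $U_{h,h'}(\mathfrak{sl}_2,g)$ is a trivial formal deformation of $U_h(\mathfrak{sl}_2)$ along $h'$. 3) $U_{h,h'}(\mathfrak{sl}_2,g)$ is a trivial formal deformation of $U_{h'}(\mathfrak{sl}_2)$ along $h$.
   Context: The base field is $\mathbb C$. "Topologically generated by a set $S$ with relations" means the quotient of the power series algebra (in the formal parameters) over the free algebra $\mathbb C\langle S\rangle$ by the closure, for the topology defined by the ideal generated by the parameters, of the two-sided ideal generated by the relations. Definition of $U_{h,h'}(\mathfrak{sl}_2,g)$. Let $Q=\exp(h)$, $T=\exp(h')$, $\varepsilon=e^{i\pi/g}$ and $$P(u)=\tfrac12\big(u^{g-1}+u^{1-g}\big)\prod_{k=1}^{g-1}\frac{\varepsilon^ku-\varepsilon^{-k}u^{-1}}{\varepsilon^k-\varepsilon^{-k}}.$$ For a variable $x$, put $\{x\}_Q=P(e^{hx})\in\mathbb C[x][[h]]$ and $$F(x)=\frac{(QT^{\{x\}_Q})^x-(QT^{\{x\}_Q})^{-x}}{QT^{\{x\}_Q}-Q^{-1}T^{-\{x\}_Q}}=\frac{\sinh\big((h+h'\{x\}_Q)x\big)}{\sinh\big(h+h'\{x\}_Q\big)}\in\mathbb C[x][[h,h']]$$ (numerator and denominator are both divided by $h+h'\{x\}_Q$, after which the denominator is invertible). $U_{h,h'}(\mathfrak{sl}_2,g)$ is the $\mathbb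 C[[h,h']]$-algebra topologically generated by $X^+,X^-,H,C$ with relations $[C,X^\pm]=[C,H]=0$, $[H,X^\pm]=\pm2X^\pm$ and $$X^\pm X^\mp=F(H_1^\pm)\,F(H_{-1}^\pm),\qquad H_e^\pm=\tfrac12\big(\sqrt C+eH\mp e\big)\quad(e=\pm1),$$ where $F(H_1^\pm)F(H_{-1}^\pm)$, computed in $\mathbb C[H,\sqrt C][[h,h']]$ with commuting variables, is invariant under $\sqrt C\mapsto-\sqrt C$ and hence is a power series with coefficients in $\mathbb C[H,C]$. $U_h(\mathfrak{sl}_2)$ is the $\mathbb C[[h]]$-algebra topologically generated by $\tilde X^\pm,\tilde H$ with $[\tilde H,\tilde X^\pm]=\pm2\tilde X^\pm$, $[\tilde X^+,\tilde X^-]=\sinh(h\tilde H)/\sinh(h)$; $U_{h'}(\mathfrak{sl}_2)$ is the same with $h'$ in place of $h$. Formal deformations. Let $K$ be a commutative ring and $A$ a $K$-algebra. A formal deformation of $A$ along parameters $\bar h=(h_1,\dots,h_s)$ is a $K[[\bar h]]$-algebra structure on the $K[[\bar h]]$-module $A[[\bar h]]$ with unit $1\in A$ which reduces modulo $(h_1,\dots,h_s)$ to the algebra $A$. It is trivial if there is a $K[[\bar h]]$-algebra isomorphism from it to $A[[\bar h]]$ with the constant ($K[[\bar h]]$-bilinearly extended) product, inducing the identity modulo $(h_1,\dots,h_s)$. The algebra $U_{h,h'}(\mathfrak{sl}_2,g)$ has the topological basis $(X^-)^aH^b(X^+)^c$, $a,b,c\in\mathbb N$, and $U_h(\mathfrak{sl}_2)$,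 $U_{h'}(\mathfrak{sl}_2)$, $U(\mathfrak{sl}_2)$ have the analogous (topological) bases; in the theorem $U_{h,h'}(\mathfrak{sl}_2,g)$ is identified as a module with $U(\mathfrak{sl}_2)[[h,h']]$, with $U_h(\mathfrak{sl}_2)[[h']]$ and with $U_{h'}(\mathfrak{sl}_2)[[h]]$ through these bases (in 2) $K=\mathbb C[[h]]$, in 3) $K=\mathbb C[[h']]$). *)

theory Defs
  imports
    "HOL-Algebra.QuotRing"
    "HOL-Algebra.Ideal_Product"
    "HOL-Algebra.Module"
    "HOL-Algebra.Algebraic_Closure_Type"
    "HOL-Library.Poly_Mapping"
    "HOL-Computational_Algebra.Polynomial"
    "HOL-Computational_Algebra.Formal_Power_Series"
    "HOL-Analysis.Complex_Transcendental"
begin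

section \<open>Algebras over a commutative ring\<close>

text \<open>The library locale \<^locale>\<open>algebra\<close> only covers commutative algebras.\<close>

locale assoc_algebra = module R M + ring M for R and M (structure) +
  assumes smult_mult_left:
    "\<lbrakk>k \<in> carrier R; x \<in> carrier M; y \<in> carrier M\<rbrakk>
      \<Longrightarrow> (k \<odot>\<^bsub>M\<^esub> x) \<otimes>\<^bsub>M\<^esub> y = k \<odot>\<^bsub>M\<^esub> (x \<otimes>\<^bsub>M\<^esub> y)"
  and smult_mult_right:
    "\<lbrakk>k \<in> carrier R; x \<in> carrier M; y \<in> carrier M\<rbrakk>
      \<Longrightarrow> x \<otimes>\<^bsub>M\<^esub> (k \<odot>\<^bsub>M\<^esub> y) = k \<odot>\<^bsub>M\<^esub> (x \<otimes>\<^bsub>M\<^esub> y)"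

definition with_smult :: "('a, 'm) ring_scheme \<Rightarrow> ('k \<Rightarrow> 'a \<Rightarrow> 'a) \<Rightarrow> ('k, 'a) module" where
  "with_smult R s = \<lparr>carrier = carrier R, monoid.mult = monoid.mult R, one = one R,
     zero = zero R, add = add R, module.smult = s\<rparr>"

definition restrict_scalars :: "('l \<Rightarrow> 'k) \<Rightarrow> ('k, 'a) module \<Rightarrow> ('l, 'a) module" where
  "restrict_scalars \<sigma> M = with_smult M (\<lambda>l x. \<sigma> l \<odot>\<^bsub>M\<^esub> x)"

definition module_iso ::
  "('k, 'r) ring_scheme \<Rightarrow> ('k, 'a) module \<Rightarrow> ('k, 'b) module \<Rightarrow> ('a \<Rightarrow> 'b) set" where
  "module_iso K M N = {f. bij_betw f (carrier M) (carrier N) \<and>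
     (\<forall>x\<in>carrier M. \<forall>y\<in>carrier M. f (x \<oplus>\<^bsub>M\<^esub> y) = f x \<oplus>\<^bsub>N\<^esub> f y) \<and>
     (\<forall>k\<in>carrier K. \<forall>x\<in>carrier M. f (k \<odot>\<^bsub>M\<^esub> x) = k \<odot>\<^bsub>N\<^esub> f x)}"

definition algebra_iso ::
  "('k, 'r) ring_scheme \<Rightarrow> ('k, 'a) module \<Rightarrow> ('k, 'b) module \<Rightarrow> ('a \<Rightarrow> 'b) set" where
  "algebra_iso K M N = ring_iso M N \<inter> module_iso K M N"

definition quot_algebra :: "('k, 'a) module \<Rightarrow> 'a set \<Rightarrow> ('k, 'a set) module" where
  "quot_algebra M I = with_smult (M Quot I) (\<lambda>k S. \<Union>x\<in>S. I +>\<^bsub>M\<^esub> (k \<odot>\<^bsub>M\<^esub> x))"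


section \<open>Formal power series in finitely many parameters\<close>

text \<open>
  The finite type \<open>'s\<close> indexes the parameters; the series with coefficients \<open>f m\<close> is
  the sum of \<open>f m h\<^sup>m\<close> over the multi-indices \<open>m :: 's \<Rightarrow> nat\<close>, and \<open>{a. a \<le> m}\<close> is the finite
  set of multi-indices that are pointwise at most \<open>m\<close>.
\<close>

definition const_series :: "('a, 'm) ring_scheme \<Rightarrow> 'a \<Rightarrow> ('s::finite \<Rightarrow> nat) \<Rightarrow> 'a" where
  "const_series R a = (\<lambda>m. if m = (\<lambda>_. 0) then a else \<zero>\<^bsub>R\<^esub>)"

definition parameter :: "('a, 'm) ring_scheme \<Rightarrow> 's::finite \<Rightarrow> ('s \<Rightarrow> nat) \<Rightarrow> 'a" where
  "parameter R i = (\<lambda>m. if m = (\<lambda>j. if j = i then 1 else 0) then \<one>\<^bsub>R\<^esub> else \<zero>\<^bsub>R\<^esub>)"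

definition series_ring :: "('a, 'm) ring_scheme \<Rightarrow> (('s::finite \<Rightarrow> nat) \<Rightarrow> 'a) ring" where
  "series_ring R = \<lparr>carrier = {f. \<forall>m. f m \<in> carrier R},
     monoid.mult = (\<lambda>f g m. \<Oplus>\<^bsub>R\<^esub>a\<in>{a. a \<le> m}. f a \<otimes>\<^bsub>R\<^esub> g (m - a)),
     one = const_series R \<one>\<^bsub>R\<^esub>,
     zero = const_series R \<zero>\<^bsub>R\<^esub>,
     add = (\<lambda>f g m. f m \<oplus>\<^bsub>R\<^esub> g m)\<rparr>"

text \<open>For a \<open>K\<close>-algebra \<open>A\<close>, this is \<open>A[[h\<^sub>1,\<dots>,h\<^sub>s]]\<close> with the constant product, as an algebra
  over \<open>K[[h\<^sub>1,\<dots>,h\<^sub>s]]\<close>.\<close>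

definition series_algebra ::
  "('k, 'a) module \<Rightarrow> (('s::finite \<Rightarrow> nat) \<Rightarrow> 'k, ('s \<Rightarrow> nat) \<Rightarrow> 'a) module" where
  "series_algebra A =
     with_smult (series_ring A) (\<lambda>k f m. \<Oplus>\<^bsub>A\<^esub>a\<in>{a. a \<le> m}. k a \<odot>\<^bsub>A\<^esub> f (m - a))"


section \<open>Formal deformations\<close>

text \<open>The quotient of \<open>A[[h\<^sub>1,\<dots>,h\<^sub>s]]\<close> by \<open>(h\<^sub>1,\<dots>,h\<^sub>s)\<close> is identified with \<open>A\<close> by taking constant
  coefficients.\<close>

definition formal_deformation ::
  "'k ring \<Rightarrow> ('k, 'a) module \<Rightarrow> (('s::finite \<Rightarrow> nat) \<Rightarrow> 'k, ('s \<Rightarrow> nat) \<Rightarrow> 'a) module \<Rightarrow> bool"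
where
  "formal_deformation K A B \<longleftrightarrow>
     cring K \<and> assoc_algebra K A \<and> assoc_algebra (series_ring K) B \<and>
     carrier B = carrier (series_algebra A) \<and>
     zero B = zero (series_algebra A) \<and>
     (\<forall>f\<in>carrier B. \<forall>g\<in>carrier B. f \<oplus>\<^bsub>B\<^esub> g = f \<oplus>\<^bsub>series_algebra A\<^esub> g) \<and>
     (\<forall>k\<in>carrier (series_ring K). \<forall>f\<in>carrier B. k \<odot>\<^bsub>B\<^esub> f = k \<odot>\<^bsub>series_algebra A\<^esub> f) \<and>
     one B = const_series A \<one>\<^bsub>A\<^esub> \<and>
     (\<forall>f\<in>carrier B. \<forall>g\<in>carrier B. (f \<otimes>\<^bsub>B\<^esub> g) (\<lambda>_. 0) = f (\<lambda>_. 0) \<otimes>\<^bsub>A\<^esub> g (\<lambda>_. 0))"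

definition trivial_formal_deformation ::
  "'k ring \<Rightarrow> ('k, 'a) module \<Rightarrow> (('s::finite \<Rightarrow> nat) \<Rightarrow> 'k, ('s \<Rightarrow> nat) \<Rightarrow> 'a) module \<Rightarrow> bool"
where
  "trivial_formal_deformation K A B \<longleftrightarrow>
     formal_deformation K A B \<and>
     (\<exists>\<phi>\<in>algebra_iso (series_ring K) B (series_algebra A).
        \<forall>f\<in>carrier B. \<phi> f (\<lambda>_. 0) = f (\<lambda>_. 0))"

definition transport_algebra ::
  "('k, 'a) module \<Rightarrow> ('a \<Rightarrow> 'b) \<Rightarrow> ('k, 'b) module \<Rightarrow> ('k, 'a) module" where
  "transport_algebra M \<iota> B =
     M\<lparr>monoid.mult := (\<lambda>f g. inv_into (carrier M) \<iota> (\<iota> f \<otimes>\<^bsub>B\<^esub> \<iota> g)),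
       one := inv_into (carrier M) \<iota> \<one>\<^bsub>B\<^esub>\<rparr>"

text \<open>
  \<open>e\<close> and \<open>e'\<close> are the (topological) bases of \<open>A\<close> and \<open>B\<close>. The identification of \<open>A[[h\<^sub>1,\<dots>,h\<^sub>s]]\<close>
  with \<open>B\<close> is the \<open>K[[h\<^sub>1,\<dots>,h\<^sub>s]]\<close>-linear bijection \<open>\<iota>\<close> that matches them. Linear maps
  are continuous for the adic topologies, so \<open>\<iota>\<close> is unique as soon as \<open>e\<close> is a topological basis.
\<close>

definition trivial_deformation_via_bases ::
  "'k ring \<Rightarrow> ('k, 'a) module \<Rightarrow> ('i \<Rightarrow> 'a) \<Rightarrow>
   (('s::finite \<Rightarrow> nat) \<Rightarrow> 'k, 'b) module \<Rightarrow> ('i \<Rightarrow> 'b) \<Rightarrow> bool"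
where
  "trivial_deformation_via_bases K A e B e' \<longleftrightarrow>
     (\<exists>\<iota>\<in>module_iso (series_ring K) (series_algebra A) B.
        (\<forall>i. \<iota> (const_series A (e i)) = e' i) \<and>
        trivial_formal_deformation K A (transport_algebra (series_algebra A) \<iota> B))"


section \<open>Topologically generated algebras\<close>

instantiation list :: (type) monoid_add
begin

definition zero_list :: "'a list" where "zero_list = []"

definition plus_list :: "'a list \<Rightarrow> 'a list \<Rightarrow> 'a list" where "plus_list = (@)"

instance
  by standard (simp_all add: zero_list_def plus_list_def)

end

text \<open>With concatenation as addition of exponents, finitely supported functions on words
  form the free algebra.\<close>

type_synonym 'x free = "'x list \<Rightarrow>\<^sub>0 complex"

definition scalar :: "complex \<Rightarrow> 'x free" where
  "scalar c = Poly_Mapping.single [] c"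

definition gen :: "'x \<Rightarrow> 'x free" where
  "gen x = Poly_Mapping.single [x] 1"

abbreviation complex_ring :: "complex ring" where
  "complex_ring \<equiv> ring_of_type_algebra"

definition free_algebra :: "(complex, 'x free) module" where
  "free_algebra = with_smult ring_of_type_algebra (\<lambda>c p. scalar c * p)"

definition eval_free :: "complex poly \<Rightarrow> 'x free \<Rightarrow> 'x free" where
  "eval_free p a = (\<Sum>i\<le>Polynomial.degree p. scalar (Polynomial.coeff p i) * a ^ i)"

definition ideal_power :: "('a, 'm) ring_scheme \<Rightarrow> 'a set \<Rightarrow> nat \<Rightarrow> 'a set" where
  "ideal_power R J n = (ideal_prod R J ^^ n) (carrier R)"

definition adic_closure :: "('a, 'm) ring_scheme \<Rightarrow> 'a set \<Rightarrow> 'a set \<Rightarrow> 'a set" where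
  "adic_closure R J S = {x \<in> carrier R. \<forall>n. \<exists>y\<in>S. x \<ominus>\<^bsub>R\<^esub> y \<in> ideal_power R J n}"

definition rel_ideal :: "(('s::finite \<Rightarrow> nat) \<Rightarrow> 'x free) set \<Rightarrow> (('s \<Rightarrow> nat) \<Rightarrow> 'x free) set" where
  "rel_ideal rels =
     (let P = series_algebra free_algebra
      in adic_closure P (genideal P (range (parameter free_algebra))) (genideal P rels))"

definition top_generated ::
  "(('s::finite \<Rightarrow> nat) \<Rightarrow> 'x free) set \<Rightarrow>
   (('s \<Rightarrow> nat) \<Rightarrow> complex, (('s \<Rightarrow> nat) \<Rightarrow> 'x free) set) module" where
  "top_generated rels = quot_algebra (series_algebra free_algebra) (rel_ideal rels)"

definition top_gen ::
  "(('s::finite \<Rightarrow> nat) \<Rightarrow> 'x free) set \<Rightarrow> 'x \<Rightarrow> (('s \<Rightarrow> nat) \<Rightarrow> 'x free) set" where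
  "top_gen rels x =
     rel_ideal rels +>\<^bsub>series_algebra free_algebra\<^esub> const_series free_algebra (gen x)"

definition pbw :: "('a, 'm) ring_scheme \<Rightarrow> 'a \<Rightarrow> 'a \<Rightarrow> 'a \<Rightarrow> nat \<times> nat \<times> nat \<Rightarrow> 'a" where
  "pbw R xm h xp = (\<lambda>(a, b, c). xm [^]\<^bsub>R\<^esub> a \<otimes>\<^bsub>R\<^esub> h [^]\<^bsub>R\<^esub> b \<otimes>\<^bsub>R\<^esub> xp [^]\<^bsub>R\<^esub> c)"


section \<open>The enveloping algebra and its one-parameter deformation\<close>

datatype sl2_gen = Xp | Xm | Hgen

definition weight_rels :: "'x \<Rightarrow> 'x \<Rightarrow> 'x \<Rightarrow> 'x free set" where
  "weight_rels h xp xm =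
     {gen h * gen xp - gen xp * gen h - scalar 2 * gen xp,
      gen h * gen xm - gen xm * gen h + scalar 2 * gen xm}"

definition U_rel_ideal :: "sl2_gen free set" where
  "U_rel_ideal = genideal free_algebra
     (insert (gen Xp * gen Xm - gen Xm * gen Xp - gen Hgen) (weight_rels Hgen Xp Xm))"

definition U_sl2 :: "(complex, sl2_gen free set) module" where
  "U_sl2 = quot_algebra free_algebra U_rel_ideal"

definition U_gen :: "sl2_gen \<Rightarrow> sl2_gen free set" where
  "U_gen x = U_rel_ideal +>\<^bsub>free_algebra\<^esub> gen x"

definition U_basis :: "nat \<times> nat \<times> nat \<Rightarrow> sl2_gen free set" where
  "U_basis = pbw U_sl2 (U_gen Xm) (U_gen Hgen) (U_gen Xp)"

text \<open>\<open>exp_series emb a\<close> is \<open>exp(t a)\<close> in the series variable \<open>t\<close>, where \<open>emb\<close> embeds the complex numbers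
  into the coefficient ring.\<close>

definition exp_series :: "(complex \<Rightarrow> 'r) \<Rightarrow> 'r \<Rightarrow> 'r::comm_ring_1 fps" where
  "exp_series emb a = Abs_fps (\<lambda>n. emb (1 / fact n) * a ^ n)"

abbreviation var :: "complex poly" where
  "var \<equiv> [:0, 1:]"

definition exp_h :: "complex poly \<Rightarrow> complex poly fps" where
  "exp_h = exp_series (\<lambda>c. [:c:])"

text \<open>\<open>sinh(h x) / sinh(h)\<close> in \<open>\<complex>[x][[h]]\<close>. This ring is an integral domain, so the
  quotient is unique.\<close>

definition sinh_quotient :: "complex poly fps" where
  "sinh_quotient = (THE f. f * (exp_h 1 - exp_h (- 1)) = exp_h var - exp_h (- var))"

definition Uh_rels :: "((unit \<Rightarrow> nat) \<Rightarrow> sl2_gen free) set" where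
  "Uh_rels = insert
     (\<lambda>m. const_series free_algebra (gen Xp * gen Xm - gen Xm * gen Xp) m
        - eval_free (fps_nth sinh_quotient (m ())) (gen Hgen))
     (const_series free_algebra ` weight_rels Hgen Xp Xm)"

text \<open>The name of the parameter is immaterial: this is both \<open>U\<^sub>h(sl\<^sub>2)\<close> and \<open>U\<^sub>h\<^sub>'(sl\<^sub>2)\<close>.\<close>

definition Uh_sl2 ::
  "((unit \<Rightarrow> nat) \<Rightarrow> complex, ((unit \<Rightarrow> nat) \<Rightarrow> sl2_gen free) set) module" where
  "Uh_sl2 = top_generated Uh_rels"

definition Uh_basis :: "nat \<times> nat \<times> nat \<Rightarrow> ((unit \<Rightarrow> nat) \<Rightarrow> sl2_gen free) set" where
  "Uh_basis = pbw Uh_sl2 (top_gen Uh_rels Xm) (top_gen Uh_rels Hgen) (top_gen Uh_rels Xp)"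


section \<open>The two-parameter algebra\<close>

text \<open>\<open>\<complex>[x][[h,h']]\<close> is represented by \<^typ>\<open>complex poly fps fps\<close>, the inner variable being
  \<open>h\<close> and the outer one \<open>h'\<close>.\<close>

definition root_eps :: "nat \<Rightarrow> complex" where
  "root_eps g = exp (\<i> * of_real pi / of_nat g)"

text \<open>The Laurent polynomial \<open>P(u)\<close>; the argument \<open>v\<close> stands for the inverse of \<open>u\<close>.\<close>

definition laurent_P :: "nat \<Rightarrow> complex poly fps \<Rightarrow> complex poly fps \<Rightarrow> complex poly fps" where
  "laurent_P g u v =
     (let c = (\<lambda>z. fps_const [:z:]); \<epsilon> = root_eps g in
      c (1 / 2) * (u ^ (g - 1) + v ^ (g - 1)) *
      (\<Prod>k=1..<g. (c (\<epsilon> ^ k) * u - c (inverse (\<epsilon> ^ k)) * v) *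
                  c (inverse (\<epsilon> ^ k - inverse (\<epsilon> ^ k)))))"

definition brace_Q :: "nat \<Rightarrow> complex poly fps" where
  "brace_Q g = laurent_P g (exp_h var) (exp_h (- var))"

definition exp_h' :: "complex poly fps \<Rightarrow> complex poly fps fps" where
  "exp_h' = exp_series (\<lambda>c. fps_const [:c:])"

text \<open>\<open>QT_power g a\<close> is \<open>(Q T^{x})^a\<close>, i.e. \<open>exp(h a) exp(h' {x} a)\<close>, with \<open>{x}\<close> being \<open>brace_Q g\<close>.\<close>

definition QT_power :: "nat \<Rightarrow> complex poly \<Rightarrow> complex poly fps fps" where
  "QT_power g a = fps_const (exp_h a) * exp_h' (brace_Q g * fps_const a)"

definition F_series :: "nat \<Rightarrow> complex poly fps fps" where
  "F_series g =
     (THE f. f * (QT_power g 1 - QT_power g (- 1)) = QT_power g var - QT_power g (- var))"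

text \<open>\<open>\<complex>[H, \<surd>C]\<close> is represented by \<^typ>\<open>complex poly poly\<close>: the inner variable is \<open>H\<close>, the outer one
  is \<open>\<surd>C\<close>. \<open>H_arg e s\<close> is \<open>(\<surd>C + e H - s e) / 2\<close>, where \<open>s = 1\<close> gives the upper and \<open>s = -1\<close> the
  lower sign.\<close>

definition H_arg :: "complex \<Rightarrow> complex \<Rightarrow> complex poly poly" where
  "H_arg e s = [:[:- s * e / 2, e / 2:], [:1 / 2:]:]"

definition F_at :: "nat \<Rightarrow> complex poly poly \<Rightarrow> complex poly poly fps fps" where
  "F_at g p = Abs_fps (\<lambda>j. Abs_fps (\<lambda>i.
     poly (map_poly (\<lambda>c. [:[:c:]:]) (fps_nth (fps_nth (F_series g) j) i)) p))"

datatype sl2_gen_C = Xp_C | Xm_C | H_C | C_C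

datatype two_params = param_h | param_h'

instance two_params :: finite
proof
  have "(UNIV :: two_params set) = {param_h, param_h'}"
    using two_params.exhaust by auto
  then show "finite (UNIV :: two_params set)"
    by (metis finite.emptyI finite.insertI)
qed

text \<open>A polynomial in \<open>H\<close> and \<open>\<surd>C\<close> that is even in \<open>\<surd>C\<close>, as a polynomial in \<open>H\<close> and \<open>C\<close>. The order of
  the factors is immaterial since \<open>C\<close> and \<open>H\<close> commute in the quotient.\<close>

definition even_to_free :: "complex poly poly \<Rightarrow> sl2_gen_C free" where
  "even_to_free r = (\<Sum>k\<le>Polynomial.degree r.
     eval_free (Polynomial.coeff r (2 * k)) (gen H_C) * gen C_C ^ k)"

definition F_product :: "nat \<Rightarrow> complex \<Rightarrow> (two_params \<Rightarrow> nat) \<Rightarrow> sl2_gen_C free" where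
  "F_product g s = (\<lambda>m. even_to_free
     (fps_nth (fps_nth (F_at g (H_arg 1 s) * F_at g (H_arg (- 1) s)) (m param_h')) (m param_h)))"

definition Uhh_rels :: "nat \<Rightarrow> ((two_params \<Rightarrow> nat) \<Rightarrow> sl2_gen_C free) set" where
  "Uhh_rels g =
     const_series free_algebra `
       ((\<lambda>x. gen C_C * gen x - gen x * gen C_C) ` {Xp_C, Xm_C, H_C} \<union> weight_rels H_C Xp_C Xm_C) \<union>
     {\<lambda>m. const_series free_algebra (gen Xp_C * gen Xm_C) m - F_product g 1 m,
      \<lambda>m. const_series free_algebra (gen Xm_C * gen Xp_C) m - F_product g (- 1) m}"

definition Uhh_sl2 ::
  "nat \<Rightarrow> ((two_params \<Rightarrow> nat) \<Rightarrow> complex, ((two_params \<Rightarrow> nat) \<Rightarrow> sl2_gen_C free) set) module" where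
  "Uhh_sl2 g = top_generated (Uhh_rels g)"

definition Uhh_basis ::
  "nat \<Rightarrow> nat \<times> nat \<times> nat \<Rightarrow> ((two_params \<Rightarrow> nat) \<Rightarrow> sl2_gen_C free) set" where
  "Uhh_basis g =
     pbw (Uhh_sl2 g) (top_gen (Uhh_rels g) Xm_C) (top_gen (Uhh_rels g) H_C)
       (top_gen (Uhh_rels g) Xp_C)"

text \<open>\<open>join_series p q\<close> is the isomorphism \<open>\<complex>[[q]][[p]] \<rightarrow> \<complex>[[h,h']]\<close>, for \<open>{p, q} = {h, h'}\<close>.\<close>

definition join_series ::
  "two_params \<Rightarrow> two_params \<Rightarrow> ((unit \<Rightarrow> nat) \<Rightarrow> (unit \<Rightarrow> nat) \<Rightarrow> complex) \<Rightarrow>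
   (two_params \<Rightarrow> nat) \<Rightarrow> complex" where
  "join_series p q f = (\<lambda>m. f (\<lambda>_. m p) (\<lambda>_. m q))"

end

theory Submission
  imports Defs "HOL-Library.Function_Algebras"
begin

text \<open>
  Write \<open>F(x) = x G(x)\<close>, let \<open>C = 4 X\<^sup>- X\<^sup>+ + (H + 1)\<^sup>2\<close> be the Casimir element of \<open>U(sl\<^sub>2)\<close>, and put
  \<open>\<Gamma> = G(H\<^sub>1\<^sup>+) G(H\<^sub>-\<^sub>1\<^sup>+)\<close>, a series in \<open>H\<close> and \<open>C\<close> with constant term \<open>1\<close>. In \<open>U(sl\<^sub>2)\<close> the products
  \<open>X\<^sup>\<plusminus> X\<^sup>\<mp>\<close> are \<open>H\<^sub>1\<^sup>\<plusminus> H\<^sub>-\<^sub>1\<^sup>\<plusminus>\<close>, and \<open>X\<^sup>- f(H) = f(H + 2) X\<^sup>-\<close>; hence \<open>X\<^sup>-\<close>, \<open>H\<close>, \<open>C\<close> and \<open>\<Gamma> X\<^sup>+\<close>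
  satisfy the relations of the two-parameter algebra inside \<open>U(sl\<^sub>2)[[h,h']]\<close>. The resulting
  homomorphism from the power series over the free algebra is onto because it is so modulo the
  parameters. Its kernel is the closure of the ideal of relations: the lowest-order part of an
  element of the kernel lies in the kernel modulo the parameters, which is generated by the
  constant terms of the relations, so it can be lifted to the ideal of relations and subtracted.
  Thus the two-parameter algebra is \<open>U(sl\<^sub>2)[[h,h']]\<close>, and in the same way \<open>U\<^sub>h(sl\<^sub>2)\<close> is
  \<open>U(sl\<^sub>2)[[h]]\<close>, with \<open>\<Gamma>\<close> specialised at \<open>h' = 0\<close> (equivalently at \<open>h = 0\<close>). The identification
  through the PBW bases becomes \<open>(X\<^sup>-)\<^sup>a H\<^sup>b (X\<^sup>+)\<^sup>c \<mapsto> (X\<^sup>-)\<^sup>a H\<^sup>b (\<Gamma> X\<^sup>+)\<^sup>c\<close>, a linear map that is the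
  identity modulo the parameters, and this map is itself the trivialisation.
\<close>

section \<open>Power series over algebras\<close>

text \<open>The two specialisations of \<open>\<Gamma>\<close> agree because F is sinh(h x) /
  sinh(h) with h replaced by h + h' {x}. What is needed about F is carried over from the
  one-parameter quotient by a Taylor expansion, and P(1) = 1 makes {x} equal to 1 at h = 0. So h' =
  0 and h = 0 lead to the same one-parameter series, and 2) and 3) get a common proof.

  The obstacle in 2) and 3) is that the isomorphism of the one-parameter algebra with U[[h]] does
  not send its PBW basis to the monomials of U, but to monomials in a twisted X+. The linear map
  that matches the bases is therefore the two-parameter PBW map composed with the inverse of the
  one-parameter PBW map, taken coefficientwise. It is the identity modulo the remaining parameter
  because both twists coincide there.

  No basis is taken for granted. Independence of the PBW monomials of U comes from an explicit
  representation on polynomials, and the matching of the deformed bases from the fact that a linear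
  map of series that is the identity modulo the parameters is unitriangular, hence
  bijective.\<close>

lemma finite_le_multiindex [simp]: "finite {a::'s::finite \<Rightarrow> nat. a \<le> m}"
proof (rule finite_subset)
  show "{a. a \<le> m} \<subseteq> PiE UNIV (\<lambda>i. {..m i})"
    by (auto simp: le_fun_def)
qed (simp add: finite_PiE)

lemma (in abelian_monoid) finsum_Sigma:
  assumes "finite A" "\<And>a. a \<in> A \<Longrightarrow> finite (B a)"
    and "\<And>a b. a \<in> A \<Longrightarrow> b \<in> B a \<Longrightarrow> f a b \<in> carrier G"
  shows "(\<Oplus>a\<in>A. \<Oplus>b\<in>B a. f a b) = (\<Oplus>p\<in>Sigma A B. f (fst p) (snd p))"
  using assms
proof (induction A)
  case (insert x A)
  have split: "Sigma (insert x A) B = Pair x ` B x \<union> Sigma A B" by auto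
  have "(\<Oplus>p\<in>Pair x ` B x. f (fst p) (snd p)) = (\<Oplus>b\<in>B x. f x b)"
    using insert.prems by (subst finsum_reindex) (auto simp: inj_on_def)
  moreover have "(\<Oplus>p\<in>Sigma (insert x A) B. f (fst p) (snd p)) =
      (\<Oplus>p\<in>Pair x ` B x. f (fst p) (snd p)) \<oplus> (\<Oplus>p\<in>Sigma A B. f (fst p) (snd p))"
    unfolding split using insert by (intro finsum_Un_disjoint) auto
  ultimately show ?case
    using insert by (subst finsum_insert) (auto intro!: finsum_closed)
qed simp

text \<open>Both sides run over the triples of multi-indices with sum \<open>m\<close>; the map (a,
  b) |-> (a + b, a) passes from one enumeration to the other.\<close>

lemma (in abelian_monoid) finsum_convolution_assoc:
  fixes m :: "'s::finite \<Rightarrow> nat"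
  assumes "\<And>a b c. t a b c \<in> carrier G"
  shows "(\<Oplus>a\<in>{a. a \<le> m}. \<Oplus>b\<in>{b. b \<le> a}. t b (a - b) (m - a)) =
    (\<Oplus>a\<in>{a. a \<le> m}. \<Oplus>b\<in>{b. b \<le> m - a}. t a b (m - a - b))"
proof -
  let ?S = "Sigma {a. a \<le> m} (\<lambda>a. {b. b \<le> m - a})"
  let ?h = "\<lambda>p. (fst p + snd p, fst p)"
  have im: "Sigma {a. a \<le> m} (\<lambda>a. {b. b \<le> a}) = ?h ` ?S"
  proof (intro equalityI subsetI)
    fix p assume "p \<in> Sigma {a. a \<le> m} (\<lambda>a. {b. b \<le> a})"
    then obtain a b where p: "p = (a, b)" "b \<le> a" "a \<le> m" by auto
    then have "p = ?h (b, a - b)" "(b, a - b) \<in> ?S"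
      by (auto simp: le_fun_def fun_eq_iff intro: order_trans diff_le_mono)
    then show "p \<in> ?h ` ?S" by blast
  next
    fix p assume "p \<in> ?h ` ?S"
    then show "p \<in> Sigma {a. a \<le> m} (\<lambda>a. {b. b \<le> a})"
      by (fastforce simp: le_fun_def le_diff_conv2 add.commute)
  qed
  have "(\<Oplus>a\<in>{a. a \<le> m}. \<Oplus>b\<in>{b. b \<le> a}. t b (a - b) (m - a)) =
    (\<Oplus>p\<in>?h ` ?S. t (snd p) (fst p - snd p) (m - fst p))"
    unfolding im[symmetric] using assms by (subst finsum_Sigma) auto
  also have "\<dots> = (\<Oplus>p\<in>?S. t (fst p) (snd p) (m - fst p - snd p))"
    using assms by (subst finsum_reindex) (auto simp: inj_on_def diff_diff_add fun_eq_iff intro!: finsum_cong')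
  also have "\<dots> = (\<Oplus>a\<in>{a. a \<le> m}. \<Oplus>b\<in>{b. b \<le> m - a}. t a b (m - a - b))"
    using assms by (subst finsum_Sigma) auto
  finally show ?thesis .
qed

lemma bij_diff_multiindex: "bij_betw (\<lambda>a. m - a) {a. a \<le> m} {a::'s::finite \<Rightarrow> nat. a \<le> m}"
  by (rule bij_betw_byWitness[of _ "\<lambda>a. m - a"]) (auto simp: le_fun_def fun_eq_iff)

lemma (in abelian_monoid) finsum_single:
  assumes "finite A" "a \<in> A" "f a \<in> carrier G" "\<And>b. b \<in> A \<Longrightarrow> b \<noteq> a \<Longrightarrow> f b = \<zero>"
  shows "finsum G f A = f a"
proof -
  have "finsum G f A = (\<Oplus>b\<in>A. if a = b then f b else \<zero>)"
    using assms by (intro finsum_cong') auto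
  also have "\<dots> = f a" using finsum_singleton[of a A f] assms
    by (subst finsum_cong'[of A A "\<lambda>j. if a = j then f a else \<zero>"]) (auto simp: add.finprod_singleton_swap add.finprod_singleton)
  finally show ?thesis .
qed

lemma carrier_with_smult [simp]: "carrier (with_smult R s) = carrier R"
  and mult_with_smult [simp]: "monoid.mult (with_smult R s) = monoid.mult R"
  and one_with_smult [simp]: "one (with_smult R s) = one R"
  and zero_with_smult [simp]: "zero (with_smult R s) = zero R"
  and add_with_smult [simp]: "add (with_smult R s) = add R"
  and smult_with_smult [simp]: "module.smult (with_smult R s) = s"
  by (simp_all add: with_smult_def)

lemma ring_cong:
  assumes "ring R" "carrier S = carrier R" "monoid.mult S = monoid.mult R" "one S = one R"
    "zero S = zero R" "add S = add R"
  shows "ring S"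
proof -
  interpret R: ring R by fact
  show ?thesis
  proof (rule ringI)
    show "abelian_group S"
    proof (rule abelian_groupI)
      fix x assume "x \<in> carrier S"
      then show "\<exists>y\<in>carrier S. y \<oplus>\<^bsub>S\<^esub> x = \<zero>\<^bsub>S\<^esub>"
        using assms R.l_neg by (intro bexI[of _ "\<ominus>\<^bsub>R\<^esub> x"]) auto
    qed (auto simp: assms R.a_ac)
    show "monoid S" by (rule monoidI) (auto simp: assms R.m_assoc)
  qed (auto simp: assms R.l_distr R.r_distr)
qed

lemma ring_with_smult [simp]: "ring R \<Longrightarrow> ring (with_smult R s)"
  by (rule ring_cong) auto

context ring begin

lemma carrier_series_ring [simp]: "carrier (series_ring R) = {f. \<forall>m. f m \<in> carrier R}"
  and mult_series_ring: "f \<otimes>\<^bsub>series_ring R\<^esub> g = (\<lambda>m. \<Oplus>a\<in>{a. a \<le> m}. f a \<otimes> g (m - a))"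
  and add_series_ring [simp]: "f \<oplus>\<^bsub>series_ring R\<^esub> g = (\<lambda>m. f m \<oplus> g m)"
  and zero_series_ring [simp]: "\<zero>\<^bsub>series_ring R\<^esub> = (\<lambda>m. \<zero>)"
  and one_series_ring: "\<one>\<^bsub>series_ring R\<^esub> = const_series R \<one>"
  by (auto simp: series_ring_def const_series_def)

end

lemma zero_le_multiindex [simp]: "(\<lambda>_. 0) \<le> (m :: 's \<Rightarrow> nat)"
  and diff_le_multiindex [simp]: "m - a \<le> (m :: 's \<Rightarrow> nat)"
  and diff_zero_multiindex [simp]: "m - (\<lambda>_. 0) = (m :: 's \<Rightarrow> nat)"
  and diff_self_multiindex [simp]: "m - m = ((\<lambda>_. 0) :: 's \<Rightarrow> nat)"
  by (auto simp: le_fun_def fun_diff_def)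

lemma diff_diff_multiindex [simp]: "a \<le> m \<Longrightarrow> m - (m - a) = (a :: 's \<Rightarrow> nat)"
  by (auto simp: le_fun_def fun_eq_iff)

text \<open>The operation \<open>t\<close> may combine two different types into a third, so that the
  product of series and the action of scalar series are both instances.\<close>

definition conv :: "('b, 'm) ring_scheme \<Rightarrow> ('k \<Rightarrow> 'a \<Rightarrow> 'b) \<Rightarrow> (('s::finite \<Rightarrow> nat) \<Rightarrow> 'k) \<Rightarrow>
    (('s \<Rightarrow> nat) \<Rightarrow> 'a) \<Rightarrow> ('s \<Rightarrow> nat) \<Rightarrow> 'b" where
  "conv R t f g = (\<lambda>m. \<Oplus>\<^bsub>R\<^esub>a\<in>{a. a \<le> m}. t (f a) (g (m - a)))"

lemma (in abelian_monoid) conv_closed: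
  assumes "\<And>a b. t (f a) (g b) \<in> carrier G"
  shows "conv G t f g m \<in> carrier G"
  using assms by (auto simp: conv_def)

text \<open>One convolution lemma yields associativity of the product as well as the mixed
  associativity laws between scalars and elements.\<close>

lemma (in abelian_monoid) conv_assoc:
  fixes f :: "('s::finite \<Rightarrow> nat) \<Rightarrow> 'x"
  assumes closed: "\<And>a b c. t (u (f a) (g b)) (h c) \<in> carrier G"
    and assoc: "\<And>a b c. t (u (f a) (g b)) (h c) = t' (f a) (u' (g b) (h c))"
    and distr: "\<And>a c. t (\<Oplus>\<^bsub>H\<^esub>b\<in>{b. b \<le> a}. u (f b) (g (a - b))) (h c) =
      (\<Oplus>b\<in>{b. b \<le> a}. t (u (f b) (g (a - b))) (h c))"
    and distr': "\<And>a c. t' (f c) (\<Oplus>\<^bsub>H'\<^esub>b\<in>{b. b \<le> a}. u' (g b) (h (a - b))) =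
      (\<Oplus>b\<in>{b. b \<le> a}. t' (f c) (u' (g b) (h (a - b))))"
  shows "conv G t (conv H u f g) h = conv G t' f (conv H' u' g h)"
proof
  fix m
  have "conv G t (conv H u f g) h m =
     (\<Oplus>a\<in>{a. a \<le> m}. \<Oplus>b\<in>{b. b \<le> a}. t (u (f b) (g (a - b))) (h (m - a)))"
    unfolding conv_def using closed distr
    by (intro finsum_cong') auto
  also have "\<dots> = (\<Oplus>a\<in>{a. a \<le> m}. \<Oplus>b\<in>{b. b \<le> m - a}. t (u (f a) (g b)) (h (m - a - b)))"
    by (rule finsum_convolution_assoc) (rule closed)
  also have "\<dots> = conv G t' f (conv H' u' g h) m"
    unfolding conv_def using closed distr' by (intro finsum_cong') (auto simp: assoc)
  finally show "conv G t (conv H u f g) h m = conv G t' f (conv H' u' g h) m" .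
qed

lemma (in abelian_monoid) conv_const_left:
  assumes "\<And>b. t a (g b) \<in> carrier G" "\<And>b. t z (g b) = \<zero>"
  shows "conv G t (\<lambda>m. if m = (\<lambda>_. 0) then a else z) g m = t a (g m)"
  unfolding conv_def using assms
  by (subst finsum_single[of _ "\<lambda>_. 0"]) auto

lemma (in abelian_monoid) conv_const_right:
  assumes "\<And>b. t (f b) a \<in> carrier G" "\<And>b. t (f b) z = \<zero>"
  shows "conv G t f (\<lambda>m. if m = (\<lambda>_. 0) then a else z) m = t (f m) a"
proof -
  have "b = m" if "b \<le> m" "m - b = (\<lambda>_. 0)" for b
    using that by (auto simp: le_fun_def fun_eq_iff intro: antisym)
  then show ?thesis
    unfolding conv_def using assms
    by (subst finsum_single[of _ m]) auto
qed

lemma (in abelian_monoid) conv_add_left: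
  assumes "\<And>a b. t (f a) (h b) \<in> carrier G" "\<And>a b. t (g a) (h b) \<in> carrier G"
    "\<And>a b. t (p (f a) (g a)) (h b) = t (f a) (h b) \<oplus> t (g a) (h b)"
  shows "conv G t (\<lambda>m. p (f m) (g m)) h m = conv G t f h m \<oplus> conv G t g h m"
  unfolding conv_def using assms by simp

lemma (in abelian_monoid) conv_add_right:
  assumes "\<And>a b. t (h b) (f a) \<in> carrier G" "\<And>a b. t (h b) (g a) \<in> carrier G"
    "\<And>a b. t (h b) (p (f a) (g a)) = t (h b) (f a) \<oplus> t (h b) (g a)"
  shows "conv G t h (\<lambda>m. p (f m) (g m)) m = conv G t h f m \<oplus> conv G t h g m"
  unfolding conv_def using assms by simp

lemma (in abelian_monoid) conv_commute:
  assumes "\<And>a b. t (f a) (g b) \<in> carrier G" "\<And>a b. t (f a) (g b) = t' (g b) (f a)"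
  shows "conv G t f g m = conv G t' g f m"
proof -
  have "(\<Oplus>a\<in>{a. a \<le> m}. t (f a) (g (m - a))) =
     (\<Oplus>a\<in>(\<lambda>a. m - a) ` {a. a \<le> m}. t (f a) (g (m - a)))"
    using bij_diff_multiindex[of m] by (simp add: bij_betw_def)
  also have "\<dots> = (\<Oplus>a\<in>{a. a \<le> m}. t' (g a) (f (m - a)))"
    using bij_diff_multiindex[of m] assms
    by (subst finsum_reindex) (auto simp: bij_betw_def intro!: finsum_cong')
  finally show ?thesis by (simp add: conv_def)
qed

context ring begin

lemma mult_series_ring_conv: "f \<otimes>\<^bsub>series_ring R\<^esub> g = conv R (\<otimes>) f g"
  by (simp add: mult_series_ring conv_def)

lemma ring_series_ring: "ring (series_ring R :: (('s::finite \<Rightarrow> nat) \<Rightarrow> 'a) ring)"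
proof (rule ringI)
  show "abelian_group (series_ring R :: (('s \<Rightarrow> nat) \<Rightarrow> 'a) ring)"
  proof (rule abelian_groupI)
    fix x :: "('s \<Rightarrow> nat) \<Rightarrow> 'a" assume "x \<in> carrier (series_ring R)"
    then show "\<exists>y\<in>carrier (series_ring R). y \<oplus>\<^bsub>series_ring R\<^esub> x = \<zero>\<^bsub>series_ring R\<^esub>"
      by (intro bexI[of _ "\<lambda>m. \<ominus> x m"]) (auto simp: l_neg)
  qed (auto simp: a_ac)
  show "monoid (series_ring R :: (('s \<Rightarrow> nat) \<Rightarrow> 'a) ring)"
  proof (rule monoidI)
    fix x y z :: "('s \<Rightarrow> nat) \<Rightarrow> 'a"
    assume x: "x \<in> carrier (series_ring R)" and y: "y \<in> carrier (series_ring R)"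
      and z: "z \<in> carrier (series_ring R)"
    show "x \<otimes>\<^bsub>series_ring R\<^esub> y \<in> carrier (series_ring R)"
      using x y by (auto simp: mult_series_ring_conv intro!: conv_closed)
    show "x \<otimes>\<^bsub>series_ring R\<^esub> y \<otimes>\<^bsub>series_ring R\<^esub> z = x \<otimes>\<^bsub>series_ring R\<^esub> (y \<otimes>\<^bsub>series_ring R\<^esub> z)"
      unfolding mult_series_ring_conv
      by (intro conv_assoc; (rule finsum_ldistr | rule finsum_rdistr)?) (use x y z in \<open>auto simp: m_assoc\<close>)
  next
    fix x :: "('s \<Rightarrow> nat) \<Rightarrow> 'a" assume "x \<in> carrier (series_ring R)"
    then show "\<one>\<^bsub>series_ring R\<^esub> \<otimes>\<^bsub>series_ring R\<^esub> x = x" "x \<otimes>\<^bsub>series_ring R\<^esub> \<one>\<^bsub>series_ring R\<^esub> = x"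
      by (auto simp: mult_series_ring_conv one_series_ring const_series_def
        conv_const_left conv_const_right intro!: ext)
  qed (auto simp: one_series_ring const_series_def)
qed (auto simp: mult_series_ring_conv l_distr r_distr conv_add_left conv_add_right)

end

lemma (in cring) cring_series_ring: "cring (series_ring R :: (('s::finite \<Rightarrow> nat) \<Rightarrow> 'a) ring)"
proof -
  interpret S: ring "series_ring R :: (('s \<Rightarrow> nat) \<Rightarrow> 'a) ring" by (rule ring_series_ring)
  show ?thesis
    by unfold_locales (auto simp: mult_series_ring_conv m_comm intro!: conv_commute)
qed

lemma assoc_algebraI:
  fixes R (structure)
  assumes "module R M" "ring M"
    "\<And>k x y. \<lbrakk>k \<in> carrier R; x \<in> carrier M; y \<in> carrier M\<rbrakk>
      \<Longrightarrow> (k \<odot>\<^bsub>M\<^esub> x) \<otimes>\<^bsub>M\<^esub> y = k \<odot>\<^bsub>M\<^esub> (x \<otimes>\<^bsub>M\<^esub> y)"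
    "\<And>k x y. \<lbrakk>k \<in> carrier R; x \<in> carrier M; y \<in> carrier M\<rbrakk>
      \<Longrightarrow> x \<otimes>\<^bsub>M\<^esub> (k \<odot>\<^bsub>M\<^esub> y) = k \<odot>\<^bsub>M\<^esub> (x \<otimes>\<^bsub>M\<^esub> y)"
  shows "assoc_algebra R M"
  using assms by (auto simp: assoc_algebra_def assoc_algebra_axioms_def)

lemma (in module) finsum_smult_rdistr:
  "\<lbrakk>finite A; f \<in> A \<rightarrow> carrier R; x \<in> carrier M\<rbrakk> \<Longrightarrow>
     (\<Oplus>i\<in>A. f i) \<odot>\<^bsub>M\<^esub> x = (\<Oplus>\<^bsub>M\<^esub>i\<in>A. f i \<odot>\<^bsub>M\<^esub> x)"
  by (induction rule: finite_induct) (auto simp: Pi_iff smult_l_distr)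

text \<open>The record types are fixed to the plain ones for which \<open>series_algebra\<close> and
  \<open>formal_deformation\<close> are defined.\<close>

locale K_algebra = assoc_algebra R M for R :: "'k ring" (structure) and M :: "('k, 'a) module" (structure)
begin

lemma carrier_series_algebra [simp]: "carrier (series_algebra M) = {f. \<forall>m. f m \<in> carrier M}"
  and mult_series_algebra: "f \<otimes>\<^bsub>series_algebra M\<^esub> g = conv M (\<otimes>\<^bsub>M\<^esub>) f g"
  and add_series_algebra [simp]: "f \<oplus>\<^bsub>series_algebra M\<^esub> g = (\<lambda>m. f m \<oplus>\<^bsub>M\<^esub> g m)"
  and zero_series_algebra [simp]: "\<zero>\<^bsub>series_algebra M\<^esub> = (\<lambda>m. \<zero>\<^bsub>M\<^esub>)"
  and one_series_algebra: "\<one>\<^bsub>series_algebra M\<^esub> = const_series M \<one>\<^bsub>M\<^esub>"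
  and smult_series_algebra: "k \<odot>\<^bsub>series_algebra M\<^esub> f = conv M (\<odot>\<^bsub>M\<^esub>) k f"
  by (simp_all add: series_algebra_def one_series_ring mult_series_ring_conv conv_def)

theorem assoc_algebra_series:
  "assoc_algebra (series_ring R :: (('s::finite \<Rightarrow> nat) \<Rightarrow> _) ring) (series_algebra M)"
proof (rule assoc_algebraI)
  show ring: "ring (series_algebra M :: (('s \<Rightarrow> nat) \<Rightarrow> 'k, ('s \<Rightarrow> nat) \<Rightarrow> 'a) module)"
    unfolding series_algebra_def by (intro ring_with_smult ring_series_ring)
  show "module (series_ring R :: (('s \<Rightarrow> nat) \<Rightarrow> _) ring) (series_algebra M)"
  proof (rule moduleI)
    show "cring (series_ring R :: (('s \<Rightarrow> nat) \<Rightarrow> _) ring)" by (rule R.cring_series_ring)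
    show "abelian_group (series_algebra M :: (('s \<Rightarrow> nat) \<Rightarrow> 'k, ('s \<Rightarrow> nat) \<Rightarrow> 'a) module)"
      using ring by (rule ring.is_abelian_group)
  next
    fix a b :: "('s \<Rightarrow> nat) \<Rightarrow> 'k" and x :: "('s \<Rightarrow> nat) \<Rightarrow> 'a"
    assume *: "a \<in> carrier (series_ring R)" "b \<in> carrier (series_ring R)" "x \<in> carrier (series_algebra M)"
    show "(a \<otimes>\<^bsub>series_ring R\<^esub> b) \<odot>\<^bsub>series_algebra M\<^esub> x = a \<odot>\<^bsub>series_algebra M\<^esub> (b \<odot>\<^bsub>series_algebra M\<^esub> x)"
      unfolding smult_series_algebra R.mult_series_ring_conv
      by (intro conv_assoc; (rule finsum_smult_ldistr | rule finsum_smult_rdistr)?) (use * in \<open>auto simp: smult_assoc1\<close>)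
  qed (auto simp: smult_series_algebra smult_l_distr smult_r_distr conv_add_left conv_add_right
        R.one_series_ring const_series_def conv_const_left intro!: conv_closed ext)
next
  fix k :: "('s \<Rightarrow> nat) \<Rightarrow> 'k" and x y :: "('s \<Rightarrow> nat) \<Rightarrow> 'a"
  assume *: "k \<in> carrier (series_ring R)" "x \<in> carrier (series_algebra M)" "y \<in> carrier (series_algebra M)"
  show assoc: "(k \<odot>\<^bsub>series_algebra M\<^esub> x) \<otimes>\<^bsub>series_algebra M\<^esub> y = k \<odot>\<^bsub>series_algebra M\<^esub> (x \<otimes>\<^bsub>series_algebra M\<^esub> y)"
    unfolding smult_series_algebra mult_series_algebra
    by (intro conv_assoc; (rule finsum_smult_ldistr | rule finsum_ldistr)?) (use * in \<open>auto simp: smult_mult_left\<close>)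
  \<comment> \<open>The action of \<open>k\<close> on \<open>x\<close> is rewritten as a right
    action, so that associativity of convolution moves \<open>k\<close> past \<open>x\<close> onto
    \<open>y\<close>.\<close>
  have "k \<odot>\<^bsub>series_algebra M\<^esub> x = conv M (\<lambda>x k. k \<odot>\<^bsub>M\<^esub> x) x k"
    unfolding smult_series_algebra using * by (intro ext conv_commute) auto
  then have "k \<odot>\<^bsub>series_algebra M\<^esub> (x \<otimes>\<^bsub>series_algebra M\<^esub> y) = conv M (\<otimes>\<^bsub>M\<^esub>) (conv M (\<lambda>x k. k \<odot>\<^bsub>M\<^esub> x) x k) y"
    unfolding assoc[symmetric] by (simp add: mult_series_algebra)
  also have "\<dots> = conv M (\<otimes>\<^bsub>M\<^esub>) x (conv M (\<odot>\<^bsub>M\<^esub>) k y)"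
    by (intro conv_assoc; (rule finsum_ldistr | rule finsum_rdistr)?) (use * in \<open>auto simp: smult_mult_left smult_mult_right\<close>)
  finally show "x \<otimes>\<^bsub>series_algebra M\<^esub> (k \<odot>\<^bsub>series_algebra M\<^esub> y) = k \<odot>\<^bsub>series_algebra M\<^esub> (x \<otimes>\<^bsub>series_algebra M\<^esub> y)"
    by (simp add: smult_series_algebra mult_series_algebra)
qed

end

section \<open>Isomorphisms of algebras, transported structures and quotients\<close>

lemma algebra_isoI:
  assumes "bij_betw f (carrier M) (carrier N)"
    and "\<And>x y. x \<in> carrier M \<Longrightarrow> y \<in> carrier M \<Longrightarrow> f (x \<oplus>\<^bsub>M\<^esub> y) = f x \<oplus>\<^bsub>N\<^esub> f y"
    and "\<And>k x. k \<in> carrier K \<Longrightarrow> x \<in> carrier M \<Longrightarrow> f (k \<odot>\<^bsub>M\<^esub> x) = k \<odot>\<^bsub>N\<^esub> f x"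
    and "\<And>x y. x \<in> carrier M \<Longrightarrow> y \<in> carrier M \<Longrightarrow> f (x \<otimes>\<^bsub>M\<^esub> y) = f x \<otimes>\<^bsub>N\<^esub> f y"
    and "f \<one>\<^bsub>M\<^esub> = \<one>\<^bsub>N\<^esub>"
  shows "f \<in> algebra_iso K M N"
  using assms by (auto simp: algebra_iso_def module_iso_def ring_iso_def ring_hom_def dest: bij_betwE)

lemma algebra_isoD:
  assumes "f \<in> algebra_iso K M N"
  shows "bij_betw f (carrier M) (carrier N)"
    and "\<And>x. x \<in> carrier M \<Longrightarrow> f x \<in> carrier N"
    and "\<And>x y. x \<in> carrier M \<Longrightarrow> y \<in> carrier M \<Longrightarrow> f (x \<oplus>\<^bsub>M\<^esub> y) = f x \<oplus>\<^bsub>N\<^esub> f y"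
    and "\<And>k x. k \<in> carrier K \<Longrightarrow> x \<in> carrier M \<Longrightarrow> f (k \<odot>\<^bsub>M\<^esub> x) = k \<odot>\<^bsub>N\<^esub> f x"
    and "\<And>x y. x \<in> carrier M \<Longrightarrow> y \<in> carrier M \<Longrightarrow> f (x \<otimes>\<^bsub>M\<^esub> y) = f x \<otimes>\<^bsub>N\<^esub> f y"
    and "f \<one>\<^bsub>M\<^esub> = \<one>\<^bsub>N\<^esub>"
    and "f \<in> module_iso K M N"
  using assms by (auto simp: algebra_iso_def module_iso_def ring_iso_def ring_hom_def)

lemma module_isoI:
  assumes "bij_betw f (carrier M) (carrier N)"
    and "\<And>x y. x \<in> carrier M \<Longrightarrow> y \<in> carrier M \<Longrightarrow> f (x \<oplus>\<^bsub>M\<^esub> y) = f x \<oplus>\<^bsub>N\<^esub> f y"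
    and "\<And>k x. k \<in> carrier K \<Longrightarrow> x \<in> carrier M \<Longrightarrow> f (k \<odot>\<^bsub>M\<^esub> x) = k \<odot>\<^bsub>N\<^esub> f x"
  shows "f \<in> module_iso K M N"
  using assms by (auto simp: module_iso_def)

lemma module_isoD:
  assumes "f \<in> module_iso K M N"
  shows "bij_betw f (carrier M) (carrier N)"
    and "\<And>x. x \<in> carrier M \<Longrightarrow> f x \<in> carrier N"
    and "\<And>x y. x \<in> carrier M \<Longrightarrow> y \<in> carrier M \<Longrightarrow> f (x \<oplus>\<^bsub>M\<^esub> y) = f x \<oplus>\<^bsub>N\<^esub> f y"
    and "\<And>k x. k \<in> carrier K \<Longrightarrow> x \<in> carrier M \<Longrightarrow> f (k \<odot>\<^bsub>M\<^esub> x) = k \<odot>\<^bsub>N\<^esub> f x"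
  using assms by (auto simp: module_iso_def dest: bij_betwE)

lemma module_iso_trans:
  assumes "f \<in> module_iso K M N" "g \<in> module_iso K N P"
  shows "g \<circ> f \<in> module_iso K M P"
  using bij_betw_trans[OF module_isoD(1)[OF assms(1)] module_isoD(1)[OF assms(2)]]
    module_isoD[OF assms(1)] module_isoD[OF assms(2)]
  by (intro module_isoI) auto

lemma algebra_iso_trans:
  assumes "f \<in> algebra_iso K M N" "g \<in> algebra_iso K N P"
  shows "g \<circ> f \<in> algebra_iso K M P"
  using bij_betw_trans[OF algebra_isoD(1)[OF assms(1)] algebra_isoD(1)[OF assms(2)]]
    algebra_isoD[OF assms(1)] algebra_isoD[OF assms(2)]
  by (intro algebra_isoI) auto

lemma module_iso_inv:
  assumes f: "f \<in> module_iso K M N"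
    and "\<And>x y. x \<in> carrier M \<Longrightarrow> y \<in> carrier M \<Longrightarrow> x \<oplus>\<^bsub>M\<^esub> y \<in> carrier M"
    and "\<And>k x. k \<in> carrier K \<Longrightarrow> x \<in> carrier M \<Longrightarrow> k \<odot>\<^bsub>M\<^esub> x \<in> carrier M"
  shows "inv_into (carrier M) f \<in> module_iso K N M"
proof -
  let ?g = "inv_into (carrier M) f"
  have bij: "bij_betw f (carrier M) (carrier N)" using f by (rule module_isoD)
  have g: "?g y \<in> carrier M" "f (?g y) = y" if "y \<in> carrier N" for y
    using bij that by (auto simp: bij_betw_def inv_into_into f_inv_into_f)
  have gf: "?g (f x) = x" if "x \<in> carrier M" for x
    using bij that by (auto simp: bij_betw_def)
  show ?thesis
  proof (rule module_isoI)
    show "bij_betw ?g (carrier N) (carrier M)" using bij by (rule bij_betw_inv_into)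
  next
    fix x y assume "x \<in> carrier N" "y \<in> carrier N"
    then show "?g (x \<oplus>\<^bsub>N\<^esub> y) = ?g x \<oplus>\<^bsub>M\<^esub> ?g y"
      using gf[of "?g x \<oplus>\<^bsub>M\<^esub> ?g y"] g module_isoD(3)[OF f] assms(2) by simp
  next
    fix k x assume "k \<in> carrier K" "x \<in> carrier N"
    then show "?g (k \<odot>\<^bsub>N\<^esub> x) = k \<odot>\<^bsub>M\<^esub> ?g x"
      using gf[of "k \<odot>\<^bsub>M\<^esub> ?g x"] g module_isoD(4)[OF f] assms(3) by simp
  qed
qed

lemma (in K_algebra) algebra_iso_inv:
  assumes f: "f \<in> algebra_iso R M N"
  shows "inv_into (carrier M) f \<in> algebra_iso R N M"
proof -
  let ?g = "inv_into (carrier M) f"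
  have "?g \<in> module_iso R N M" by (rule module_iso_inv[OF algebra_isoD(7)[OF f]]) auto
  note g = module_isoD[OF this]
  have bij: "bij_betw f (carrier M) (carrier N)" using f by (rule algebra_isoD)
  have fg: "f (?g y) = y" if "y \<in> carrier N" for y
    using bij that by (auto simp: bij_betw_def inv_into_into f_inv_into_f)
  have gf: "?g (f x) = x" if "x \<in> carrier M" for x
    using bij that by (auto simp: bij_betw_def)
  show ?thesis
  proof (rule algebra_isoI)
    fix x y assume "x \<in> carrier N" "y \<in> carrier N"
    then show "?g (x \<otimes>\<^bsub>N\<^esub> y) = ?g x \<otimes>\<^bsub>M\<^esub> ?g y"
      using gf[of "?g x \<otimes>\<^bsub>M\<^esub> ?g y"] g fg algebra_isoD(5)[OF f] by simp
  next
    show "?g \<one>\<^bsub>N\<^esub> = \<one>\<^bsub>M\<^esub>" using gf[of "\<one>\<^bsub>M\<^esub>"] algebra_isoD(6)[OF f] by simp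
  qed (use g in auto)
qed

text \<open>Every law is pulled back along the injective \<open>f\<close>, and surjectivity supplies
  additive inverses. This covers quotients and transported products, whose laws are awkward to check
  directly.\<close>

lemma assoc_algebra_transfer:
  assumes N: "assoc_algebra K N" and f: "f \<in> algebra_iso K M N"
    and closed: "\<And>x y. x \<in> carrier M \<Longrightarrow> y \<in> carrier M \<Longrightarrow> x \<otimes>\<^bsub>M\<^esub> y \<in> carrier M"
      "\<And>x y. x \<in> carrier M \<Longrightarrow> y \<in> carrier M \<Longrightarrow> x \<oplus>\<^bsub>M\<^esub> y \<in> carrier M"
      "\<And>k x. k \<in> carrier K \<Longrightarrow> x \<in> carrier M \<Longrightarrow> k \<odot>\<^bsub>M\<^esub> x \<in> carrier M"
      "\<one>\<^bsub>M\<^esub> \<in> carrier M" "\<zero>\<^bsub>M\<^esub> \<in> carrier M"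
    and zero: "f \<zero>\<^bsub>M\<^esub> = \<zero>\<^bsub>N\<^esub>"
  shows "assoc_algebra K M"
proof -
  interpret N: assoc_algebra K N by fact
  note hom = algebra_isoD(2-6)[OF f] zero
  have inj: "x = y" if "f x = f y" "x \<in> carrier M" "y \<in> carrier M" for x y
    using algebra_isoD(1)[OF f] that by (auto simp: bij_betw_def dest: inj_onD)
  have surj: "\<exists>x\<in>carrier M. f x = y" if "y \<in> carrier N" for y
    using algebra_isoD(1)[OF f] that unfolding bij_betw_def by (metis imageE)
  have ab: "abelian_group M"
  proof (rule abelian_groupI)
    fix x assume x: "x \<in> carrier M"
    obtain y where "y \<in> carrier M" "f y = \<ominus>\<^bsub>N\<^esub> f x" using surj[of "\<ominus>\<^bsub>N\<^esub> f x"] x hom by auto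
    with x show "\<exists>y\<in>carrier M. y \<oplus>\<^bsub>M\<^esub> x = \<zero>\<^bsub>M\<^esub>"
      by (intro bexI[of _ y] inj) (simp_all add: hom closed N.M.l_neg)
  qed (auto intro!: inj simp: hom closed N.M.a_ac)
  have mon: "monoid M"
    by (rule monoidI) (auto intro!: inj simp: hom closed N.m_assoc)
  show ?thesis
  proof (rule assoc_algebraI)
    show "ring M"
      by (rule ringI[OF ab mon]) (auto intro!: inj simp: hom closed N.l_distr N.r_distr)
    show "module K M"
      by (rule moduleI[OF N.R.is_cring ab])
        (auto intro!: inj simp: hom closed N.smult_l_distr N.smult_r_distr N.smult_assoc1)
  qed (auto intro!: inj simp: hom closed N.smult_mult_left N.smult_mult_right)
qed

lemma hom_finsum:
  assumes "abelian_monoid G" "abelian_monoid H" "h \<zero>\<^bsub>G\<^esub> = \<zero>\<^bsub>H\<^esub>"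
    and "\<And>x. x \<in> carrier G \<Longrightarrow> h x \<in> carrier H"
    and "\<And>x y. x \<in> carrier G \<Longrightarrow> y \<in> carrier G \<Longrightarrow> h (x \<oplus>\<^bsub>G\<^esub> y) = h x \<oplus>\<^bsub>H\<^esub> h y"
    and "f \<in> A \<rightarrow> carrier G"
  shows "h (finsum G f A) = finsum H (\<lambda>a. h (f a)) A"
proof -
  interpret G: abelian_monoid G by fact
  interpret H: abelian_monoid H by fact
  show ?thesis
    using assms(6)
  proof (induction A rule: infinite_finite_induct)
    case (insert x A)
    then show ?case using assms(3-5)
      by (subst G.finsum_insert, simp, simp, force, force, subst H.finsum_insert)
         (auto simp: Pi_iff intro!: G.finsum_closed)
  qed (auto simp: assms finsum_def finprod_def)
qed

lemma hom_zero:
  assumes "abelian_group G" "abelian_group H"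
    and "\<And>x. x \<in> carrier G \<Longrightarrow> h x \<in> carrier H"
    and "\<And>x y. x \<in> carrier G \<Longrightarrow> y \<in> carrier G \<Longrightarrow> h (x \<oplus>\<^bsub>G\<^esub> y) = h x \<oplus>\<^bsub>H\<^esub> h y"
  shows "h \<zero>\<^bsub>G\<^esub> = \<zero>\<^bsub>H\<^esub>"
proof -
  interpret G: abelian_group G by fact
  interpret H: abelian_group H by fact
  have "h \<zero>\<^bsub>G\<^esub> \<oplus>\<^bsub>H\<^esub> h \<zero>\<^bsub>G\<^esub> = h \<zero>\<^bsub>G\<^esub>"
    using assms(4)[of "\<zero>\<^bsub>G\<^esub>" "\<zero>\<^bsub>G\<^esub>"] by simp
  then show ?thesis
    using assms(3)[of "\<zero>\<^bsub>G\<^esub>"] by (metis G.zero_closed H.add.l_cancel_one')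
qed

lemma bij_betw_pointwise:
  assumes "bij_betw h A B"
  shows "bij_betw (\<lambda>f m. h (f m)) {f. \<forall>m. f m \<in> A} {f. \<forall>m. f m \<in> B}"
  using assms
  by (intro bij_betw_byWitness[of _ "\<lambda>f m. inv_into A h (f m)"])
     (auto simp: bij_betw_def inv_into_into f_inv_into_f)

lemma series_module_iso:
  fixes K :: "'k ring" and A :: "('k, 'a) module" and A' :: "('k, 'b) module"
  assumes A: "assoc_algebra K A" and A': "assoc_algebra K A'" and h: "h \<in> module_iso K A A'"
  shows "(\<lambda>f (m :: 's::finite \<Rightarrow> nat). h (f m)) \<in> module_iso (series_ring K) (series_algebra A) (series_algebra A')"
proof -
  interpret A: K_algebra K A using A by (simp add: K_algebra_def)
  interpret A': K_algebra K A' using A' by (simp add: K_algebra_def)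
  note hD = module_isoD[OF h]
  have h0: "h \<zero>\<^bsub>A\<^esub> = \<zero>\<^bsub>A'\<^esub>"
    using hD by (intro hom_zero A.M.abelian_group_axioms A'.M.abelian_group_axioms) auto
  show ?thesis
  proof (rule module_isoI)
    fix k :: "('s \<Rightarrow> nat) \<Rightarrow> 'k" and x :: "('s \<Rightarrow> nat) \<Rightarrow> 'a" assume k: "k \<in> carrier (series_ring K)" and x: "x \<in> carrier (series_algebra A)"
    show "(\<lambda>m. h ((k \<odot>\<^bsub>series_algebra A\<^esub> x) m)) = k \<odot>\<^bsub>series_algebra A'\<^esub> (\<lambda>m. h (x m))"
    proof
      fix m
      have "h ((k \<odot>\<^bsub>series_algebra A\<^esub> x) m) = (\<Oplus>\<^bsub>A'\<^esub>a\<in>{a. a \<le> m}. h (k a \<odot>\<^bsub>A\<^esub> x (m - a)))"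
        unfolding A.smult_series_algebra conv_def using k x hD h0
        by (intro hom_finsum A.M.abelian_monoid_axioms A'.M.abelian_monoid_axioms) auto
      also have "\<dots> = (k \<odot>\<^bsub>series_algebra A'\<^esub> (\<lambda>m. h (x m))) m"
        unfolding A'.smult_series_algebra conv_def using k x hD
        by (intro A'.M.finsum_cong') auto
      finally show "h ((k \<odot>\<^bsub>series_algebra A\<^esub> x) m) = (k \<odot>\<^bsub>series_algebra A'\<^esub> (\<lambda>m. h (x m))) m" .
    qed
  qed (use hD bij_betw_pointwise[OF hD(1)] in auto)
qed

lemma series_algebra_iso:
  fixes K :: "'k ring" and A :: "('k, 'a) module" and A' :: "('k, 'b) module"
  assumes A: "assoc_algebra K A" and A': "assoc_algebra K A'" and h: "h \<in> algebra_iso K A A'"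
  shows "(\<lambda>f (m :: 's::finite \<Rightarrow> nat). h (f m)) \<in> algebra_iso (series_ring K) (series_algebra A) (series_algebra A')"
proof -
  interpret A: K_algebra K A using A by (simp add: K_algebra_def)
  interpret A': K_algebra K A' using A' by (simp add: K_algebra_def)
  note hD = algebra_isoD[OF h]
  note hm = module_isoD[OF series_module_iso[where 's = 's, OF A A' hD(7)]]
  have h0: "h \<zero>\<^bsub>A\<^esub> = \<zero>\<^bsub>A'\<^esub>"
    using hD by (intro hom_zero A.M.abelian_group_axioms A'.M.abelian_group_axioms) auto
  show ?thesis
  proof (rule algebra_isoI)
    fix x y :: "('s \<Rightarrow> nat) \<Rightarrow> 'a" assume k: "x \<in> carrier (series_algebra A)" and x: "y \<in> carrier (series_algebra A)"
    show "(\<lambda>m. h ((x \<otimes>\<^bsub>series_algebra A\<^esub> y) m)) = (\<lambda>m. h (x m)) \<otimes>\<^bsub>series_algebra A'\<^esub> (\<lambda>m. h (y m))"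
    proof
      fix m
      have "h ((x \<otimes>\<^bsub>series_algebra A\<^esub> y) m) = (\<Oplus>\<^bsub>A'\<^esub>a\<in>{a. a \<le> m}. h (x a \<otimes>\<^bsub>A\<^esub> y (m - a)))"
        unfolding A.mult_series_algebra conv_def using k x hD h0
        by (intro hom_finsum A.M.abelian_monoid_axioms A'.M.abelian_monoid_axioms) auto
      also have "\<dots> = ((\<lambda>m. h (x m)) \<otimes>\<^bsub>series_algebra A'\<^esub> (\<lambda>m. h (y m))) m"
        unfolding A'.mult_series_algebra conv_def using k x hD
        by (intro A'.M.finsum_cong') auto
      finally show "h ((x \<otimes>\<^bsub>series_algebra A\<^esub> y) m) = ((\<lambda>m. h (x m)) \<otimes>\<^bsub>series_algebra A'\<^esub> (\<lambda>m. h (y m))) m" .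
    qed
  qed (use hm hD h0 in \<open>auto simp: A.one_series_algebra A'.one_series_algebra const_series_def\<close>)
qed

text \<open>The isomorphism \<open>\<Phi>\<close> from \<open>B\<close> to constant series over a
  model \<open>A'\<close> need not match the bases; \<open>L\<close> measures the discrepancy. With
  \<open>a\<close> the coefficientwise \<open>\<alpha>\<close> and \<open>b\<close> its inverse,
  \<open>\<iota>\<close> is the inverse of \<open>\<Phi>\<close> after \<open>L\<close> and
  \<open>a\<close>, and \<open>\<phi>\<close> is \<open>b\<close> after \<open>\<Phi>\<close> and
  \<open>\<iota>\<close>, that is, \<open>b\<close> after \<open>L\<close> and \<open>a\<close>. The
  first form shows that \<open>\<phi>\<close> is multiplicative for the transported product, the
  second that it is the identity modulo the parameters. The index \<open>i0\<close> puts the unit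
  into both bases, so that the transported unit is the constant series 1.\<close>

theorem trivial_deformation_via_basesI:
  fixes K :: "'k ring" and A :: "('k, 'a) module" and A' :: "('k, 'c) module"
    and B :: "(('s::finite \<Rightarrow> nat) \<Rightarrow> 'k, 'b) module"
  assumes A: "assoc_algebra K A" and A': "assoc_algebra K A'" and \<alpha>: "\<alpha> \<in> algebra_iso K A A'"
    and B: "ring B" "\<And>k x. k \<in> carrier (series_ring K) \<Longrightarrow> x \<in> carrier B \<Longrightarrow> k \<odot>\<^bsub>B\<^esub> x \<in> carrier B"
    and \<Phi>: "\<Phi> \<in> algebra_iso (series_ring K) B (series_algebra A')"
    and L: "L \<in> module_iso (series_ring K) (series_algebra A') (series_algebra A')"
    and L0: "\<And>f. f \<in> carrier (series_algebra A') \<Longrightarrow> L f (\<lambda>_. 0) = f (\<lambda>_. 0)"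
    and e: "\<And>i. e i \<in> carrier A" "\<And>i. e' i \<in> carrier B"
    and Le: "\<And>i. L (const_series A' (\<alpha> (e i))) = \<Phi> (e' i)"
    and one: "e i0 = \<one>\<^bsub>A\<^esub>" "e' i0 = \<one>\<^bsub>B\<^esub>"
  shows "trivial_deformation_via_bases K A e B e'"
proof -
  interpret A: K_algebra K A using A by (simp add: K_algebra_def)
  interpret A': K_algebra K A' using A' by (simp add: K_algebra_def)
  interpret B: ring B by fact
  let ?SK = "series_ring K :: (('s \<Rightarrow> nat) \<Rightarrow> 'k) ring"
  let ?SA = "series_algebra A :: (('s \<Rightarrow> nat) \<Rightarrow> 'k, ('s \<Rightarrow> nat) \<Rightarrow> 'a) module"
  let ?SA' = "series_algebra A' :: (('s \<Rightarrow> nat) \<Rightarrow> 'k, ('s \<Rightarrow> nat) \<Rightarrow> 'c) module"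
  interpret SA: assoc_algebra ?SK ?SA by (rule A.assoc_algebra_series)
  interpret SA: K_algebra ?SK ?SA by unfold_locales
  interpret SA': assoc_algebra ?SK ?SA' by (rule A'.assoc_algebra_series)
  define a where "a = (\<lambda>f (m :: 's \<Rightarrow> nat). \<alpha> (f m))"
  define b where "b = inv_into (carrier ?SA) a"
  define \<Psi> where "\<Psi> = inv_into (carrier B) \<Phi>"
  define \<iota> where "\<iota> = \<Psi> \<circ> L \<circ> a"
  define T where "T = transport_algebra ?SA \<iota> B"
  define \<phi> where "\<phi> = b \<circ> \<Phi> \<circ> \<iota>"
  have a: "a \<in> algebra_iso ?SK ?SA ?SA'"
    unfolding a_def by (rule series_algebra_iso[OF A A' \<alpha>])
  have b: "b \<in> algebra_iso ?SK ?SA' ?SA"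
    unfolding b_def by (rule SA.algebra_iso_inv[OF a])
  note aD = algebra_isoD[OF a] and bD = algebra_isoD[OF b] and \<Phi>D = algebra_isoD[OF \<Phi>]
  have \<alpha>0: "\<alpha> \<zero>\<^bsub>A\<^esub> = \<zero>\<^bsub>A'\<^esub>"
    using algebra_isoD[OF \<alpha>] by (intro hom_zero A.M.abelian_group_axioms A'.M.abelian_group_axioms) auto
  have \<Psi>: "\<Psi> \<in> module_iso ?SK ?SA' B"
    unfolding \<Psi>_def by (rule module_iso_inv[OF \<Phi>D(7)]) (use B in auto)
  have ba: "b (a x) = x" if "x \<in> carrier ?SA" for x
    using aD(1) that by (auto simp: b_def bij_betw_def)
  have ab: "a (b x) = x" if "x \<in> carrier ?SA'" for x
    using aD(1) that by (auto simp: b_def bij_betw_def f_inv_into_f)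
  have \<Phi>\<Psi>: "\<Phi> (\<Psi> x) = x" if "x \<in> carrier ?SA'" for x
    using \<Phi>D(1) that by (auto simp: \<Psi>_def bij_betw_def f_inv_into_f)
  have \<Psi>\<Phi>: "\<Psi> (\<Phi> x) = x" if "x \<in> carrier B" for x
    using \<Phi>D(1) that by (auto simp: \<Psi>_def bij_betw_def)
  have \<iota>: "\<iota> \<in> module_iso ?SK ?SA B"
    unfolding \<iota>_def by (intro module_iso_trans[OF aD(7)] module_iso_trans[OF L] \<Psi>)
  note \<iota>D = module_isoD[OF \<iota>]
  have \<iota>_e: "\<iota> (const_series A (e i)) = e' i" for i
  proof -
    have "a (const_series A (e i)) = const_series A' (\<alpha> (e i))"
      by (auto simp: a_def const_series_def \<alpha>0)
    then show ?thesis using Le \<Psi>\<Phi> e by (simp add: \<iota>_def)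
  qed
  have inv\<iota>: "inv_into (carrier ?SA) \<iota> y \<in> carrier ?SA" "\<iota> (inv_into (carrier ?SA) \<iota> y) = y"
    if "y \<in> carrier B" for y
    using \<iota>D(1) that by (metis bij_betw_def inv_into_into, metis bij_betw_def f_inv_into_f)
  have carrT: "carrier T = carrier ?SA" and zeroT: "\<zero>\<^bsub>T\<^esub> = \<zero>\<^bsub>?SA\<^esub>"
    and addT: "x \<oplus>\<^bsub>T\<^esub> y = x \<oplus>\<^bsub>?SA\<^esub> y" and smultT: "k \<odot>\<^bsub>T\<^esub> x = k \<odot>\<^bsub>?SA\<^esub> x"
    and multT: "x \<otimes>\<^bsub>T\<^esub> y = inv_into (carrier ?SA) \<iota> (\<iota> x \<otimes>\<^bsub>B\<^esub> \<iota> y)"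
    and oneT: "\<one>\<^bsub>T\<^esub> = inv_into (carrier ?SA) \<iota> \<one>\<^bsub>B\<^esub>" for x y k
    by (simp_all add: T_def transport_algebra_def)
  have \<phi>m: "\<phi> \<in> module_iso ?SK ?SA ?SA"
    unfolding \<phi>_def by (intro module_iso_trans[OF \<iota>] module_iso_trans[OF \<Phi>D(7)] bD(7))
  have \<phi>_alt: "\<phi> f = b (L (a f))" if "f \<in> carrier ?SA" for f
    using \<Phi>\<Psi> module_isoD(2)[OF L] aD(2)[OF that] by (simp add: \<phi>_def \<iota>_def)
  have \<phi>: "\<phi> \<in> algebra_iso ?SK T ?SA"
  proof (rule algebra_isoI)
    fix x y assume "x \<in> carrier T" "y \<in> carrier T"
    then show "\<phi> (x \<otimes>\<^bsub>T\<^esub> y) = \<phi> x \<otimes>\<^bsub>?SA\<^esub> \<phi> y"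
      unfolding carrT using inv\<iota> \<iota>D \<Phi>D bD by (simp add: multT \<phi>_def del: A.carrier_series_algebra A'.carrier_series_algebra)
  next
    show "\<phi> \<one>\<^bsub>T\<^esub> = \<one>\<^bsub>?SA\<^esub>"
      using inv\<iota> \<Phi>D bD by (simp add: oneT \<phi>_def)
  qed (use module_isoD[OF \<phi>m] in \<open>simp_all add: carrT addT smultT del: A.add_series_algebra\<close>)
  have \<phi>0: "\<phi> f (\<lambda>_. 0) = f (\<lambda>_. 0)" if f: "f \<in> carrier ?SA" for f
  proof -
    have "\<alpha> (\<phi> f (\<lambda>_. 0)) = a (\<phi> f) (\<lambda>_. 0)" by (simp add: a_def)
    also have "\<dots> = L (a f) (\<lambda>_. 0)"
      using module_isoD(2)[OF L] aD(2)[OF f] by (simp add: \<phi>_alt[OF f] ab)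
    also have "\<dots> = \<alpha> (f (\<lambda>_. 0))" using L0[OF aD(2)[OF f]] by (simp add: a_def)
    finally show ?thesis
      using algebra_isoD(1)[OF \<alpha>] f module_isoD(2)[OF \<phi>m f] by (auto simp: bij_betw_def dest: inj_onD)
  qed
  have "assoc_algebra ?SK T"
  proof (rule assoc_algebra_transfer[OF SA.assoc_algebra_axioms \<phi>])
    show "\<phi> \<zero>\<^bsub>T\<^esub> = \<zero>\<^bsub>?SA\<^esub>" unfolding zeroT
      using module_isoD[OF \<phi>m]
      by (intro hom_zero[of ?SA ?SA \<phi>] SA.M.abelian_group_axioms)
    show "\<zero>\<^bsub>T\<^esub> \<in> carrier T" unfolding carrT zeroT by (rule SA.M.zero_closed)
    show "\<one>\<^bsub>T\<^esub> \<in> carrier T" using inv\<iota> by (simp add: carrT oneT)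
    fix x y assume xy: "x \<in> carrier T" "y \<in> carrier T"
    then show "x \<otimes>\<^bsub>T\<^esub> y \<in> carrier T" using inv\<iota> \<iota>D(2) by (simp add: carrT multT)
    show "x \<oplus>\<^bsub>T\<^esub> y \<in> carrier T" using xy unfolding carrT addT by (rule SA.M.a_closed)
  next
    fix k x assume "k \<in> carrier ?SK" "x \<in> carrier T"
    then show "k \<odot>\<^bsub>T\<^esub> x \<in> carrier T" unfolding carrT smultT by (rule SA.smult_closed)
  qed
  moreover have "\<one>\<^bsub>T\<^esub> = const_series A \<one>\<^bsub>A\<^esub>"
  proof -
    have "\<iota> (const_series A \<one>\<^bsub>A\<^esub>) = \<one>\<^bsub>B\<^esub>" using \<iota>_e[of i0] one by simp
    moreover have "const_series A \<one>\<^bsub>A\<^esub> \<in> carrier ?SA" by (auto simp: const_series_def)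
    ultimately show ?thesis
      using \<iota>D(1) unfolding oneT bij_betw_def by (metis inv_into_f_f)
  qed
  \<comment> \<open>Since \<open>\<phi>\<close> is multiplicative into the constant product and does
    not change constant terms, the transported product reduces to the product of
    \<open>A\<close>.\<close>
  moreover have "(f \<otimes>\<^bsub>T\<^esub> g) (\<lambda>_. 0) = f (\<lambda>_. 0) \<otimes>\<^bsub>A\<^esub> g (\<lambda>_. 0)"
    if f: "f \<in> carrier ?SA" and g: "g \<in> carrier ?SA" for f g
  proof -
    have "f \<otimes>\<^bsub>T\<^esub> g \<in> carrier ?SA" using f g inv\<iota> \<iota>D(2) by (simp add: multT)
    then have "(f \<otimes>\<^bsub>T\<^esub> g) (\<lambda>_. 0) = \<phi> (f \<otimes>\<^bsub>T\<^esub> g) (\<lambda>_. 0)" by (rule \<phi>0[symmetric])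
    also have "\<dots> = (\<phi> f \<otimes>\<^bsub>?SA\<^esub> \<phi> g) (\<lambda>_. 0)"
      using algebra_isoD(5)[OF \<phi>] f g by (simp add: carrT)
    also have "\<dots> = \<phi> f (\<lambda>_. 0) \<otimes>\<^bsub>A\<^esub> \<phi> g (\<lambda>_. 0)"
    proof -
      have "{a::'s \<Rightarrow> nat. a \<le> (\<lambda>_. 0)} = {\<lambda>_. 0}" by (auto simp: le_fun_def)
      then show ?thesis
        using module_isoD(2)[OF \<phi>m f] module_isoD(2)[OF \<phi>m g]
        by (simp add: A.mult_series_algebra conv_def zero_fun_def)
    qed
    finally show ?thesis using \<phi>0 f g by simp
  qed
  ultimately have "formal_deformation K A T"
    unfolding formal_deformation_def using A A.R.is_cring by (simp add: carrT zeroT addT smultT)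
  then have "trivial_formal_deformation K A T"
    unfolding trivial_formal_deformation_def using \<phi> \<phi>0 by (auto simp: carrT)
  then show ?thesis
    unfolding trivial_deformation_via_bases_def T_def using \<iota> \<iota>_e by blast
qed

text \<open>The first isomorphism theorem. Cosets of the kernel are fibres of \<open>h\<close>, so
  the union over representatives in the scalar action of \<open>quot_algebra\<close> collapses to
  one coset, and \<open>h\<close> takes a single value on each coset.\<close>

lemma quot_algebra:
  fixes P :: "('k, 'a) module" and S :: "('k, 'b) module"
  assumes P: "assoc_algebra K P" and S: "assoc_algebra K S"
    and h: "h \<in> ring_hom P S" "h ` carrier P = carrier S"
    and smult: "\<And>k x. k \<in> carrier K \<Longrightarrow> x \<in> carrier P \<Longrightarrow> h (k \<odot>\<^bsub>P\<^esub> x) = k \<odot>\<^bsub>S\<^esub> h x"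
    and I: "I = {x \<in> carrier P. h x = \<zero>\<^bsub>S\<^esub>}"
  shows quot_algebra_iso: "(\<lambda>Y. the_elem (h ` Y)) \<in> algebra_iso K (quot_algebra P I) S"
    and assoc_algebra_quot: "assoc_algebra K (quot_algebra P I)"
    and the_elem_coset: "\<And>x. x \<in> carrier P \<Longrightarrow> the_elem (h ` (I +>\<^bsub>P\<^esub> x)) = h x"
    and coset_in_quot: "\<And>x. x \<in> carrier P \<Longrightarrow> I +>\<^bsub>P\<^esub> x \<in> carrier (quot_algebra P I)"
proof -
  interpret P: ring P using P by (simp add: assoc_algebra_def)
  interpret S: ring S using S by (simp add: assoc_algebra_def)
  have smult_closed: "k \<odot>\<^bsub>P\<^esub> x \<in> carrier P" if "k \<in> carrier K" "x \<in> carrier P" for k x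
    using P that by (intro module.smult_closed) (auto simp: assoc_algebra_def)
  have hring: "ring_hom_ring P S h"
    by (rule ring_hom_ringI2[OF P.ring_axioms S.ring_axioms h(1)])
  have hD: "h x \<in> carrier S" "h (x \<oplus>\<^bsub>P\<^esub> y) = h x \<oplus>\<^bsub>S\<^esub> h y"
    if "x \<in> carrier P" "y \<in> carrier P" for x y
    using h(1) that by (auto simp: ring_hom_def)
  have ker: "I = a_kernel P S h" by (simp add: I a_kernel_def')
  have coset: "I +>\<^bsub>P\<^esub> x = {z \<in> carrier P. h z = h x}" if x: "x \<in> carrier P" for x
  proof (intro equalityI subsetI)
    fix z assume "z \<in> I +>\<^bsub>P\<^esub> x"
    then obtain i where "i \<in> I" "z = i \<oplus>\<^bsub>P\<^esub> x" by (auto simp: a_r_coset_def')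
    then show "z \<in> {z \<in> carrier P. h z = h x}" using x hD by (simp add: I)
  next
    fix z assume z: "z \<in> {z \<in> carrier P. h z = h x}"
    then have zx: "z = (z \<ominus>\<^bsub>P\<^esub> x) \<oplus>\<^bsub>P\<^esub> x" using x by (simp add: P.minus_eq P.a_assoc P.l_neg)
    have "h (z \<ominus>\<^bsub>P\<^esub> x) \<oplus>\<^bsub>S\<^esub> h x = h z"
      using hD(2)[of "z \<ominus>\<^bsub>P\<^esub> x" x] z x zx by simp
    also have "\<dots> = \<zero>\<^bsub>S\<^esub> \<oplus>\<^bsub>S\<^esub> h x" using z x hD(1)[of x x] by simp
    finally have "z \<ominus>\<^bsub>P\<^esub> x \<in> I"
      using z x hD(1)[of "z \<ominus>\<^bsub>P\<^esub> x" x] hD(1)[of x x] by (simp add: I)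
    with zx show "z \<in> I +>\<^bsub>P\<^esub> x" unfolding a_r_coset_def' by blast
  qed
  show te: "the_elem (h ` (I +>\<^bsub>P\<^esub> x)) = h x" if "x \<in> carrier P" for x
  proof -
    have "h ` (I +>\<^bsub>P\<^esub> x) = {h x}" using that by (auto simp: coset)
    then show ?thesis by simp
  qed
  let ?Q = "quot_algebra P I"
  have carrQ: "carrier ?Q = (\<lambda>x. I +>\<^bsub>P\<^esub> x) ` carrier P"
    by (auto simp: quot_algebra_def FactRing_def A_RCOSETS_def')
  then show "I +>\<^bsub>P\<^esub> x \<in> carrier ?Q" if "x \<in> carrier P" for x using that by auto
  have smultQ: "k \<odot>\<^bsub>?Q\<^esub> (I +>\<^bsub>P\<^esub> x) = I +>\<^bsub>P\<^esub> (k \<odot>\<^bsub>P\<^esub> x)" if "k \<in> carrier K" "x \<in> carrier P" for k x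
    using that by (auto simp: quot_algebra_def coset smult smult_closed)
  have iso: "(\<lambda>Y. the_elem (h ` Y)) \<in> ring_iso (P Quot I) S"
    unfolding ker by (rule ring_hom_ring.FactRing_iso_set[OF hring h(2)])
  have ringQ: "ring ?Q"
    unfolding quot_algebra_def
    by (intro ring_with_smult ideal.quotient_is_ring) (simp add: ker ring_hom_ring.kernel_is_ideal[OF hring])
  interpret Q: ring ?Q by fact
  show iso': "(\<lambda>Y. the_elem (h ` Y)) \<in> algebra_iso K ?Q S"
  proof (rule algebra_isoI)
    fix k Y assume "k \<in> carrier K" "Y \<in> carrier ?Q"
    then show "the_elem (h ` (k \<odot>\<^bsub>?Q\<^esub> Y)) = k \<odot>\<^bsub>S\<^esub> the_elem (h ` Y)"
      by (auto simp: carrQ smultQ te smult smult_closed)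
  qed (use iso in \<open>auto simp: quot_algebra_def ring_iso_def ring_hom_def\<close>)
  show "assoc_algebra K ?Q"
  proof (rule assoc_algebra_transfer[OF S iso'])
    fix k Y assume "k \<in> carrier K" "Y \<in> carrier ?Q"
    then show "k \<odot>\<^bsub>?Q\<^esub> Y \<in> carrier ?Q" by (auto simp: carrQ smultQ smult_closed)
  next
    show "the_elem (h ` \<zero>\<^bsub>?Q\<^esub>) = \<zero>\<^bsub>S\<^esub>"
      using algebra_isoD(2,3)[OF iso']
      by (intro hom_zero[where h = "\<lambda>Y. the_elem (h ` Y)"] Q.abelian_group_axioms S.abelian_group_axioms) auto
  qed auto
qed

section \<open>Power series over free algebras\<close>

lemma type_ring_simps [simp]:
  "carrier (ring_of_type_algebra :: 'a::ring_1 ring) = UNIV"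
  "x \<otimes>\<^bsub>ring_of_type_algebra\<^esub> y = x * (y :: 'a)"
  "x \<oplus>\<^bsub>ring_of_type_algebra\<^esub> y = x + (y :: 'a)"
  "\<zero>\<^bsub>ring_of_type_algebra\<^esub> = (0 :: 'a)"
  "\<one>\<^bsub>ring_of_type_algebra\<^esub> = (1 :: 'a)"
  by (simp_all add: ring_of_type_algebra_def)

lemma ring_type_ring: "ring (ring_of_type_algebra :: 'a::ring_1 ring)"
proof (rule ringI)
  show "abelian_group (ring_of_type_algebra :: 'a ring)"
    by (rule abelian_groupI) (auto simp: add_ac intro: exI[of _ "- _"])
  show "monoid (ring_of_type_algebra :: 'a ring)"
    by (rule monoidI) (auto simp: mult.assoc)
qed (auto simp: algebra_simps)

lemma finsum_eq_sum:
  assumes "abelian_monoid G" "carrier G = UNIV" "add G = (+)" "\<zero>\<^bsub>G\<^esub> = (0 :: 'a :: comm_monoid_add)"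
  shows "finsum G f A = sum f A"
proof -
  interpret G: abelian_monoid G by fact
  show ?thesis
  proof (induction A rule: infinite_finite_induct)
    case (insert x F)
    then show ?case using G.finsum_insert[of F x f] by (simp add: assms)
  qed (auto simp: assms finsum_def finprod_def)
qed

text \<open>A type with ring operations makes products of generators and ring simplification available;
  the ring laws are inherited from the carrier-based construction.\<close>

typedef ('s, 'a) mser = "UNIV :: (('s::finite \<Rightarrow> nat) \<Rightarrow> 'a) set"
  morphisms mcoeff Mser by simp

lemma mcoeff_Mser [simp]: "mcoeff (Mser f) = f"
  by (simp add: Mser_inverse)

lemma Mser_mcoeff [simp]: "Mser (mcoeff x) = x"
  by (rule mcoeff_inverse)

lemma mser_eqI: "(\<And>m. mcoeff x m = mcoeff y m) \<Longrightarrow> x = y"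
  by (metis mcoeff_inverse ext)

instantiation mser :: (finite, ring_1) ring_1
begin

definition zero_mser :: "('a, 'b) mser" where "zero_mser = Mser (\<lambda>_. 0)"
definition one_mser :: "('a, 'b) mser" where "one_mser = Mser (\<lambda>m. if m = (\<lambda>_. 0) then 1 else 0)"
definition plus_mser :: "('a, 'b) mser \<Rightarrow> ('a, 'b) mser \<Rightarrow> ('a, 'b) mser" where
  "plus_mser x y = Mser (\<lambda>m. mcoeff x m + mcoeff y m)"
definition minus_mser :: "('a, 'b) mser \<Rightarrow> ('a, 'b) mser \<Rightarrow> ('a, 'b) mser" where
  "minus_mser x y = Mser (\<lambda>m. mcoeff x m - mcoeff y m)"
definition uminus_mser :: "('a, 'b) mser \<Rightarrow> ('a, 'b) mser" where
  "uminus_mser x = Mser (\<lambda>m. - mcoeff x m)"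
definition times_mser :: "('a, 'b) mser \<Rightarrow> ('a, 'b) mser \<Rightarrow> ('a, 'b) mser" where
  "times_mser x y = Mser (\<lambda>m. \<Sum>a\<in>{a. a \<le> m}. mcoeff x a * mcoeff y (m - a))"

instance
proof
  interpret R: ring "ring_of_type_algebra :: 'b ring" by (rule ring_type_ring)
  interpret S: ring "series_ring (ring_of_type_algebra :: 'b ring) :: (('a \<Rightarrow> nat) \<Rightarrow> 'b) ring"
    by (rule R.ring_series_ring)
  let ?S = "series_ring (ring_of_type_algebra :: 'b ring) :: (('a \<Rightarrow> nat) \<Rightarrow> 'b) ring"
  have mult: "mcoeff (x * y) = mcoeff x \<otimes>\<^bsub>?S\<^esub> mcoeff y" for x y :: "('a, 'b) mser"
    by (simp add: times_mser_def R.mult_series_ring finsum_eq_sum[OF R.abelian_monoid_axioms] fun_eq_iff)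
  have one: "mcoeff (1 :: ('a, 'b) mser) = \<one>\<^bsub>?S\<^esub>"
    by (auto simp: one_mser_def R.one_series_ring const_series_def)
  have add: "mcoeff (x + y) = mcoeff x \<oplus>\<^bsub>?S\<^esub> mcoeff y" for x y :: "('a, 'b) mser"
    by (simp add: plus_mser_def)
  fix a b c :: "('a, 'b) mser"
  show "a * b * c = a * (b * c)" "1 * a = a" "a * 1 = a" "(a + b) * c = a * c + b * c" "a * (b + c) = a * b + a * c"
    by (simp_all add: mcoeff_inject[symmetric] mult one add S.m_assoc S.l_distr S.r_distr
        del: R.add_series_ring)
  show "a + b + c = a + (b + c)" "a + b = b + a" "0 + a = a" "- a + a = 0" "a - b = a + - b"
    by (simp_all add: plus_mser_def zero_mser_def uminus_mser_def minus_mser_def add_ac)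
  show "(0 :: ('a, 'b) mser) \<noteq> 1"
  proof
    assume "(0 :: ('a, 'b) mser) = 1"
    then have "mcoeff (0 :: ('a, 'b) mser) (\<lambda>_. 0) = mcoeff 1 (\<lambda>_. 0)" by simp
    then show False by (simp add: zero_mser_def one_mser_def)
  qed
qed

end

lemma mcoeff_simps [simp]:
  "mcoeff 0 = (\<lambda>_. 0)"
  "mcoeff (x + y) = (\<lambda>m. mcoeff x m + mcoeff y m)"
  "mcoeff (x - y) = (\<lambda>m. mcoeff x m - mcoeff y m)"
  "mcoeff (- x) = (\<lambda>m. - mcoeff x m)"
  by (simp_all add: zero_mser_def plus_mser_def minus_mser_def uminus_mser_def)

lemma mcoeff_mult: "mcoeff (x * y) m = (\<Sum>a\<in>{a. a \<le> m}. mcoeff x a * mcoeff y (m - a))"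
  by (simp add: times_mser_def)

lemma mcoeff_one: "mcoeff 1 = (\<lambda>m. if m = (\<lambda>_. 0) then 1 else 0)"
  by (simp add: one_mser_def)

lemma mcoeff_sum: "mcoeff (sum f A) m = (\<Sum>a\<in>A. mcoeff (f a) m)"
  by (induction A rule: infinite_finite_induct) auto

lemma multiindex_le_zero [simp]: "{a::'s \<Rightarrow> nat. a \<le> (\<lambda>_. 0)} = {\<lambda>_. 0}"
  by (auto simp: le_fun_def)

lemma mcoeff_mult_zero: "mcoeff (x * y) (\<lambda>_. 0) = mcoeff x (\<lambda>_. 0) * mcoeff y (\<lambda>_. 0)"
  by (simp add: mcoeff_mult del: diff_self_multiindex cancel_comm_monoid_add_class.diff_cancel)

definition mono :: "('s::finite \<Rightarrow> nat) \<Rightarrow> 'a::ring_1 \<Rightarrow> ('s, 'a) mser" where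
  "mono n c = Mser (\<lambda>m. if m = n then c else 0)"

lemma mcoeff_mono: "mcoeff (mono n c) m = (if m = n then c else 0)"
  by (simp add: mono_def)

lemma mcoeff_mono_mult: "mcoeff (mono n c * x) m = (if n \<le> m then c * mcoeff x (m - n) else 0)"
proof -
  have "mcoeff (mono n c * x) m = (\<Sum>a\<in>{a. a \<le> m}. if n = a then c * mcoeff x (m - n) else 0)"
    unfolding mcoeff_mult mcoeff_mono by (intro sum.cong) auto
  then show ?thesis by (simp add: sum.delta)
qed

lemma mcoeff_mult_mono: "mcoeff (x * mono n c) m = (if n \<le> m then mcoeff x (m - n) * c else 0)"
proof -
  have *: "m - a = n \<longleftrightarrow> a = m - n \<and> n \<le> m" if "a \<le> m" for a
    using that by auto
  have "mcoeff (x * mono n c) m = (\<Sum>a\<in>{a. a \<le> m}. if m - n = a then (if n \<le> m then mcoeff x (m - n) * c else 0) else 0)"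
    unfolding mcoeff_mult mcoeff_mono by (intro sum.cong) (auto simp: *)
  then show ?thesis by (simp add: sum.delta)
qed

abbreviation cser :: "'a::ring_1 \<Rightarrow> ('s::finite, 'a) mser" where
  "cser \<equiv> mono (\<lambda>_. 0)"

lemma mcoeff_cser_mult [simp]: "mcoeff (cser c * x) m = c * mcoeff x m"
  and mcoeff_mult_cser [simp]: "mcoeff (x * cser c) m = mcoeff x m * c"
  by (simp_all add: mcoeff_mono_mult mcoeff_mult_mono)

lemma mono_mult_mono: "mono m a * mono n b = mono (m + n) (a * b)"
proof (rule mser_eqI)
  fix k
  have "m \<le> k \<and> k - m = n \<longleftrightarrow> k = m + n"
    by (auto simp: le_fun_def fun_eq_iff) (metis le_add_diff_inverse)
  then show "mcoeff (mono m a * mono n b) k = mcoeff (mono (m + n) (a * b)) k"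
    by (auto simp: mcoeff_mono_mult mcoeff_mono)
qed

lemma mono_central: "mono m 1 * x = x * mono m 1"
  by (rule mser_eqI) (simp add: mcoeff_mono_mult mcoeff_mult_mono)

lemma cser_simps: "cser (a + b) = cser a + cser b" "cser (a * b) = cser a * cser b"
   "cser (a - b) = cser a - cser b" "cser 1 = 1" "cser 0 = 0"
  by (auto intro!: mser_eqI simp: mcoeff_mono mcoeff_one)

text \<open>A complex algebra whose elements form a whole type, given by a central map from the
  complex numbers. The free algebra, the enveloping algebra, the operators of its representation and
  the series over such algebras are all of this kind.\<close>

locale scalars =
  fixes sc :: "complex \<Rightarrow> 'a::ring_1"
  assumes sc_add: "sc (c + d) = sc c + sc d"
    and sc_mult: "sc (c * d) = sc c * sc d"
    and sc_one: "sc 1 = 1"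
    and sc_central: "sc c * x = x * sc c"
begin

lemma sc_zero: "sc 0 = 0"
  using sc_add[of 0 0] by simp

lemma scalars_cser: "scalars (\<lambda>c. cser (sc c) :: ('s::finite, 'a) mser)"
proof
  fix c and x :: "('s, 'a) mser"
  show "cser (sc c) * x = x * cser (sc c)"
    using sc_central by (intro mser_eqI) simp
qed (simp_all add: sc_add sc_mult sc_one cser_simps)

end

lemma single_Nil_one: "Poly_Mapping.single ([] :: 'x list) 1 = 1"
  using single_one[where 'a = "'x list"] unfolding zero_list_def .

definition free_hom :: "(complex \<Rightarrow> 'a::ring_1) \<Rightarrow> ('x \<Rightarrow> 'a) \<Rightarrow> 'x free \<Rightarrow> 'a" where
  "free_hom sc \<phi> p = (\<Sum>w\<in>Poly_Mapping.keys p. sc (Poly_Mapping.lookup p w) * prod_list (map \<phi> w))"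

lemma poly_mapping_single_induct [case_names zero single add]:
  fixes p :: "'a \<Rightarrow>\<^sub>0 'b::comm_monoid_add"
  assumes "P 0" "\<And>w c. P (Poly_Mapping.single w c)" "\<And>p q. P p \<Longrightarrow> P q \<Longrightarrow> P (p + q)"
  shows "P p"
proof -
  have "P (\<Sum>w\<in>A. Poly_Mapping.single w (Poly_Mapping.lookup p w))" if "finite A" for A
    using that by (induction A) (auto intro: assms)
  moreover have "(\<Sum>w\<in>Poly_Mapping.keys p. Poly_Mapping.single w (Poly_Mapping.lookup p w)) = p"
    by (rule poly_mapping_eqI)
       (simp add: lookup_sum lookup_single when_def sum.delta in_keys_iff)
  ultimately show ?thesis using finite_keys by metis
qed

context scalars begin

lemma free_hom_superset:
  assumes "finite A" "Poly_Mapping.keys p \<subseteq> A"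
  shows "free_hom sc \<phi> p = (\<Sum>w\<in>A. sc (Poly_Mapping.lookup p w) * prod_list (map \<phi> w))"
  unfolding free_hom_def using assms
  by (intro sum.mono_neutral_left) (auto simp: in_keys_iff sc_zero)

lemma free_hom_single: "free_hom sc \<phi> (Poly_Mapping.single w c) = sc c * prod_list (map \<phi> w)"
  by (subst free_hom_superset[of "{w}"]) auto

lemma free_hom_add: "free_hom sc \<phi> (p + q) = free_hom sc \<phi> p + free_hom sc \<phi> q"
proof -
  let ?A = "Poly_Mapping.keys p \<union> Poly_Mapping.keys q"
  have "free_hom sc \<phi> r = (\<Sum>w\<in>?A. sc (Poly_Mapping.lookup r w) * prod_list (map \<phi> w))"
    if "Poly_Mapping.keys r \<subseteq> ?A" for r
    using that by (intro free_hom_superset) auto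
  then show ?thesis
    using Poly_Mapping.keys_add[of p q]
    by (simp add: lookup_add sc_add distrib_right sum.distrib)
qed

lemma free_hom_zero: "free_hom sc \<phi> 0 = 0"
  by (simp add: free_hom_def)

lemma free_hom_mult: "free_hom sc \<phi> (p * q) = free_hom sc \<phi> p * free_hom sc \<phi> q"
proof (induction p rule: poly_mapping_single_induct)
  case (single v c)
  show ?case
  proof (induction q rule: poly_mapping_single_induct)
    case (single w d)
    have "prod_list (map \<phi> v) * (sc d * z) = sc d * (prod_list (map \<phi> v) * z)" for z
      by (metis mult.assoc sc_central)
    then show ?case
      by (simp add: mult_single free_hom_single plus_list_def sc_mult mult.assoc)
  qed (auto simp: free_hom_zero free_hom_add distrib_left)
qed (auto simp: free_hom_zero free_hom_add distrib_right)

lemma free_hom_gen [simp]: "free_hom sc \<phi> (gen x) = \<phi> x"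
  by (simp add: gen_def free_hom_single sc_one)

lemma free_hom_scalar [simp]: "free_hom sc \<phi> (scalar c) = sc c"
  by (simp add: scalar_def free_hom_single)

lemma free_hom_one: "free_hom sc \<phi> 1 = 1"
  using free_hom_scalar[of \<phi> 1] by (simp add: scalar_def sc_one single_Nil_one)

lemma free_hom_diff: "free_hom sc \<phi> (p - q) = free_hom sc \<phi> p - free_hom sc \<phi> q"
  using free_hom_add[of \<phi> "p - q" q] by simp

lemma free_hom_sum: "free_hom sc \<phi> (sum f A) = (\<Sum>a\<in>A. free_hom sc \<phi> (f a))"
  by (induction A rule: infinite_finite_induct) (auto simp: free_hom_zero free_hom_add)

lemma free_hom_power: "free_hom sc \<phi> (p ^ n) = free_hom sc \<phi> p ^ n"
  by (induction n) (auto simp: free_hom_one free_hom_mult)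

end

text \<open>The uniqueness half of the universal property: a homomorphism after an evaluation is
  again an evaluation. It identifies constant terms, and classes in a quotient, with evaluations at
  other generators.\<close>

lemma free_hom_comp:
  fixes h :: "'a::ring_1 \<Rightarrow> 'b::ring_1" and \<phi> :: "'x \<Rightarrow> 'a"
  assumes h: "\<And>x y. h (x + y) = h x + h y" "\<And>x y. h (x * y) = h x * h y" "h 1 = 1"
    and sc: "\<And>c. h (sc c) = sc' c"
  shows "h (free_hom sc \<phi> p) = free_hom sc' (\<lambda>x. h (\<phi> x)) p"
proof -
  have h0: "h 0 = 0" using h(1)[of 0 0] by simp
  have hs: "h (sum f A) = (\<Sum>a\<in>A. h (f a))" for f and A :: "'x list set"
    by (induction A rule: infinite_finite_induct) (auto simp: h h0)
  have hp: "h (prod_list xs) = prod_list (map h xs)" for xs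
    by (induction xs) (auto simp: h)
  show ?thesis by (simp add: free_hom_def hs h hp sc comp_def)
qed

lemma scalars_scalar: "scalars (scalar :: complex \<Rightarrow> 'x free)"
proof
  fix c and x :: "'x free"
  show "scalar c * x = x * scalar c"
    by (induction x rule: poly_mapping_single_induct)
       (auto simp: scalar_def mult_single plus_list_def distrib_left distrib_right mult.commute)
qed (auto simp: scalar_def single_add mult_single plus_list_def single_Nil_one)

interpretation free: scalars "scalar :: complex \<Rightarrow> 'x free" by (rule scalars_scalar)

text \<open>The way back from rings given by types to the carrier-based algebras of the
  theorem.\<close>

definition type_algebra :: "(complex \<Rightarrow> 'a) \<Rightarrow> (complex, 'a::ring_1) module" where
  "type_algebra sc = with_smult ring_of_type_algebra (\<lambda>c x. sc c * x)"

lemma free_algebra_eq: "free_algebra = type_algebra scalar"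
  by (simp add: free_algebra_def type_algebra_def)

lemma type_algebra_simps [simp]:
  "carrier (type_algebra sc) = UNIV"
  "x \<otimes>\<^bsub>type_algebra sc\<^esub> y = x * y"
  "x \<oplus>\<^bsub>type_algebra sc\<^esub> y = x + y"
  "\<zero>\<^bsub>type_algebra sc\<^esub> = 0"
  "\<one>\<^bsub>type_algebra sc\<^esub> = 1"
  "c \<odot>\<^bsub>type_algebra sc\<^esub> x = sc c * x"
  by (simp_all add: type_algebra_def)

lemma const_series_type [simp]: "const_series (type_algebra sc) a = mcoeff (cser a)"
  by (auto simp: const_series_def mcoeff_mono)

context scalars begin

lemma assoc_algebra_type: "assoc_algebra complex_ring (type_algebra sc)"
proof (rule assoc_algebraI)
  show ring: "ring (type_algebra sc)"
    unfolding type_algebra_def by (intro ring_with_smult ring_type_ring)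
  show "module complex_ring (type_algebra sc)"
    using ring.is_abelian_group[OF ring]
    by (intro moduleI cring_from_type_algebra) (auto simp: sc_add sc_mult sc_one algebra_simps)
  show "x \<otimes>\<^bsub>type_algebra sc\<^esub> (k \<odot>\<^bsub>type_algebra sc\<^esub> y) = k \<odot>\<^bsub>type_algebra sc\<^esub> (x \<otimes>\<^bsub>type_algebra sc\<^esub> y)" for k x y
    by (simp, metis mult.assoc sc_central)
qed (auto simp: mult.assoc)

interpretation T: K_algebra complex_ring "type_algebra sc"
  using assoc_algebra_type by (simp add: K_algebra_def)

text \<open>The dictionary by which statements about \<open>series_algebra\<close> become identities
  in the ring type \<open>mser\<close>.\<close>

lemma series_type_simps:
  "carrier (series_algebra (type_algebra sc) :: (_, ('s::finite \<Rightarrow> nat) \<Rightarrow> 'a) module) = UNIV"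
  "\<one>\<^bsub>series_algebra (type_algebra sc)\<^esub> = mcoeff (1 :: ('s, 'a) mser)"
  "\<zero>\<^bsub>series_algebra (type_algebra sc)\<^esub> = mcoeff (0 :: ('s, 'a) mser)"
  "f \<oplus>\<^bsub>series_algebra (type_algebra sc)\<^esub> g = mcoeff (Mser f + Mser g :: ('s, 'a) mser)"
  "f \<otimes>\<^bsub>series_algebra (type_algebra sc)\<^esub> g = mcoeff (Mser f * Mser g :: ('s, 'a) mser)"
  "k \<odot>\<^bsub>series_algebra (type_algebra sc)\<^esub> f = mcoeff (Mser (\<lambda>m. sc (k m)) * Mser f :: ('s, 'a) mser)"
  by (auto simp: T.one_series_algebra T.mult_series_algebra T.smult_series_algebra conv_def
     finsum_eq_sum[OF T.M.abelian_monoid_axioms] mcoeff_mult fun_eq_iff cser_simps)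

lemma assoc_algebra_series_type:
  "assoc_algebra (series_ring complex_ring :: (('s::finite \<Rightarrow> nat) \<Rightarrow> complex) ring)
     (series_algebra (type_algebra sc))"
  by (rule T.assoc_algebra_series)

lemma series_type_minus:
  "\<ominus>\<^bsub>series_algebra (type_algebra sc)\<^esub> f = mcoeff (- Mser f :: ('s::finite, 'a) mser)"
  "f \<ominus>\<^bsub>series_algebra (type_algebra sc)\<^esub> g = mcoeff (Mser f - Mser g :: ('s::finite, 'a) mser)"
proof -
  let ?S = "series_algebra (type_algebra sc) :: (('s \<Rightarrow> nat) \<Rightarrow> complex, ('s \<Rightarrow> nat) \<Rightarrow> 'a) module"
  interpret S: assoc_algebra "series_ring complex_ring" ?S by (rule assoc_algebra_series_type)
  show *: "\<ominus>\<^bsub>?S\<^esub> f = mcoeff (- Mser f)" for f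
    by (rule S.minus_equality) (auto simp: series_type_simps)
  show "f \<ominus>\<^bsub>?S\<^esub> g = mcoeff (Mser f - Mser g)"
    by (simp add: S.minus_eq * series_type_simps fun_eq_iff)
qed

end

section \<open>Presentations of power series algebras\<close>

lemma sum_multiindex_less:
  assumes "a < b"
  shows "sum a UNIV < sum (b :: 's::finite \<Rightarrow> nat) UNIV"
proof (rule sum_strict_mono_ex1)
  have le: "a x \<le> b x" for x using assms by (metis le_funD less_imp_le)
  then show "\<forall>x\<in>UNIV. a x \<le> b x" by simp
  have "\<exists>x. a x \<noteq> b x" using assms by (metis ext less_irrefl)
  then show "\<exists>x\<in>UNIV. a x < b x" using le by (metis UNIV_I le_neq_implies_less)
qed simp

lemma wf_multiindex_less: "wf {(a, b :: 's::finite \<Rightarrow> nat). a < b}"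
  by (rule wf_subset[OF wf_measure[of "\<lambda>m. sum m UNIV"]]) (auto intro: sum_multiindex_less)

lemma multiindex_le_split: "{a. a \<le> m} = insert m {a. a < (m :: 's \<Rightarrow> nat)}"
  by auto

lemma finite_less_multiindex [simp]: "finite {a. a < (m :: 's::finite \<Rightarrow> nat)}"
  by (rule finite_subset[OF _ finite_le_multiindex[of m]]) auto

lemma finite_multiindex_degree: "finite {m :: 's::finite \<Rightarrow> nat. sum m UNIV = n}"
proof (rule finite_subset)
  show "{m :: 's \<Rightarrow> nat. sum m UNIV = n} \<subseteq> {m. m \<le> (\<lambda>_. n)}"
    by (auto simp: le_fun_def intro: member_le_sum)
qed simp

text \<open>Well-founded recursion along the strict pointwise order. The condition at
  \<open>m\<close> may only look at smaller multi-indices, and its solution there may be an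
  unspecified choice.\<close>

lemma triangular_solution:
  fixes P :: "(('s::finite \<Rightarrow> nat) \<Rightarrow> 'b) \<Rightarrow> ('s \<Rightarrow> nat) \<Rightarrow> 'b \<Rightarrow> bool"
  assumes "\<And>f g m r. (\<And>a. a < m \<Longrightarrow> f a = g a) \<Longrightarrow> P f m r = P g m r" "\<And>m f. \<exists>r. P f m r"
  obtains f where "\<And>m. P f m (f m)"
proof -
  have "\<exists>f. \<forall>m. P f m (f m)"
  proof (rule dependent_wf_choice[OF wf_multiindex_less])
    fix f g :: "('s \<Rightarrow> nat) \<Rightarrow> 'b" and m r
    assume "\<And>a. (a, m) \<in> {(a, b). a < b} \<Longrightarrow> f a = g a"
    then show "P f m r = P g m r" by (intro assms(1)) simp
  qed (rule assms(2))
  then show ?thesis using that by blast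
qed

definition order_ge :: "nat \<Rightarrow> ('s::finite, 'a::ring_1) mser set" where
  "order_ge n = {x. \<forall>m. sum m UNIV < n \<longrightarrow> mcoeff x m = 0}"

context scalars begin

lemma ideal_mser:
  fixes T :: "('s::finite, 'a) mser set"
  assumes "0 \<in> T" "\<And>x y. x \<in> T \<Longrightarrow> y \<in> T \<Longrightarrow> x + y \<in> T"
    and "\<And>x y. x \<in> T \<Longrightarrow> x * y \<in> T" "\<And>x y. x \<in> T \<Longrightarrow> y * x \<in> T"
  shows "ideal (mcoeff ` T) (series_algebra (type_algebra sc))"
proof -
  let ?S = "series_algebra (type_algebra sc) :: (('s \<Rightarrow> nat) \<Rightarrow> complex, ('s \<Rightarrow> nat) \<Rightarrow> 'a) module"
  interpret S: assoc_algebra "series_ring complex_ring" ?S by (rule assoc_algebra_series_type)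
  show ?thesis
  proof (rule idealI)
    show "ring ?S" by (rule S.ring_axioms)
    show "subgroup (mcoeff ` T) (add_monoid ?S)"
    proof (rule S.add.subgroupI)
      fix a assume "a \<in> mcoeff ` T"
      then obtain x where x: "x \<in> T" "a = mcoeff x" by auto
      then have "- x \<in> T" using assms(4)[of x "-1"] by simp
      then show "\<ominus>\<^bsub>?S\<^esub> a \<in> mcoeff ` T"
        unfolding series_type_minus x(2) Mser_mcoeff by (rule imageI)
    next
      fix a b assume "a \<in> mcoeff ` T" "b \<in> mcoeff ` T"
      then show "a \<oplus>\<^bsub>?S\<^esub> b \<in> mcoeff ` T"
        unfolding series_type_simps using assms(2) by (auto simp del: mcoeff_simps)
    qed (use assms(1) in \<open>auto simp: series_type_simps\<close>)
  qed (unfold series_type_simps, use assms in auto)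
qed

definition ideal_span :: "(('s::finite \<Rightarrow> nat) \<Rightarrow> 'a) set \<Rightarrow> ('s, 'a) mser set" where
  "ideal_span R = {x. mcoeff x \<in> genideal (series_algebra (type_algebra sc)) R}"

lemma ideal_span:
  fixes R :: "(('s::finite \<Rightarrow> nat) \<Rightarrow> 'a) set" and x y :: "('s, 'a) mser"
  shows "0 \<in> ideal_span R"
    and "x \<in> ideal_span R \<Longrightarrow> y \<in> ideal_span R \<Longrightarrow> x + y \<in> ideal_span R"
    and "x \<in> ideal_span R \<Longrightarrow> x * y \<in> ideal_span R"
    and "x \<in> ideal_span R \<Longrightarrow> y * x \<in> ideal_span R"
    and "r \<in> R \<Longrightarrow> Mser r \<in> ideal_span R"
proof -
  let ?S = "series_algebra (type_algebra sc) :: (('s \<Rightarrow> nat) \<Rightarrow> complex, ('s \<Rightarrow> nat) \<Rightarrow> 'a) module"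
  interpret S: assoc_algebra "series_ring complex_ring" ?S by (rule assoc_algebra_series_type)
  have R: "R \<subseteq> carrier ?S" by (simp add: series_type_simps)
  note I = S.genideal_ideal[OF R]
  note Ia = additive_subgroup.a_closed[OF ideal.axioms(1)[OF I]]
  note I0 = additive_subgroup.zero_closed[OF ideal.axioms(1)[OF I]]
  show "0 \<in> ideal_span R" using I0 unfolding ideal_span_def series_type_simps by (simp only: mem_Collect_eq)
  show "x \<in> ideal_span R \<Longrightarrow> y \<in> ideal_span R \<Longrightarrow> x + y \<in> ideal_span R"
    using Ia[of "mcoeff x" "mcoeff y"]
    unfolding ideal_span_def series_type_simps Mser_mcoeff by (simp only: mem_Collect_eq)
  show "x \<in> ideal_span R \<Longrightarrow> x * y \<in> ideal_span R"
    using ideal.I_r_closed[OF I, of "mcoeff x" "mcoeff y"]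
    unfolding ideal_span_def series_type_simps Mser_mcoeff by (simp only: mem_Collect_eq UNIV_I)
  show "x \<in> ideal_span R \<Longrightarrow> y * x \<in> ideal_span R"
    using ideal.I_l_closed[OF I, of "mcoeff x" "mcoeff y"]
    unfolding ideal_span_def series_type_simps Mser_mcoeff by (simp only: mem_Collect_eq UNIV_I)
  show "r \<in> R \<Longrightarrow> Mser r \<in> ideal_span R"
    using S.genideal_self[OF R] by (auto simp: ideal_span_def)
qed

lemma genideal_mser_minimal:
  fixes R :: "(('s::finite \<Rightarrow> nat) \<Rightarrow> 'a) set"
  assumes "0 \<in> T" "\<And>x y. x \<in> T \<Longrightarrow> y \<in> T \<Longrightarrow> x + y \<in> T"
    and "\<And>x y. x \<in> T \<Longrightarrow> x * y \<in> T" "\<And>x y. x \<in> T \<Longrightarrow> y * x \<in> T" "\<And>r. r \<in> R \<Longrightarrow> Mser r \<in> T"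
    and "f \<in> genideal (series_algebra (type_algebra sc)) R"
  shows "Mser f \<in> T"
proof -
  let ?S = "series_algebra (type_algebra sc) :: (('s \<Rightarrow> nat) \<Rightarrow> complex, ('s \<Rightarrow> nat) \<Rightarrow> 'a) module"
  interpret S: assoc_algebra "series_ring complex_ring" ?S by (rule assoc_algebra_series_type)
  have "R \<subseteq> mcoeff ` T" using assms(5) by (metis image_eqI mcoeff_Mser subsetI)
  then have "genideal ?S R \<subseteq> mcoeff ` T"
    by (intro S.genideal_minimal ideal_mser assms)
  then show ?thesis using assms(6) by auto
qed

lemma order_ge_mult:
  assumes "x \<in> order_ge p" "y \<in> order_ge q"
  shows "x * y \<in> order_ge (p + q)"
proof -
  have "mcoeff x a * mcoeff y (m - a) = 0" if "sum m UNIV < p + q" "a \<le> m" for a m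
  proof -
    have "sum a UNIV + sum (m - a) UNIV = sum m UNIV"
      using that(2) by (simp add: le_fun_def flip: sum.distrib)
    then have "sum a UNIV < p \<or> sum (m - a) UNIV < q" using that(1) by linarith
    then show ?thesis using assms by (auto simp: order_ge_def)
  qed
  then show ?thesis by (simp add: order_ge_def mcoeff_mult)
qed

lemma order_ge_zero [simp]: "order_ge 0 = UNIV"
  by (simp add: order_ge_def)

lemma order_ge_add: "x \<in> order_ge n \<Longrightarrow> y \<in> order_ge n \<Longrightarrow> x + y \<in> order_ge n"
  by (simp add: order_ge_def)

lemma parameter_type: "parameter (type_algebra sc) i = mcoeff (mono (\<lambda>j. if j = i then 1 else 0) 1)"
  by (auto simp: parameter_def mcoeff_mono)

text \<open>The closure of the relations is taken for the powers of the ideal of the parameters,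
  which are iterated ideal products; total order makes approximation a condition on coefficients.
  One inclusion holds since orders add under products, the other since a series of order at least n
  + 1 is a sum of parameters times series of order at least n.\<close>

lemma ideal_power_parameters:
  "ideal_power (series_algebra (type_algebra sc))
     (genideal (series_algebra (type_algebra sc)) (range (parameter (type_algebra sc)))) n
   = mcoeff ` (order_ge n :: ('s::finite, 'a) mser set)"
proof -
  let ?S = "series_algebra (type_algebra sc) :: (('s \<Rightarrow> nat) \<Rightarrow> complex, ('s \<Rightarrow> nat) \<Rightarrow> 'a) module"
  let ?J = "genideal ?S (range (parameter (type_algebra sc)))"
  have J: "Mser f \<in> order_ge 1" if "f \<in> ?J" for f
  proof (rule genideal_mser_minimal[OF _ _ _ _ _ that])
    fix x y :: "('s, 'a) mser" assume "x \<in> order_ge 1"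
    then show "x * y \<in> order_ge 1" "y * x \<in> order_ge 1"
      using order_ge_mult[of x 1 y 0] order_ge_mult[of y 0 x 1] by simp_all
  next
    fix r assume "r \<in> range (parameter (type_algebra sc) :: 's \<Rightarrow> _)"
    then obtain i where r: "r = parameter (type_algebra sc) i" by auto
    have "(\<lambda>_. 0) \<noteq> (\<lambda>j. if j = i then 1 else 0 :: nat)" by (auto dest: fun_cong[of _ _ i])
    then show "Mser r \<in> order_ge 1" by (auto simp: r order_ge_def parameter_type mcoeff_mono)
  qed (auto simp: order_ge_def)
  show ?thesis
  proof (induction n)
    case 0
    have "mcoeff ` (UNIV :: ('s, 'a) mser set) = UNIV"
      by (metis mcoeff_Mser surjI)
    then show ?case by (simp add: ideal_power_def series_type_simps)
  next
    case (Suc n)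
    have eq: "ideal_power ?S ?J (Suc n) = ideal_prod ?S ?J (mcoeff ` (order_ge n :: ('s, 'a) mser set))"
      using Suc by (simp add: ideal_power_def)
    let ?R = "ideal_prod ?S ?J (mcoeff ` (order_ge n :: ('s, 'a) mser set))"
    have "f \<in> mcoeff ` (order_ge (Suc n) :: ('s, 'a) mser set)" if "f \<in> ?R" for f
      using that
    proof induction
      case (prod i j)
      then have "Mser i * Mser j \<in> order_ge (1 + n)" using J by (intro order_ge_mult) auto
      then show ?case by (auto simp: series_type_simps)
    next
      case (sum s1 s2)
      then show ?case
        unfolding series_type_simps by (auto simp del: mcoeff_simps intro: order_ge_add)
    qed
    moreover have "mcoeff x \<in> ?R" if x: "x \<in> order_ge (Suc n)" for x :: "('s, 'a) mser"
    proof -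
      \<comment> \<open>Each nonzero multi-index \<open>m\<close> is assigned to one parameter
        \<open>s m\<close> occurring in it. Then \<open>y i\<close> collects the terms of
        \<open>x\<close> assigned to \<open>i\<close>, divided by that parameter, whose exponent
        vector is \<open>u i\<close>.\<close>
      define s where "s = (\<lambda>m :: 's \<Rightarrow> nat. SOME i. m i > 0)"
      define u where "u = (\<lambda>i j :: 's. if j = i then 1 else 0 :: nat)"
      define y where "y = (\<lambda>i. Mser (\<lambda>m. if s (m + u i) = i then mcoeff x (m + u i) else 0))"
      have s: "m (s m) > 0" if "m \<noteq> (\<lambda>_. 0)" for m
        unfolding s_def using that by (intro someI_ex[of "\<lambda>i. m i > 0"]) auto
      have u_le: "u i \<le> m \<longleftrightarrow> m i > 0" for i m by (auto simp: u_def le_fun_def)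
      have add_u: "m - u i + u i = m" if "m i > 0" for m i
        using that by (auto simp: u_def fun_eq_iff)
      have "y i \<in> order_ge n" for i
        using x by (auto simp: order_ge_def y_def u_def sum.distrib)
      moreover have "mcoeff (mono (u i) 1) \<in> ?J" for i
        using ideal_span(5)[of "parameter (type_algebra sc) i" "range (parameter (type_algebra sc))"]
        by (auto simp: parameter_type u_def ideal_span_def)
      ultimately have uy: "mcoeff (mono (u i) 1 * y i) \<in> ?R" for i
        using ideal_prod.prod[of "mcoeff (mono (u i) 1)" ?J "mcoeff (y i)" "mcoeff ` order_ge n" ?S]
        by (simp add: series_type_simps)
      have R_add: "mcoeff (a + b) \<in> ?R" if "mcoeff a \<in> ?R" "mcoeff b \<in> ?R" for a b
        using ideal_prod.sum[OF that] by (simp only: series_type_simps Mser_mcoeff)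
      have R_sum: "mcoeff (sum f A) \<in> ?R" if "finite A" "A \<noteq> {}" "\<And>i. mcoeff (f i) \<in> ?R" for f and A :: "'s set"
        using that by (induction A rule: finite_ne_induct) (auto intro: R_add simp del: mcoeff_simps)
      have "mcoeff x m = mcoeff (\<Sum>i\<in>UNIV. mono (u i) 1 * y i) m" for m
      proof (cases "m = (\<lambda>_. 0)")
        case True
        then show ?thesis using x by (simp add: mcoeff_sum mcoeff_mono_mult u_le order_ge_def)
      next
        case False
        have "mcoeff (\<Sum>i\<in>UNIV. mono (u i) 1 * y i) m = (\<Sum>i\<in>UNIV. if s m = i then mcoeff x m else 0)"
          unfolding mcoeff_sum mcoeff_mono_mult u_le
          using s[OF False] by (intro sum.cong) (auto simp: y_def add_u)
        then show ?thesis by simp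
      qed
      then have "x = (\<Sum>i\<in>UNIV. mono (u i) 1 * y i)" by (rule mser_eqI)
      then show ?thesis using R_sum[of UNIV "\<lambda>i. mono (u i) 1 * y i"] uy by simp
    qed
    ultimately show ?case unfolding eq by blast
  qed
qed

end

lemma sum_convolution_assoc:
  fixes t :: "('s::finite \<Rightarrow> nat) \<Rightarrow> ('s \<Rightarrow> nat) \<Rightarrow> ('s \<Rightarrow> nat) \<Rightarrow> 'm::ring_1"
  shows "(\<Sum>a\<in>{a. a \<le> m}. \<Sum>b\<in>{b. b \<le> a}. t b (a - b) (m - a)) =
    (\<Sum>a\<in>{a. a \<le> m}. \<Sum>b\<in>{b. b \<le> m - a}. t a b (m - a - b))"
proof -
  interpret R: ring "ring_of_type_algebra :: 'm ring" by (rule ring_type_ring)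
  show ?thesis
    using R.finsum_convolution_assoc[of t m]
    by (simp add: finsum_eq_sum[OF R.abelian_monoid_axioms] fun_eq_iff)
qed

locale series_hom = scalars sc for sc :: "complex \<Rightarrow> 'm::ring_1" +
  fixes \<phi> :: "'x \<Rightarrow> ('s::finite, 'm) mser"
begin

interpretation S: scalars "\<lambda>c. cser (sc c) :: ('s, 'm) mser"
  by (rule scalars_cser)

abbreviation H :: "'x free \<Rightarrow> ('s, 'm) mser" where
  "H \<equiv> free_hom (\<lambda>c. cser (sc c)) \<phi>"

text \<open>A series with coefficients f_a is sent to the sum of h^a H(f_a), where H(f_a) is itself
  a series. Coefficient \<open>m\<close> only involves a \<le> m, so the sum is finite and
  convergence is built into the formula.\<close>

definition ext :: "('s, 'x free) mser \<Rightarrow> ('s, 'm) mser" where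
  "ext f = Mser (\<lambda>m. \<Sum>a\<in>{a. a \<le> m}. mcoeff (H (mcoeff f a)) (m - a))"

lemma ext_add: "ext (f + g) = ext f + ext g"
  by (rule mser_eqI) (simp add: ext_def S.free_hom_add sum.distrib)

lemma ext_zero: "ext 0 = 0"
  by (rule mser_eqI) (simp add: ext_def S.free_hom_zero)

lemma ext_diff: "ext (f - g) = ext f - ext g"
  using ext_add[of "f - g" g] by simp

lemma ext_truncate:
  assumes "m \<le> N"
  shows "mcoeff (ext f) m = mcoeff (\<Sum>a\<in>{a. a \<le> N}. mono a 1 * H (mcoeff f a)) m"
proof -
  have "mcoeff (\<Sum>a\<in>{a. a \<le> N}. mono a 1 * H (mcoeff f a)) m =
      (\<Sum>a\<in>{a. a \<le> N}. if a \<le> m then mcoeff (H (mcoeff f a)) (m - a) else 0)"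
    by (simp add: mcoeff_sum mcoeff_mono_mult cong: if_cong)
  also have "\<dots> = (\<Sum>a\<in>{a. a \<le> m}. mcoeff (H (mcoeff f a)) (m - a))"
    using assms by (intro sum.mono_neutral_cong_right) auto
  finally show ?thesis by (simp add: ext_def)
qed

text \<open>Coefficient \<open>N\<close> of a product sees only coefficients up to \<open>N\<close>,
  so both factors may be replaced by the finite sums of \<open>ext_truncate\<close>. There the
  central monomials move out of the products, and the double sum is regrouped by total
  exponent.\<close>

lemma ext_mult: "ext (f * g) = ext f * ext g"
proof (rule mser_eqI)
  fix N
  let ?F = "\<lambda>f. \<Sum>a\<in>{a. a \<le> N}. mono a 1 * H (mcoeff f a)"
  have m: "mono a 1 * x * (mono b 1 * y) = mono (a + b) 1 * (x * y)" for a b and x y :: "('s, 'm) mser"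
  proof -
    have "mono a 1 * x * (mono b 1 * y) = mono a 1 * (x * mono b 1) * y" by (simp add: mult.assoc)
    also have "\<dots> = mono a 1 * (mono b 1 * x) * y" by (simp only: mono_central[of b x])
    also have "\<dots> = mono a 1 * mono b 1 * (x * y)" by (simp only: mult.assoc)
    finally show ?thesis unfolding mono_mult_mono by simp
  qed
  have le: "a + b \<le> N \<longleftrightarrow> b \<le> N - a" "N - (a + b) = N - a - b" if "a \<le> N" for a b
  proof -
    show "a + b \<le> N \<longleftrightarrow> b \<le> N - a" using that by (simp add: le_fun_def le_diff_conv2 add.commute)
    show "N - (a + b) = N - a - b" by (simp add: fun_eq_iff)
  qed
  have "mcoeff (ext f * ext g) N = mcoeff (?F f * ?F g) N"
    unfolding mcoeff_mult by (intro sum.cong arg_cong2[of _ _ _ _ "(*)"] ext_truncate) auto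
  also have "\<dots> = (\<Sum>a\<in>{a. a \<le> N}. \<Sum>b\<in>{b. b \<le> N}.
      if b \<le> N - a then mcoeff (H (mcoeff f a) * H (mcoeff g b)) (N - a - b) else 0)"
    unfolding sum_product m mcoeff_sum mcoeff_mono_mult by (intro sum.cong) (auto simp: le)
  also have "\<dots> = (\<Sum>a\<in>{a. a \<le> N}. \<Sum>b\<in>{b. b \<le> N - a}. mcoeff (H (mcoeff f a * mcoeff g b)) (N - a - b))"
    by (intro sum.cong sum.mono_neutral_cong_right)
       (auto simp: S.free_hom_mult intro: order_trans[OF _ diff_le_multiindex])
  also have "\<dots> = (\<Sum>a\<in>{a. a \<le> N}. \<Sum>b\<in>{b. b \<le> a}. mcoeff (H (mcoeff f b * mcoeff g (a - b))) (N - a))"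
    by (rule sum_convolution_assoc[symmetric])
  also have "\<dots> = mcoeff (ext (f * g)) N"
    by (simp add: ext_def mcoeff_mult S.free_hom_sum mcoeff_sum)
  finally show "mcoeff (ext (f * g)) N = mcoeff (ext f * ext g) N" by simp
qed

text \<open>Constant images cause no carry into higher orders. This applies to scalars and to the
  parts of the relations written in H and C, whose images are constant series.\<close>

lemma ext_diagonal:
  assumes "\<And>a. H (mcoeff f a) = cser (c a)"
  shows "ext f = Mser c"
proof (rule mser_eqI)
  fix m
  have "mcoeff (ext f) m = (\<Sum>a\<in>{a. a \<le> m}. if m = a then c m else 0)"
  proof -
    have "m - a = (\<lambda>_. 0) \<longleftrightarrow> m = a" if "a \<le> m" for a
      using diff_diff_multiindex[OF that] by auto
    then show ?thesis
      unfolding ext_def assms mcoeff_mono mcoeff_Mser by (intro sum.cong) auto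
  qed
  then show "mcoeff (ext f) m = mcoeff (Mser c) m" by simp
qed

lemma ext_scalar: "ext (Mser (\<lambda>m. scalar (k m))) = Mser (\<lambda>m. sc (k m))"
  by (rule ext_diagonal) simp

lemma ext_cser: "ext (cser p) = H p"
proof (rule mser_eqI)
  fix m
  have "mcoeff (ext (cser p)) m = (\<Sum>a\<in>{a. a \<le> m}. if (\<lambda>_. 0) = a then mcoeff (H p) m else 0)"
    unfolding ext_def mcoeff_mono mcoeff_Mser by (intro sum.cong) (auto simp: S.free_hom_zero)
  then show "mcoeff (ext (cser p)) m = mcoeff (H p) m" by simp
qed

lemma ext_one: "ext 1 = 1"
  using ext_cser[of 1] by (simp add: cser_simps S.free_hom_one)

lemma H_zero: "mcoeff (H p) (\<lambda>_. 0) = free_hom sc (\<lambda>x. mcoeff (\<phi> x) (\<lambda>_. 0)) p"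
  by (rule free_hom_comp) (auto simp: mcoeff_mult_zero mcoeff_one mcoeff_mono)

text \<open>Below \<open>m\<close> the coefficients of \<open>f\<close> vanish, so only the term
  with index \<open>m\<close> survives, and of its image only the constant term is seen.\<close>

lemma ext_lowest:
  assumes "f \<in> order_ge n" "sum m UNIV = n"
  shows "mcoeff (ext f) m = free_hom sc (\<lambda>x. mcoeff (\<phi> x) (\<lambda>_. 0)) (mcoeff f m)"
proof -
  have "mcoeff f a = 0" if "a < m" for a
    using assms sum_multiindex_less[OF that] by (auto simp: order_ge_def)
  then show ?thesis
    by (simp add: ext_def multiindex_le_split S.free_hom_zero zero_fun_def flip: H_zero)
qed

lemma ext_ideal_span_zero:
  assumes "\<And>r. r \<in> rels \<Longrightarrow> ext (Mser r) = 0" "x \<in> free.ideal_span rels"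
  shows "ext x = 0"
  using free.genideal_mser_minimal[of "{x. ext x = 0}" rels "mcoeff x"] assms
  by (auto simp: free.ideal_span_def ext_zero ext_add ext_mult)

end

text \<open>Only \<open>kills\<close> concerns whole series; \<open>surj\<close> and
  \<open>lift_kernel\<close> are conditions modulo the parameters. The lift in
  \<open>lift_kernel\<close> has to lie in the ideal of relations, because it is subtracted there
  order by order.\<close>

locale presentation = series_hom sc \<phi>
  for sc :: "complex \<Rightarrow> 'm::ring_1" and \<phi> :: "'x \<Rightarrow> ('s::finite, 'm) mser" +
  fixes rels :: "(('s \<Rightarrow> nat) \<Rightarrow> 'x free) set"
  assumes kills: "r \<in> rels \<Longrightarrow> ext (Mser r) = 0"
    and surj: "\<exists>p. free_hom sc (\<lambda>x. mcoeff (\<phi> x) (\<lambda>_. 0)) p = y"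
    and lift_kernel: "free_hom sc (\<lambda>x. mcoeff (\<phi> x) (\<lambda>_. 0)) p = 0 \<Longrightarrow>
      \<exists>r\<in>scalars.ideal_span scalar rels. mcoeff r (\<lambda>_. 0) = p"
begin

interpretation S: scalars "\<lambda>c. cser (sc c) :: ('s, 'm) mser" by (rule scalars_cser)

abbreviation h0 :: "'x free \<Rightarrow> 'm" where
  "h0 \<equiv> free_hom sc (\<lambda>x. mcoeff (\<phi> x) (\<lambda>_. 0))"

lemma ext_ideal_span: "x \<in> free.ideal_span rels \<Longrightarrow> ext x = 0"
  using kills by (rule ext_ideal_span_zero)

text \<open>Coefficient \<open>m\<close> of \<open>ext f\<close> is \<open>h0\<close> of coefficient
  \<open>m\<close> of \<open>f\<close> plus terms from smaller multi-indices; this triangular system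
  is solvable since \<open>h0\<close> is onto.\<close>

lemma ext_surj: "\<exists>x. ext x = y"
proof -
  obtain f where f: "\<And>m. h0 (f m) = mcoeff y m - (\<Sum>a\<in>{a. a < m}. mcoeff (H (f a)) (m - a))"
    by (rule triangular_solution[of "\<lambda>f m r. h0 r = mcoeff y m - (\<Sum>a\<in>{a. a < m}. mcoeff (H (f a)) (m - a))"])
       (use surj in auto)
  have "ext (Mser f) = y"
  proof (rule mser_eqI)
    fix m
    show "mcoeff (ext (Mser f)) m = mcoeff y m"
      using f[of m] by (simp add: ext_def multiindex_le_split zero_fun_def flip: H_zero)
  qed
  then show ?thesis ..
qed

lemma ext_order_ge: "x \<in> order_ge n \<Longrightarrow> ext x \<in> order_ge n"
proof -
  assume x: "x \<in> order_ge n"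
  have "mcoeff x a = 0" if "sum m UNIV < n" "a \<le> m" for a m
    using x that sum_mono[of UNIV a m] by (auto simp: order_ge_def le_fun_def)
  then show ?thesis by (simp add: order_ge_def ext_def S.free_hom_zero)
qed

lemma ideal_span_sum:
  "finite A \<Longrightarrow> (\<And>a. a \<in> A \<Longrightarrow> f a \<in> free.ideal_span rels) \<Longrightarrow> sum f A \<in> free.ideal_span rels"
  by (induction A rule: finite_induct) (auto intro: free.ideal_span)

text \<open>The lowest-order part of a series in the kernel lies in the kernel at the origin, where it
  can be lifted to the ideal of relations and subtracted.\<close>

lemma kernel_approximation:
  assumes x: "ext x = 0"
  shows "\<exists>y\<in>free.ideal_span rels. x - y \<in> order_ge n"
proof (induction n)
  case 0
  then show ?case using free.ideal_span(1) by auto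
next
  case (Suc n)
  then obtain y where y: "y \<in> free.ideal_span rels" "x - y \<in> order_ge n" by blast
  have "ext (x - y) = 0" using x ext_ideal_span[OF y(1)] by (simp add: ext_diff)
  then have "h0 (mcoeff (x - y) m) = 0" if "sum m UNIV = n" for m
    using ext_lowest[OF y(2) that] by simp
  then have "\<exists>r\<in>free.ideal_span rels. mcoeff r (\<lambda>_. 0) = mcoeff (x - y) m" if "sum m UNIV = n" for m
    using lift_kernel that by blast
  then obtain r where r: "\<And>m. sum m UNIV = n \<Longrightarrow> r m \<in> free.ideal_span rels"
      "\<And>m. sum m UNIV = n \<Longrightarrow> mcoeff (r m) (\<lambda>_. 0) = mcoeff (x - y) m"
    by metis
  define z where "z = (\<Sum>m\<in>{m. sum m UNIV = n}. mono m 1 * r m)"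
  have z: "z \<in> free.ideal_span rels"
    unfolding z_def using r(1) by (intro ideal_span_sum finite_multiindex_degree free.ideal_span) auto
  have "mcoeff z k = mcoeff (x - y) k" if k: "sum k UNIV \<le> n" for k
  proof -
    \<comment> \<open>Among the exponents of total degree n only \<open>k\<close> itself can lie
      below \<open>k\<close>, so coefficient \<open>k\<close> of \<open>z\<close> sees just the
      constant term of one lift.\<close>
    have *: "m = k" if "m \<le> k" "sum m UNIV = n" for m
      using that k sum_multiindex_less[of m k] by (metis leD order_le_imp_less_or_eq)
    have "mcoeff z k = (\<Sum>m\<in>{m. sum m UNIV = n}. if k = m then mcoeff (x - y) k else 0)"
      unfolding z_def mcoeff_sum mcoeff_mono_mult
      using r(2) * by (intro sum.cong refl) (auto simp: zero_fun_def)
    also have "\<dots> = (if sum k UNIV = n then mcoeff (x - y) k else 0)"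
      by (simp add: finite_multiindex_degree)
    also have "\<dots> = mcoeff (x - y) k"
      using y(2) k by (auto simp: order_ge_def)
    finally show ?thesis .
  qed
  then have "x - (y + z) \<in> order_ge (Suc n)"
    by (auto simp: order_ge_def algebra_simps)
  then show ?case using free.ideal_span(2)[OF y(1) z] by blast
qed

text \<open>The closure maps to 0 because \<open>ext\<close> does not lower the order and only 0 has
  arbitrarily large order. The converse is \<open>kernel_approximation\<close> at every
  order.\<close>

lemma rel_ideal_eq: "rel_ideal rels = {f. ext (Mser f) = 0}"
proof (intro equalityI subsetI)
  fix f assume f: "f \<in> rel_ideal rels"
  have "ext (Mser f) \<in> order_ge n" for n
  proof -
    from f obtain g where g: "g \<in> genideal (series_algebra free_algebra) rels"
      "f \<ominus>\<^bsub>series_algebra free_algebra\<^esub> g \<in> ideal_power (series_algebra free_algebra)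
        (genideal (series_algebra free_algebra) (range (parameter free_algebra))) n"
      by (auto simp: rel_ideal_def Let_def adic_closure_def)
    have "Mser f - Mser g \<in> order_ge n"
      using g(2) unfolding free_algebra_eq free.ideal_power_parameters free.series_type_minus
      by (metis (no_types, lifting) image_iff mcoeff_inject)
    moreover have "ext (Mser g) = 0"
      using g(1) by (intro ext_ideal_span) (simp add: free.ideal_span_def free_algebra_eq)
    ultimately show ?thesis using ext_order_ge[of "Mser f - Mser g" n] by (simp add: ext_diff)
  qed
  then have "ext (Mser f) = 0"
    by (intro mser_eqI) (metis (mono_tags, lifting) lessI mem_Collect_eq mcoeff_simps(1) order_ge_def)
  then show "f \<in> {f. ext (Mser f) = 0}" by simp
next
  fix f assume "f \<in> {f. ext (Mser f) = 0}"
  then have f: "ext (Mser f) = 0" by simp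
  show "f \<in> rel_ideal rels"
    unfolding rel_ideal_def Let_def adic_closure_def free_algebra_eq
  proof (intro CollectI conjI allI)
    fix n
    from kernel_approximation[OF f, of n] obtain y where y: "y \<in> free.ideal_span rels" "Mser f - y \<in> order_ge n"
      by blast
    show "\<exists>y\<in>genideal (series_algebra (type_algebra scalar)) rels.
        f \<ominus>\<^bsub>series_algebra (type_algebra scalar)\<^esub> y \<in> ideal_power (series_algebra (type_algebra scalar))
        (genideal (series_algebra (type_algebra scalar)) (range (parameter (type_algebra scalar)))) n"
      unfolding free.ideal_power_parameters free.series_type_minus
      using y by (intro bexI[of _ "mcoeff y"]) (auto simp: free.ideal_span_def simp del: mcoeff_simps)
  qed (simp add: free.series_type_simps)
qed

definition hom :: "(('s \<Rightarrow> nat) \<Rightarrow> 'x free) \<Rightarrow> ('s \<Rightarrow> nat) \<Rightarrow> 'm" where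
  "hom f = mcoeff (ext (Mser f))"

definition iso :: "(('s \<Rightarrow> nat) \<Rightarrow> 'x free) set \<Rightarrow> ('s \<Rightarrow> nat) \<Rightarrow> 'm" where
  "iso Y = the_elem (hom ` Y)"

lemma presentation:
  shows iso: "iso \<in> algebra_iso (series_ring complex_ring) (top_generated rels) (series_algebra (type_algebra sc))"
    and assoc_algebra_top_generated: "assoc_algebra (series_ring complex_ring) (top_generated rels)"
    and iso_top_gen: "iso (top_gen rels x) = mcoeff (\<phi> x)"
    and top_gen_closed: "top_gen rels x \<in> carrier (top_generated rels)"
proof -
  let ?P = "series_algebra free_algebra :: (('s \<Rightarrow> nat) \<Rightarrow> complex, ('s \<Rightarrow> nat) \<Rightarrow> 'x free) module"
  let ?S = "series_algebra (type_algebra sc) :: (('s \<Rightarrow> nat) \<Rightarrow> complex, ('s \<Rightarrow> nat) \<Rightarrow> 'm) module"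
  note P = free.assoc_algebra_series_type[where 's = 's, folded free_algebra_eq]
  note simpsP = free.series_type_simps[where 's = 's, folded free_algebra_eq]
  note S = assoc_algebra_series_type[where 's = 's]
  have h: "hom \<in> ring_hom ?P ?S"
    unfolding ring_hom_def simpsP series_type_simps hom_def Mser_mcoeff
    by (auto simp: ext_mult ext_add ext_one simp del: mcoeff_simps)
  have "\<exists>f. hom f = g" for g
    using ext_surj[of "Mser g"] unfolding hom_def by (metis Mser_mcoeff mcoeff_Mser)
  then have s: "hom ` carrier ?P = carrier ?S"
    unfolding simpsP series_type_simps by (metis surjI surj_def)
  have sm: "hom (k \<odot>\<^bsub>?P\<^esub> f) = k \<odot>\<^bsub>?S\<^esub> hom f" for k f
    unfolding simpsP series_type_simps hom_def Mser_mcoeff ext_mult ext_scalar ..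
  have I: "rel_ideal rels = {f \<in> carrier ?P. hom f = \<zero>\<^bsub>?S\<^esub>}"
    unfolding rel_ideal_eq simpsP series_type_simps hom_def mcoeff_inject by simp
  have 1: "iso = (\<lambda>Y. the_elem (hom ` Y))" by (simp add: iso_def fun_eq_iff)
  show "iso \<in> algebra_iso (series_ring complex_ring) (top_generated rels) ?S"
    unfolding 1 top_generated_def by (rule quot_algebra_iso[OF P S h s sm I])
  show "assoc_algebra (series_ring complex_ring) (top_generated rels)"
    unfolding top_generated_def by (rule assoc_algebra_quot[OF P S h s sm I])
  show "iso (top_gen rels x) = mcoeff (\<phi> x)"
    unfolding 1 top_gen_def
    by (subst the_elem_coset[OF P S h s sm I], unfold simpsP)
       (simp_all add: hom_def free_algebra_eq ext_cser)
  show "top_gen rels x \<in> carrier (top_generated rels)"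
    unfolding top_gen_def top_generated_def
    by (rule coset_in_quot[OF P S h s sm I]) (simp add: simpsP)
qed

end

section \<open>The enveloping algebra and its PBW basis\<close>

context scalars begin

lemma ring_type_algebra: "ring (type_algebra sc)"
  using assoc_algebra_type by (simp add: assoc_algebra_def)

lemma genideal_type:
  shows "0 \<in> genideal (type_algebra sc) R"
    and "x \<in> genideal (type_algebra sc) R \<Longrightarrow> y \<in> genideal (type_algebra sc) R \<Longrightarrow> x + y \<in> genideal (type_algebra sc) R"
    and "x \<in> genideal (type_algebra sc) R \<Longrightarrow> x * z \<in> genideal (type_algebra sc) R"
    and "x \<in> genideal (type_algebra sc) R \<Longrightarrow> z * x \<in> genideal (type_algebra sc) R"
    and "r \<in> R \<Longrightarrow> r \<in> genideal (type_algebra sc) R"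
proof -
  note I = ring.genideal_ideal[OF ring_type_algebra, of R, simplified]
  show "0 \<in> genideal (type_algebra sc) R"
    using additive_subgroup.zero_closed[OF ideal.axioms(1)[OF I]] by simp
  show "x \<in> genideal (type_algebra sc) R \<Longrightarrow> y \<in> genideal (type_algebra sc) R \<Longrightarrow> x + y \<in> genideal (type_algebra sc) R"
    using additive_subgroup.a_closed[OF ideal.axioms(1)[OF I], of x y] by simp
  show "x \<in> genideal (type_algebra sc) R \<Longrightarrow> x * z \<in> genideal (type_algebra sc) R"
    using ideal.I_r_closed[OF I, of x z] by simp
  show "x \<in> genideal (type_algebra sc) R \<Longrightarrow> z * x \<in> genideal (type_algebra sc) R"
    using ideal.I_l_closed[OF I, of x z] by simp
  show "r \<in> R \<Longrightarrow> r \<in> genideal (type_algebra sc) R"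
    using ring.genideal_self[OF ring_type_algebra, of R] by auto
qed

lemma genideal_type_minimal:
  assumes "0 \<in> T" "\<And>x y. x \<in> T \<Longrightarrow> y \<in> T \<Longrightarrow> x + y \<in> T"
    and "\<And>x y. x \<in> T \<Longrightarrow> x * y \<in> T" "\<And>x y. x \<in> T \<Longrightarrow> y * x \<in> T" "R \<subseteq> T"
  shows "genideal (type_algebra sc) R \<subseteq> T"
proof -
  have inv: "\<ominus>\<^bsub>type_algebra sc\<^esub> x = - x" for x
    by (rule abelian_group.minus_equality[OF ring.is_abelian_group[OF ring_type_algebra]]) auto
  have "ideal T (type_algebra sc)"
  proof (rule idealI[OF ring_type_algebra])
    show "subgroup T (add_monoid (type_algebra sc))"
    proof (rule group.subgroupI[OF abelian_group.a_group[OF ring.is_abelian_group[OF ring_type_algebra]]])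
      fix a assume "a \<in> T"
      then show "inv\<^bsub>add_monoid (type_algebra sc)\<^esub> a \<in> T"
        using assms(4)[of a "-1"] inv[of a] by (simp add: a_inv_def)
    qed (use assms in auto)
  qed (use assms in auto)
  then show ?thesis using assms(5) by (rule ring.genideal_minimal[OF ring_type_algebra])
qed

end

definition sl2_rels :: "'x \<Rightarrow> 'x \<Rightarrow> 'x \<Rightarrow> 'x free set" where
  "sl2_rels h xp xm = insert (gen xp * gen xm - gen xm * gen xp - gen h) (weight_rels h xp xm)"

lemma U_rel_ideal_eq: "U_rel_ideal = genideal (type_algebra scalar) (sl2_rels Hgen Xp Xm)"
  by (simp add: U_rel_ideal_def sl2_rels_def free_algebra_eq)

lemmas U_rel_ideal = free.genideal_type[where R = "sl2_rels Hgen Xp Xm", folded U_rel_ideal_eq]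

lemma U_rel_ideal_uminus: "x \<in> U_rel_ideal \<Longrightarrow> - x \<in> U_rel_ideal"
  using U_rel_ideal(4)[of x "-1"] by simp

lemma scalars_complex: "scalars (\<lambda>c. c)"
  by standard auto

text \<open>The character sending all generators to 0 kills the relations but not 1. This gives the
  law 0 \<noteq> 1 required for the quotient type.\<close>

lemma one_notin_U_rel_ideal: "1 \<notin> U_rel_ideal"
proof -
  interpret C: scalars "\<lambda>c. c" by (rule scalars_complex)
  have "U_rel_ideal \<subseteq> {p. free_hom (\<lambda>c. c) (\<lambda>_. 0) p = 0}"
    unfolding U_rel_ideal_eq
    by (rule free.genideal_type_minimal)
       (auto simp: C.free_hom_zero C.free_hom_add C.free_hom_mult C.free_hom_diff sl2_rels_def weight_rels_def)
  then show ?thesis using C.free_hom_one[of "\<lambda>_ :: sl2_gen. 0"] by auto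
qed

\<comment> \<open>A copy of the enveloping algebra as a type, so that it can serve as coefficient
  ring of \<open>mser\<close>; \<open>U_iso\<close> ties it to \<open>U_sl2\<close>.\<close>
quotient_type usl2 = "sl2_gen free" / "\<lambda>p q. p - q \<in> U_rel_ideal"
proof (rule equivpI)
  show "reflp (\<lambda>p q. p - q \<in> U_rel_ideal)" by (auto simp: reflp_def U_rel_ideal)
  show "symp (\<lambda>p q. p - q \<in> U_rel_ideal)"
    unfolding symp_def using U_rel_ideal_uminus[of "_ - _"] by simp
  show "transp (\<lambda>p q. p - q \<in> U_rel_ideal)"
    unfolding transp_def
  proof (intro allI impI)
    fix x y z assume "x - y \<in> U_rel_ideal" "y - z \<in> U_rel_ideal"
    then have "(x - y) + (y - z) \<in> U_rel_ideal" by (rule U_rel_ideal(2))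
    then show "x - z \<in> U_rel_ideal" by simp
  qed
qed

instantiation usl2 :: ring_1
begin

lift_definition zero_usl2 :: usl2 is 0 .
lift_definition one_usl2 :: usl2 is 1 .
lift_definition plus_usl2 :: "usl2 \<Rightarrow> usl2 \<Rightarrow> usl2" is "(+)"
proof -
  fix a b c d assume "a - b \<in> U_rel_ideal" "c - d \<in> U_rel_ideal"
  then have "(a - b) + (c - d) \<in> U_rel_ideal" by (rule U_rel_ideal(2))
  then show "a + c - (b + d) \<in> U_rel_ideal" by (simp add: algebra_simps)
qed
lift_definition uminus_usl2 :: "usl2 \<Rightarrow> usl2" is uminus
proof -
  fix a b assume "a - b \<in> U_rel_ideal"
  then have "- (a - b) \<in> U_rel_ideal" by (rule U_rel_ideal_uminus)
  then show "- a - - b \<in> U_rel_ideal" by simp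
qed
lift_definition minus_usl2 :: "usl2 \<Rightarrow> usl2 \<Rightarrow> usl2" is "(-)"
proof -
  fix a b c d assume "a - b \<in> U_rel_ideal" "c - d \<in> U_rel_ideal"
  then have "(a - b) + - (c - d) \<in> U_rel_ideal" by (intro U_rel_ideal(2) U_rel_ideal_uminus)
  then show "a - c - (b - d) \<in> U_rel_ideal" by (simp add: algebra_simps)
qed
lift_definition times_usl2 :: "usl2 \<Rightarrow> usl2 \<Rightarrow> usl2" is "(*)"
proof -
  fix a b c d assume "a - b \<in> U_rel_ideal" "c - d \<in> U_rel_ideal"
  then have "(a - b) * c + b * (c - d) \<in> U_rel_ideal" by (intro U_rel_ideal(2-4))
  then show "a * c - b * d \<in> U_rel_ideal" by (simp add: algebra_simps)
qed

instance
proof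
  show "(0 :: usl2) \<noteq> 1"
    using one_notin_U_rel_ideal U_rel_ideal_uminus[of "-1"] by transfer auto
qed (transfer; simp add: U_rel_ideal(1) algebra_simps)+

end

lift_definition usc :: "complex \<Rightarrow> usl2" is scalar .
lift_definition ugen :: "sl2_gen \<Rightarrow> usl2" is gen .

lemma free_hom_id: "free_hom scalar gen p = p"
proof (induction p rule: poly_mapping_single_induct)
  case (single w c)
  have "prod_list (map gen w) = Poly_Mapping.single w 1"
    by (induction w) (simp_all add: single_Nil_one gen_def mult_single plus_list_def)
  then show ?case
    by (subst free.free_hom_single) (simp add: scalar_def mult_single plus_list_def)
qed (auto simp: free.free_hom_zero free.free_hom_add)

interpretation U: scalars usc
proof
  have "scalar c * p - p * scalar c \<in> U_rel_ideal" for c p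
    by (simp only: free.sc_central[of c p] diff_self U_rel_ideal(1))
  then show "usc c * x = x * usc c" for c x by transfer
qed (transfer; simp add: free.sc_add free.sc_mult free.sc_one U_rel_ideal(1))+

lemma abs_usl2_eq: "abs_usl2 p = free_hom usc ugen p"
proof -
  have "ugen = (\<lambda>x. abs_usl2 (gen x))" by (simp add: ugen.abs_eq fun_eq_iff)
  then show ?thesis
    using free_hom_comp[of abs_usl2 scalar usc gen p]
    by (simp add: plus_usl2.abs_eq times_usl2.abs_eq one_usl2_def usc.abs_eq free_hom_id)
qed

lemma free_hom_ugen_eq_0: "free_hom usc ugen p = 0 \<longleftrightarrow> p \<in> U_rel_ideal"
  unfolding abs_usl2_eq[symmetric] zero_usl2_def by (simp add: usl2.abs_eq_iff)

lemma free_hom_ugen_surj: "\<exists>p. free_hom usc ugen p = x"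
  unfolding abs_usl2_eq[symmetric] using Quotient3_abs_rep[OF Quotient3_usl2] by blast

abbreviation "XP \<equiv> ugen Xp"
abbreviation "XM \<equiv> ugen Xm"
abbreviation "HH \<equiv> ugen Hgen"

lemma usl2_relations:
  "HH * XP = XP * HH + 2 * XP" "HH * XM = XM * HH - 2 * XM" "XP * XM = XM * XP + HH"
proof -
  have 2: "usc 2 = 2" using U.sc_add[of 1 1] by (simp add: U.sc_one)
  have "free_hom usc ugen r = 0" if "r \<in> sl2_rels Hgen Xp Xm" for r
    using U_rel_ideal(5)[OF that] free_hom_ugen_eq_0 by simp
  note * = this[unfolded sl2_rels_def weight_rels_def, OF insertI1]
    this[unfolded sl2_rels_def weight_rels_def, OF insertI2, OF insertI1]
    this[unfolded sl2_rels_def weight_rels_def, OF insertI2, OF insertI2, OF insertI1]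
  have "HH * XP - XP * HH - 2 * XP = 0" "HH * XM - XM * HH + 2 * XM = 0" "XP * XM - XM * XP - HH = 0"
    using * by (simp_all add: U.free_hom_diff U.free_hom_add U.free_hom_mult 2)
  then show "HH * XP = XP * HH + 2 * XP" "HH * XM = XM * HH - 2 * XM" "XP * XM = XM * XP + HH"
    by (auto simp: algebra_simps)
qed

definition U_iso :: "sl2_gen free set \<Rightarrow> usl2" where
  "U_iso Y = the_elem (free_hom usc ugen ` Y)"

lemma U_sl2_presentation:
  shows U_iso: "U_iso \<in> algebra_iso complex_ring U_sl2 (type_algebra usc)"
    and assoc_algebra_U_sl2: "assoc_algebra complex_ring U_sl2"
    and U_iso_gen: "U_iso (U_gen x) = ugen x"
    and U_gen_closed: "U_gen x \<in> carrier U_sl2"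
proof -
  note P = free.assoc_algebra_type[folded free_algebra_eq] and S = U.assoc_algebra_type
  have h: "free_hom usc ugen \<in> ring_hom free_algebra (type_algebra usc)"
    by (auto simp: free_algebra_eq ring_hom_def U.free_hom_add U.free_hom_mult U.free_hom_one)
  have s: "free_hom usc ugen ` carrier free_algebra = carrier (type_algebra usc)"
    using free_hom_ugen_surj by (simp add: free_algebra_eq surj_def) (blast intro: sym)
  have sm: "free_hom usc ugen (k \<odot>\<^bsub>free_algebra\<^esub> x) = k \<odot>\<^bsub>type_algebra usc\<^esub> free_hom usc ugen x" for k x
    by (simp add: free_algebra_eq U.free_hom_mult)
  have I: "U_rel_ideal = {x \<in> carrier free_algebra. free_hom usc ugen x = \<zero>\<^bsub>type_algebra usc\<^esub>}"
    by (auto simp: free_algebra_eq free_hom_ugen_eq_0)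
  have 1: "U_iso = (\<lambda>Y. the_elem (free_hom usc ugen ` Y))" by (simp add: U_iso_def fun_eq_iff)
  show "U_iso \<in> algebra_iso complex_ring U_sl2 (type_algebra usc)"
    unfolding 1 U_sl2_def by (rule quot_algebra_iso[OF P S h s sm I])
  show "assoc_algebra complex_ring U_sl2"
    unfolding U_sl2_def by (rule assoc_algebra_quot[OF P S h s sm I])
  show "U_iso (U_gen x) = ugen x"
    unfolding 1 U_gen_def
    by (subst the_elem_coset[OF P S h s sm I]) (auto simp: free_algebra_eq)
  show "U_gen x \<in> carrier U_sl2"
    unfolding U_gen_def U_sl2_def by (rule coset_in_quot[OF P S h s sm I]) (simp add: free_algebra_eq)
qed

text \<open>The enveloping algebra acts on the span of its formal PBW monomials by left multiplication.
  A vector \<open>v\<close> stands for the sum over \<open>c\<close> of \<open>v c t X\<^sup>+\<^sup>c\<close>, where the polynomial variable \<open>Y\<close>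
  of \<open>v c t\<close> is \<open>X\<^sup>-\<close> and \<open>t\<close> is a value of \<open>H\<close>.\<close>

type_synonym pbw_vector = "nat \<Rightarrow> complex \<Rightarrow> complex poly"

text \<open>Additivity is needed for one of the distributive laws of composition, and homogeneity
  makes the scalars central.\<close>

typedef endo = "{f :: pbw_vector \<Rightarrow> pbw_vector. (\<forall>v w. f (v + w) = f v + f w) \<and>
    (\<forall>k v. f (\<lambda>n t. Polynomial.smult k (v n t)) = (\<lambda>n t. Polynomial.smult k (f v n t)))}"
  by (rule exI[of _ "\<lambda>v. v"]) simp

setup_lifting type_definition_endo

instantiation endo :: ring_1
begin

lift_definition zero_endo :: endo is "\<lambda>v. 0" by (simp add: fun_eq_iff)
lift_definition one_endo :: endo is "\<lambda>v. v" by simp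
lift_definition plus_endo :: "endo \<Rightarrow> endo \<Rightarrow> endo" is "\<lambda>f g v. f v + g v"
  by (auto simp: fun_eq_iff smult_add_right)
lift_definition uminus_endo :: "endo \<Rightarrow> endo" is "\<lambda>f v. - f v"
  by (auto simp: fun_eq_iff)
lift_definition minus_endo :: "endo \<Rightarrow> endo \<Rightarrow> endo" is "\<lambda>f g v. f v - g v"
  by (auto simp: fun_eq_iff smult_diff_right)
lift_definition times_endo :: "endo \<Rightarrow> endo \<Rightarrow> endo" is "\<lambda>f g v. f (g v)"
  by auto

instance
proof
  show "(0 :: endo) \<noteq> 1"
  proof transfer
    show "(\<lambda>v :: pbw_vector. 0) \<noteq> (\<lambda>v. v)"
    proof
      assume "(\<lambda>v :: pbw_vector. 0) = (\<lambda>v. v)"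
      then have "(0 :: pbw_vector) = (\<lambda>_ _. 1)" by (rule fun_cong)
      then show False by (simp add: fun_eq_iff)
    qed
  qed
qed (transfer; simp add: add_ac fun_eq_iff)+

end

lift_definition esc :: "complex \<Rightarrow> endo" is "\<lambda>k v n t. Polynomial.smult k (v n t)"
  by (auto simp: fun_eq_iff smult_add_right mult.commute)

abbreviation Y_times :: "complex poly \<Rightarrow> complex poly" where
  "Y_times \<equiv> pCons 0"

lift_definition eXM :: endo is "\<lambda>v n t. Y_times (v n t)"
  by (auto simp: fun_eq_iff)

text \<open>From H (X-)^a = (X-)^a (H - 2a): the exponent a is read off by Y d/dY.\<close>

lift_definition eH :: endo is "\<lambda>v n t. Polynomial.smult t (v n t) - Polynomial.smult 2 (Y_times (pderiv (v n t)))"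
  by (auto simp: fun_eq_iff pderiv_add pderiv_smult smult_add_right smult_diff_right mult.commute)

text \<open>From X+ (X-)^a = (X-)^a X+ + a (X-)^(a-1) (H - a + 1) and X+ f(H) = f(H - 2) X+. The
  second relation gives the shift of \<open>n\<close> and \<open>t\<close>; the correction term of
  the first is t d/dY - Y d^2/dY^2 applied to Y^a.\<close>

lift_definition eXP :: endo is "\<lambda>v n t. (if n = 0 then 0 else v (n - 1) (t - 2)) +
    Polynomial.smult t (pderiv (v n t)) - Y_times (pderiv (pderiv (v n t)))"
  by (auto simp: fun_eq_iff pderiv_add pderiv_smult smult_add_right smult_diff_right mult.commute)

interpretation endo: scalars esc
proof
  fix k x show "esc k * x = x * esc k" by transfer auto
qed (transfer; simp add: fun_eq_iff smult_add_left)+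

lemma pderiv_Y_times: "pderiv (Y_times p) = p + Y_times (pderiv p)"
  by (simp add: pderiv_pCons)

lemma endo_H_XM: "eH * eXM - eXM * eH + esc 2 * eXM = 0"
  by transfer (simp add: fun_eq_iff pderiv_Y_times smult_add_right smult_diff_right algebra_simps)

lemma coeff_two_mult: "Polynomial.coeff (2 * p) n = 2 * Polynomial.coeff (p :: complex poly) n"
  by (simp add: numeral_poly)

lemma endo_H_XP: "eH * eXP - eXP * eH - esc 2 * eXP = 0"
  by transfer (auto simp: fun_eq_iff pderiv_Y_times pderiv_add pderiv_diff pderiv_smult
      smult_add_right smult_diff_right smult_diff_left algebra_simps poly_eq_iff coeff_pCons split: nat.splits)

lemma endo_XP_XM: "eXP * eXM - eXM * eXP - eH = 0"
  by transfer (auto simp: fun_eq_iff pderiv_Y_times pderiv_add smult_add_right algebra_simps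
     poly_eq_iff coeff_pCons coeff_two_mult split: nat.splits)

primrec egen :: "sl2_gen \<Rightarrow> endo" where
  "egen Xp = eXP"
| "egen Xm = eXM"
| "egen Hgen = eH"

lemma free_hom_egen_eq_0: "p \<in> U_rel_ideal \<Longrightarrow> free_hom esc egen p = 0"
proof -
  have "U_rel_ideal \<subseteq> {p. free_hom esc egen p = 0}"
    unfolding U_rel_ideal_eq using endo_H_XM endo_H_XP endo_XP_XM
    by (intro free.genideal_type_minimal)
       (auto simp: endo.free_hom_zero endo.free_hom_add endo.free_hom_mult endo.free_hom_diff sl2_rels_def weight_rels_def)
  then show "p \<in> U_rel_ideal \<Longrightarrow> free_hom esc egen p = 0" by auto
qed

section \<open>Linear independence of the PBW monomials\<close>

lift_definition rep :: "usl2 \<Rightarrow> endo" is "free_hom esc egen"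
  using free_hom_egen_eq_0 endo.free_hom_diff by (metis eq_iff_diff_eq_0)

lemma rep_add: "rep (x + y) = rep x + rep y"
  and rep_mult: "rep (x * y) = rep x * rep y"
  and rep_one: "rep 1 = 1"
  and rep_sc: "rep (usc c) = esc c"
  and rep_gen: "rep (ugen i) = egen i"
  by (transfer; simp add: endo.free_hom_add endo.free_hom_mult endo.free_hom_one)+

text \<open>The vector acted upon stands for 1, so the result is the PBW expansion of
  \<open>x\<close> itself.\<close>

definition symbol :: "usl2 \<Rightarrow> pbw_vector" where
  "symbol x = Rep_endo (rep x) (\<lambda>n t. if n = 0 then 1 else 0)"

lemma symbol_add: "symbol (x + y) = symbol x + symbol y"
  by (simp add: symbol_def rep_add plus_endo.rep_eq)

lemma symbol_sc: "symbol (usc c * x) = (\<lambda>n t. Polynomial.smult c (symbol x n t))"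
  by (simp add: symbol_def rep_mult rep_sc times_endo.rep_eq esc.rep_eq)

lemma symbol_zero: "symbol 0 = 0"
  using symbol_add[of 0 0] by simp

lemma symbol_sum: "symbol (sum f A) = (\<lambda>n t. \<Sum>a\<in>A. symbol (f a) n t)"
  by (induction A rule: infinite_finite_induct) (auto simp: symbol_zero symbol_add fun_eq_iff)

definition pbw_monomial :: "nat \<times> nat \<times> nat \<Rightarrow> usl2" where
  "pbw_monomial = (\<lambda>(a, b, c). XM ^ a * HH ^ b * XP ^ c)"

lemma pbw_monomial_apply: "pbw_monomial (a, b, c) = XM ^ a * (HH ^ b * XP ^ c)"
  by (simp add: pbw_monomial_def mult.assoc)

text \<open>Applied to 1 in the order X+, H, X-, the operators never produce a commutator: as long
  as X+ and H act, the vector is constant in Y and all derivatives vanish.\<close>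

lemma symbol_pbw: "symbol (pbw_monomial (a, b, c)) = (\<lambda>n t. if n = c then monom (t ^ b) a else 0)"
proof -
  have *: "symbol (ugen i * x) = Rep_endo (egen i) (symbol x)" for i x
    by (simp add: symbol_def rep_mult rep_gen times_endo.rep_eq)
  have 1: "symbol (XP ^ c) = (\<lambda>n t. if n = c then 1 else 0)"
  proof (induction c)
    case 0
    then show ?case by (simp add: symbol_def rep_one one_endo.rep_eq)
  next
    case (Suc c)
    then show ?case by (auto simp: * eXP.rep_eq fun_eq_iff)
  qed
  have 2: "symbol (HH ^ b * XP ^ c) = (\<lambda>n t. if n = c then monom (t ^ b) 0 else 0)"
  proof (induction b)
    case 0
    then show ?case by (simp add: 1 monom_0 one_pCons cong: if_cong)
  next
    case (Suc b)
    then show ?case by (auto simp: * mult.assoc eH.rep_eq fun_eq_iff monom_0)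
  qed
  have "symbol (XM ^ a * (HH ^ b * XP ^ c)) = (\<lambda>n t. if n = c then monom (t ^ b) a else 0)"
  proof (induction a)
    case 0
    then show ?case by (simp add: 2)
  next
    case (Suc a)
    then show ?case by (auto simp: * mult.assoc eXM.rep_eq fun_eq_iff monom_Suc)
  qed
  then show ?thesis by (simp add: pbw_monomial_apply)
qed

text \<open>For fixed exponents a of X- and c of X+, the coefficient of Y^a in component c, as a
  function of \<open>t\<close>, is a polynomial whose coefficients are the given scalars. It
  vanishes at every complex \<open>t\<close>, hence identically.\<close>

lemma pbw_independent_sum:
  assumes "finite A" "(\<Sum>i\<in>A. usc (u i) * pbw_monomial i) = 0" "i \<in> A"
  shows "u i = 0"
proof -
  obtain a b c where i: "i = (a, b, c)" by (cases i)
  define S where "S = {j \<in> A. fst j = a \<and> snd (snd j) = c}"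
  define q where "q = (\<Sum>j\<in>S. monom (u j) (fst (snd j)))"
  have S: "finite S" using assms(1) by (simp add: S_def)
  have "poly q t = 0" for t
  proof -
    have "0 = Polynomial.coeff (symbol (\<Sum>i\<in>A. usc (u i) * pbw_monomial i) c t) a"
      using assms(2) by (simp add: symbol_zero)
    also have "\<dots> = (\<Sum>j\<in>A. u j * (Polynomial.coeff (symbol (pbw_monomial j) c t) a))"
      by (simp add: symbol_sum symbol_sc coeff_sum)
    also have "\<dots> = (\<Sum>j\<in>S. u j * t ^ fst (snd j))"
      using assms(1) unfolding S_def
      by (intro sum.mono_neutral_cong_right) (auto simp: symbol_pbw split: if_splits)
    also have "\<dots> = poly q t" by (simp add: q_def poly_sum poly_monom)
    finally show ?thesis by simp
  qed
  then have "q = 0" using poly_all_0_iff_0 by blast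
  then have "0 = Polynomial.coeff q b" by simp
  also have "\<dots> = (\<Sum>j\<in>S. if i = j then u i else 0)"
    unfolding q_def coeff_sum by (intro sum.cong) (auto simp: S_def i)
  also have "\<dots> = u i" using S assms(3) by (simp add: S_def i)
  finally show ?thesis by simp
qed

lemma usc_2: "usc 2 = 2"
  using U.sc_add[of 1 1] by (simp add: U.sc_one)

interpretation uvs: vector_space "\<lambda>c x. usc c * x"
  by standard (simp_all add: U.sc_add U.sc_mult U.sc_one algebra_simps)

lemma inj_pbw: "inj pbw_monomial"
proof (rule injI, rule ccontr)
  fix i j assume eq: "pbw_monomial i = pbw_monomial j" and "i \<noteq> j"
  then have "(\<Sum>k\<in>{i, j}. usc (if k = i then 1 else - 1) * pbw_monomial k) = 0"
    using U.sc_add[of 1 "-1"] by (simp add: U.sc_one U.sc_zero flip: distrib_right)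
  from pbw_independent_sum[OF _ this, of i] show False by simp
qed

lemma independent_pbw: "uvs.independent (range pbw_monomial)"
  unfolding uvs.dependent_explicit
proof clarsimp
  fix S u v assume S: "finite S" "S \<subseteq> range pbw_monomial" "(\<Sum>v\<in>S. usc (u v) * v) = 0" "v \<in> S"
  obtain T where T: "S = pbw_monomial ` T" using S(2) by (auto simp: subset_image_iff)
  have "inj_on pbw_monomial T" using inj_pbw by (rule inj_on_subset) simp
  then have "finite T" "(\<Sum>i\<in>T. usc (u (pbw_monomial i)) * pbw_monomial i) = 0"
    using S T by (auto simp: finite_image_iff sum.reindex)
  with pbw_independent_sum[of T "\<lambda>i. u (pbw_monomial i)"] S(4) T show "u v = 0" by auto
qed

section \<open>The PBW monomials span the enveloping algebra\<close>

lemma mult_span_closed: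
  assumes "\<And>i. y * pbw_monomial i \<in> uvs.span (range pbw_monomial)" "x \<in> uvs.span (range pbw_monomial)"
  shows "y * x \<in> uvs.span (range pbw_monomial)"
  using assms(2)
proof (induction rule: uvs.span_induct)
  case base
  show ?case
  proof (rule uvs.subspaceI)
    fix c x assume "x \<in> {x. y * x \<in> uvs.span (range pbw_monomial)}"
    moreover have "y * (usc c * x) = usc c * (y * x)" by (metis U.sc_central mult.assoc)
    ultimately show "usc c * x \<in> {x. y * x \<in> uvs.span (range pbw_monomial)}"
      by (simp add: uvs.span_scale)
  qed (auto simp: distrib_left uvs.span_zero intro: uvs.span_add)
qed (use assms(1) in auto)

lemma HH_XM_power: "HH * XM ^ a = XM ^ a * (HH - of_nat (2 * a))"
proof (induction a)
  case (Suc a)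
  have "HH * XM ^ Suc a = (XM * HH - 2 * XM) * XM ^ a" by (simp add: usl2_relations mult.assoc[symmetric])
  also have "\<dots> = XM * (HH * XM ^ a) - 2 * XM ^ Suc a" by (simp add: algebra_simps)
  also have "\<dots> = XM ^ Suc a * (HH - of_nat (2 * Suc a))"
    unfolding Suc by (simp add: algebra_simps mult_of_nat_commute mult_2 mult_2_right)
  finally show ?case .
qed simp

lemma XP_HH_power: "XP * HH ^ b = (HH - 2) ^ b * XP"
proof (induction b)
  case (Suc b)
  have 1: "XP * HH = (HH - 2) * XP" by (simp add: usl2_relations algebra_simps)
  have "XP * HH ^ Suc b = XP * HH * HH ^ b" by (simp add: mult.assoc)
  also have "\<dots> = (HH - 2) * (XP * HH ^ b)" by (simp add: 1 mult.assoc)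
  finally show ?case by (simp add: Suc mult.assoc)
qed simp

lemma usc_of_nat: "usc (of_nat n) = of_nat n"
  by (induction n) (simp_all add: U.sc_zero U.sc_add U.sc_one)

text \<open>The span contains 1 and is stable under left multiplication by the generators. Stability
  under X- and H comes first, because moving X+ past X- leaves a term starting with X- and a term
  starting with H.\<close>

lemma span_pbw: "uvs.span (range pbw_monomial) = UNIV"
proof -
  let ?T = "uvs.span (range pbw_monomial)"
  have e: "XM ^ a * (HH ^ b * XP ^ c) \<in> ?T" for a b c
    using uvs.span_base[OF rangeI, of pbw_monomial "(a, b, c)"] by (simp only: pbw_monomial_apply)
  have scale: "of_nat n * x \<in> ?T" if "x \<in> ?T" for n x
    using uvs.span_scale[OF that, of "of_nat n"] by (simp add: usc_of_nat)
  have F: "XM * x \<in> ?T" if "x \<in> ?T" for x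
  proof (rule mult_span_closed[OF _ that])
    fix i show "XM * pbw_monomial i \<in> ?T"
      using e[of "Suc (fst i)"] by (cases i) (simp add: pbw_monomial_apply mult.assoc)
  qed
  have He: "HH * (XM ^ a * (HH ^ b * XP ^ c)) \<in> ?T" for a b c
  proof -
    obtain n where n: "HH * XM ^ a = XM ^ a * (HH - of_nat n)" using HH_XM_power by blast
    have "HH * (XM ^ a * (HH ^ b * XP ^ c)) = XM ^ a * ((HH - of_nat n) * (HH ^ b * XP ^ c))"
      unfolding mult.assoc[symmetric] n ..
    also have "\<dots> = XM ^ a * (HH ^ Suc b * XP ^ c) - of_nat n * (XM ^ a * (HH ^ b * XP ^ c))"
      using mult_of_nat_commute[of n "XM ^ a"]
      by (simp add: left_diff_distrib right_diff_distrib mult.assoc) (metis mult.assoc)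
    finally have "HH * (XM ^ a * (HH ^ b * XP ^ c)) =
      XM ^ a * (HH ^ Suc b * XP ^ c) - of_nat n * (XM ^ a * (HH ^ b * XP ^ c))" .
    then show ?thesis using uvs.span_diff[OF e[of a "Suc b" c] scale[OF e]] by metis
  qed
  have H: "HH * x \<in> ?T" if "x \<in> ?T" for x
  proof (rule mult_span_closed[OF _ that])
    fix i show "HH * pbw_monomial i \<in> ?T"
      using He by (cases i) (simp add: pbw_monomial_apply mult.assoc)
  qed
  have Ee: "XP * (XM ^ a * (HH ^ b * XP ^ c)) \<in> ?T" for a b c
  proof (induction a)
    case 0
    have "(HH - 2) ^ b * XP ^ Suc c \<in> ?T"
    proof (induction b)
      case 0
      show ?case using e[of 0 0 "Suc c"] by simp
    next
      case (Suc b)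
      have "(HH - 2) ^ Suc b * XP ^ Suc c = HH * ((HH - 2) ^ b * XP ^ Suc c) - of_nat 2 * ((HH - 2) ^ b * XP ^ Suc c)"
        by (simp add: algebra_simps)
      then show ?case using uvs.span_diff[OF H[OF Suc] scale[OF Suc]] by metis
    qed
    moreover have "XP * (HH ^ b * XP ^ c) = (HH - 2) ^ b * XP ^ Suc c"
      by (simp add: mult.assoc[symmetric] XP_HH_power)
    ultimately show ?case by simp
  next
    case (Suc a)
    let ?w = "XM ^ a * (HH ^ b * XP ^ c)"
    have "XP * (XM ^ Suc a * (HH ^ b * XP ^ c)) = (XP * XM) * ?w" by (simp add: mult.assoc)
    also have "\<dots> = XM * (XP * ?w) + HH * ?w" by (simp add: usl2_relations(3) algebra_simps)
    finally show ?case using uvs.span_add[OF F[OF Suc] H[OF e]] by metis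
  qed
  have E: "XP * x \<in> ?T" if "x \<in> ?T" for x
  proof (rule mult_span_closed[OF _ that])
    fix i show "XP * pbw_monomial i \<in> ?T"
      using Ee by (cases i) (simp add: pbw_monomial_apply mult.assoc)
  qed
  have "prod_list (map ugen w) \<in> ?T" for w
  proof (induction w)
    case Nil
    show ?case using e[of 0 0 0] by simp
  next
    case (Cons x w)
    then show ?case using E F H by (cases x) auto
  qed
  then have "free_hom usc ugen p \<in> ?T" for p
    unfolding free_hom_def by (intro uvs.span_sum uvs.span_scale) auto
  then show ?thesis using free_hom_ugen_surj by (metis UNIV_eq_I)
qed

section \<open>The series F\<close>

locale complex_embedding =
  fixes emb :: "complex \<Rightarrow> 'r::comm_ring_1"
  assumes emb_add: "emb (c + d) = emb c + emb d"
    and emb_mult: "emb (c * d) = emb c * emb d"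
    and emb_one: "emb 1 = 1"
begin

lemma emb_zero: "emb 0 = 0"
  using emb_add[of 0 0] by simp

lemma emb_of_nat: "emb (of_nat n) = of_nat n"
  by (induction n) (simp_all add: emb_zero emb_add emb_one)

lemma exp_series_nth: "fps_nth (exp_series emb a) n = emb (1 / fact n) * a ^ n"
  by (simp add: exp_series_def)

lemma emb_binomial:
  assumes "k \<le> n"
  shows "emb (1 / fact n) * of_nat (n choose k) = emb (1 / fact k) * emb (1 / fact (n - k))"
proof -
  have "(1 / fact n) * of_nat (n choose k) = (1 / fact k) * (1 / fact (n - k) :: complex)"
    using assms by (simp add: binomial_fact)
  then show ?thesis by (metis emb_mult emb_of_nat)
qed

lemma exp_series_add: "exp_series emb (a + b) = exp_series emb a * exp_series emb b"
proof (rule fps_ext)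
  fix n
  have "fps_nth (exp_series emb (a + b)) n = (\<Sum>k\<le>n. (emb (1 / fact n) * of_nat (n choose k)) * (a ^ k * b ^ (n - k)))"
    by (simp add: exp_series_nth binomial_ring sum_distrib_left mult.assoc)
  also have "\<dots> = (\<Sum>k\<le>n. (emb (1 / fact k) * a ^ k) * (emb (1 / fact (n - k)) * b ^ (n - k)))"
    by (intro sum.cong refl, subst emb_binomial) (simp_all only: atMost_iff mult_ac)
  also have "\<dots> = fps_nth (exp_series emb a * exp_series emb b) n"
    by (simp add: fps_mult_nth exp_series_nth atMost_atLeast0)
  finally show "fps_nth (exp_series emb (a + b)) n = fps_nth (exp_series emb a * exp_series emb b) n" .
qed

end

interpretation emb_poly: complex_embedding "\<lambda>c. [:c:]"
  by standard (auto simp: one_pCons)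

interpretation emb_poly_poly: complex_embedding "\<lambda>c. [:[:c:]:]"
  by standard (auto simp: one_pCons)

interpretation emb_fps: complex_embedding "\<lambda>c. fps_const [:c:]"
  by standard (auto simp: one_pCons[symmetric])

lemma exp_h_nth: "fps_nth (exp_h a) n = [:1 / fact n:] * a ^ n"
  by (simp add: exp_h_def emb_poly.exp_series_nth)

text \<open>Twice sinh(h a); the factor 2 cancels in every quotient.\<close>

definition sinh_h :: "complex poly \<Rightarrow> complex poly fps" where
  "sinh_h a = exp_h a - exp_h (- a)"

lemma sinh_h_1_nonzero: "sinh_h 1 \<noteq> 0"
proof
  assume "sinh_h 1 = 0"
  then have "fps_nth (sinh_h 1) 1 = 0" by simp
  then show False by (simp add: sinh_h_def exp_h_nth one_pCons)
qed

text \<open>Both \<open>sinh(h x)\<close> and \<open>sinh(h)\<close> are divided by \<open>h\<close>, the first one also by \<open>x\<close>; then the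
  denominator is a unit. So \<open>sinh(h x) / sinh(h)\<close> is \<open>x\<close> times a series.\<close>

lemma sinh_quotient_reduced_ex:
  "\<exists>G. fps_const var * G * sinh_h 1 = sinh_h var \<and> fps_nth G 0 = 1"
proof -
  \<comment> \<open>\<open>c n\<close> is the coefficient of h^(n+1) in exp(h) - exp(-h). So
    \<open>B\<close> is the denominator divided by h, with constant term 2, and \<open>D\<close> is
    the numerator divided by h x.\<close>
  define c where "c = (\<lambda>n. [:1 / fact (Suc n) * (1 - (- 1) ^ Suc n):] :: complex poly)"
  define B where "B = Abs_fps c"
  define D where "D = Abs_fps (\<lambda>n. c n * var ^ n)"
  have neg: "(- a) ^ n = [:(- 1) ^ n:] * a ^ n" for a :: "complex poly" and n
    by (induction n) auto
  have sinh: "fps_nth (sinh_h a) n = [:1 / fact n * (1 - (- 1) ^ n):] * a ^ n" for a n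
    by (simp add: sinh_h_def exp_h_nth neg smult_diff_left algebra_simps)
  have sinh_Suc: "fps_nth (sinh_h a) (Suc n) = c n * a ^ Suc n" for a n
    by (simp only: sinh c_def)
  have sinh_0: "fps_nth (sinh_h a) 0 = 0" for a by (simp add: sinh)
  have B: "sinh_h 1 = fps_X * B"
  proof (rule fps_ext)
    fix n show "fps_nth (sinh_h 1) n = fps_nth (fps_X * B) n"
      by (cases n) (simp_all add: sinh_0 sinh_Suc B_def)
  qed
  have D: "sinh_h var = fps_const var * (fps_X * D)"
  proof (rule fps_ext)
    fix n show "fps_nth (sinh_h var) n = fps_nth (fps_const var * (fps_X * D)) n"
      by (cases n) (simp_all add: sinh_0 sinh_Suc D_def)
  qed
  have B0: "fps_nth B 0 * [:1 / 2:] = 1" by (simp add: B_def c_def one_pCons)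
  define I where "I = fps_right_inverse B [:1 / 2:]"
  have BI: "B * I = 1" unfolding I_def by (rule fps_right_inverse[OF B0])
  have "fps_const var * (D * I) * sinh_h 1 = fps_const var * (fps_X * D) * (B * I)"
    unfolding B by (simp only: mult_ac)
  also have "\<dots> = sinh_h var" by (simp add: BI D)
  finally have 1: "fps_const var * (D * I) * sinh_h 1 = sinh_h var" .
  \<comment> \<open>\<open>D\<close> and \<open>B\<close> share the constant term
    \<open>c 0\<close>, so the quotient has the same constant term as \<open>B\<close> times its
    inverse.\<close>
  have "fps_nth (D * I) 0 = fps_nth (B * I) 0" by (simp add: D_def B_def)
  then have "fps_nth (D * I) 0 = 1" unfolding BI by simp
  with 1 show ?thesis by blast
qed

definition sinh_quotient_reduced :: "complex poly fps" where
  "sinh_quotient_reduced = (SOME G. fps_const var * G * sinh_h 1 = sinh_h var \<and> fps_nth G 0 = 1)"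

lemma sinh_quotient_reduced:
  "fps_const var * sinh_quotient_reduced * sinh_h 1 = sinh_h var"
  "fps_nth sinh_quotient_reduced 0 = 1"
  using someI_ex[OF sinh_quotient_reduced_ex] by (simp_all add: sinh_quotient_reduced_def)

lemma sinh_quotient_eq: "sinh_quotient = fps_const var * sinh_quotient_reduced"
  unfolding sinh_quotient_def sinh_h_def[symmetric]
proof (rule the_equality)
  show "fps_const var * sinh_quotient_reduced * sinh_h 1 = sinh_h var" by (rule sinh_quotient_reduced)
  fix f assume "f * sinh_h 1 = sinh_h var"
  then show "f = fps_const var * sinh_quotient_reduced"
    using sinh_quotient_reduced(1) sinh_h_1_nonzero by (metis mult_right_cancel)
qed

lemma sinh_quotient_mult: "sinh_quotient * sinh_h 1 = sinh_h var"
  by (simp add: sinh_quotient_eq sinh_quotient_reduced)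

text \<open>The substitution \<open>h \<mapsto> h + h' b\<close> is given by Taylor expansion. It is multiplicative because
  the derivative with respect to \<open>h'\<close> and the derivative with respect to \<open>h\<close> agree on expansions
  with \<open>b = 1\<close>.\<close>

definition taylor :: "complex poly fps \<Rightarrow> complex poly fps fps" where
  "taylor f = Abs_fps (\<lambda>j. Abs_fps (\<lambda>n. of_nat ((n + j) choose j) * fps_nth f (n + j)))"

lemma taylor_nth: "fps_nth (fps_nth (taylor f) j) n = of_nat ((n + j) choose j) * fps_nth f (n + j)"
  by (simp add: taylor_def)

lemma taylor_nth_0: "fps_nth (taylor f) 0 = f"
  by (rule fps_ext) (simp add: taylor_nth)

lemma taylor_add: "taylor (f + g) = taylor f + taylor g"
  by (intro fps_ext) (simp add: taylor_nth distrib_left)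

lemma taylor_diff: "taylor (f - g) = taylor f - taylor g"
  by (intro fps_ext) (simp add: taylor_nth right_diff_distrib)

lemma fps_deriv_taylor: "fps_deriv (taylor f) = taylor (fps_deriv f)"
proof (intro fps_ext)
  fix j n
  have "Suc j * ((n + Suc j) choose Suc j) = Suc (n + j) * ((n + j) choose j)"
    using Suc_times_binomial[of j "n + j"] by simp
  then have eq: "of_nat (Suc j) * of_nat ((n + Suc j) choose Suc j) =
      (of_nat (Suc (n + j)) * of_nat ((n + j) choose j) :: complex poly)"
    by (metis of_nat_mult)
  have of_nat_nth: "fps_nth (of_nat k * f) m = of_nat k * fps_nth f m" for k m and f :: "complex poly fps"
    by (simp add: fps_of_nat[symmetric] del: fps_of_nat)
  have "fps_nth (fps_nth (fps_deriv (taylor f)) j) n =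
      of_nat (Suc j) * (of_nat ((n + Suc j) choose Suc j) * fps_nth f (n + Suc j))"
    by (simp only: fps_deriv_nth of_nat_nth taylor_nth Suc_eq_plus1)
  also have "\<dots> = of_nat ((n + j) choose j) * (of_nat (Suc (n + j)) * fps_nth f (Suc (n + j)))"
    unfolding mult.assoc[symmetric] eq by (simp only: mult.commute[of "of_nat (Suc _)"] add_Suc_right)
  also have "\<dots> = fps_nth (fps_nth (taylor (fps_deriv f)) j) n"
    by (simp only: fps_deriv_nth taylor_nth Suc_eq_plus1)
  finally show "fps_nth (fps_nth (fps_deriv (taylor f)) j) n = fps_nth (fps_nth (taylor (fps_deriv f)) j) n" .
qed

lemma taylor_mult: "taylor (f * g) = taylor f * taylor g"
proof (rule fps_ext)
  fix n show "fps_nth (taylor (f * g)) n = fps_nth (taylor f * taylor g) n"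
  proof (induction n arbitrary: f g)
    case 0
    then show ?case by (simp add: taylor_nth_0)
  next
    case (Suc n)
    have "of_nat (Suc n) * fps_nth (taylor (f * g)) (Suc n) = fps_nth (fps_deriv (taylor (f * g))) n"
      by (simp only: fps_deriv_nth Suc_eq_plus1)
    also have "\<dots> = fps_nth (taylor (fps_deriv f * g)) n + fps_nth (taylor (f * fps_deriv g)) n"
      unfolding fps_deriv_taylor by (simp add: taylor_add add.commute)
    also have "\<dots> = fps_nth (fps_deriv (taylor f * taylor g)) n"
      unfolding Suc by (simp add: fps_deriv_taylor[symmetric] add.commute del: fps_deriv_nth)
    also have "\<dots> = of_nat (Suc n) * fps_nth (taylor f * taylor g) (Suc n)"
      by (simp only: fps_deriv_nth Suc_eq_plus1)
    finally show ?case by (metis mult_left_cancel of_nat_eq_0_iff old.nat.distinct(2))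
  qed
qed

text \<open>h' is rescaled by \<open>b\<close> only after the expansion, so \<open>b\<close> may
  itself depend on h, as {x} does.\<close>

definition taylor_at :: "complex poly fps \<Rightarrow> complex poly fps \<Rightarrow> complex poly fps fps" where
  "taylor_at b f = Abs_fps (\<lambda>j. b ^ j * fps_nth (taylor f) j)"

lemma taylor_at_nth: "fps_nth (taylor_at b f) j = b ^ j * fps_nth (taylor f) j"
  by (simp add: taylor_at_def)

lemma taylor_at_mult: "taylor_at b (f * g) = taylor_at b f * taylor_at b g"
proof (rule fps_ext)
  fix n
  have "fps_nth (taylor_at b f * taylor_at b g) n =
    (\<Sum>i=0..n. (b ^ i * b ^ (n - i)) * (fps_nth (taylor f) i * fps_nth (taylor g) (n - i)))"
    by (simp add: fps_mult_nth taylor_at_nth algebra_simps)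
  also have "\<dots> = fps_nth (taylor_at b (f * g)) n"
    by (simp add: taylor_at_nth taylor_mult fps_mult_nth sum_distrib_left flip: power_add)
  finally show "fps_nth (taylor_at b (f * g)) n = fps_nth (taylor_at b f * taylor_at b g) n" by simp
qed

lemma taylor_at_diff: "taylor_at b (f - g) = taylor_at b f - taylor_at b g"
  by (rule fps_ext) (simp add: taylor_at_nth taylor_diff algebra_simps)

lemma taylor_at_const: "taylor_at b (fps_const c * f) = fps_const (fps_const c) * taylor_at b f"
proof (rule fps_ext)
  fix j
  have "fps_nth (taylor (fps_const c * f)) j = fps_const c * fps_nth (taylor f) j"
    by (rule fps_ext) (simp add: taylor_nth mult.left_commute)
  then show "fps_nth (taylor_at b (fps_const c * f)) j = fps_nth (fps_const (fps_const c) * taylor_at b f) j"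
    by (simp add: taylor_at_nth mult.left_commute)
qed

text \<open>This is exp((h + h' b) a) = exp(h a) exp(h' b a); coefficientwise, the binomial
  coefficient divided by (n + j)! splits into 1/j! and 1/n!.\<close>

lemma taylor_at_exp: "taylor_at (brace_Q g) (exp_h a) = QT_power g a"
proof (rule fps_ext)
  fix j
  have "fps_nth (taylor (exp_h a)) j = fps_const ([:1 / fact j:] * a ^ j) * exp_h a"
  proof (rule fps_ext)
    fix n
    have *: "[:1 / fact (n + j):] * of_nat ((n + j) choose j) = [:1 / fact j:] * ([:1 / fact n:] :: complex poly)"
      using emb_poly.emb_binomial[of j "n + j"] by simp
    have "of_nat ((n + j) choose j) * ([:1 / fact (n + j):] * a ^ (n + j)) =
      ([:1 / fact (n + j):] * of_nat ((n + j) choose j)) * (a ^ n * a ^ j)"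
      by (simp only: power_add mult_ac)
    also have "\<dots> = ([:1 / fact j:] * [:1 / fact n:]) * (a ^ n * a ^ j)" by (simp only: *)
    also have "\<dots> = [:1 / fact j:] * a ^ j * ([:1 / fact n:] * a ^ n)" by (simp only: mult_ac)
    finally show "fps_nth (fps_nth (taylor (exp_h a)) j) n = fps_nth (fps_const ([:1 / fact j:] * a ^ j) * exp_h a) n"
      unfolding taylor_nth fps_mult_left_const_nth exp_h_nth .
  qed
  then show "fps_nth (taylor_at (brace_Q g) (exp_h a)) j = fps_nth (QT_power g a) j"
    unfolding taylor_at_nth QT_power_def exp_h'_def fps_mult_left_const_nth emb_fps.exp_series_nth
    by (simp add: power_mult_distrib fps_const_power mult_ac flip: fps_const_mult)
qed

definition F_reduced :: "nat \<Rightarrow> complex poly fps fps" where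
  "F_reduced g = taylor_at (brace_Q g) sinh_quotient_reduced"

text \<open>The substitution is multiplicative, so it carries the equation defining
  \<open>sinh_quotient\<close> to the one defining F. The solution is unique because the denominator
  is nonzero, its term of degree 0 in h' being \<open>sinh_h 1\<close>. The factor x is constant and
  passes through.\<close>

lemma F_series_eq: "F_series g = fps_const (fps_const var) * F_reduced g"
proof -
  have T: "taylor_at (brace_Q g) (sinh_h a) = QT_power g a - QT_power g (- a)" for a
    by (simp add: sinh_h_def taylor_at_diff taylor_at_exp)
  have F: "taylor_at (brace_Q g) sinh_quotient * (QT_power g 1 - QT_power g (- 1)) = QT_power g var - QT_power g (- var)"
    unfolding T[symmetric] taylor_at_mult[symmetric] sinh_quotient_mult ..
  have "fps_nth (QT_power g 1 - QT_power g (- 1)) 0 = sinh_h 1"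
    unfolding T[symmetric] by (simp add: taylor_at_nth taylor_nth_0)
  then have nz: "QT_power g 1 - QT_power g (- 1) \<noteq> 0" using sinh_h_1_nonzero by auto
  have "F_series g = taylor_at (brace_Q g) sinh_quotient"
    unfolding F_series_def
  proof (rule the_equality)
    show "taylor_at (brace_Q g) sinh_quotient * (QT_power g 1 - QT_power g (- 1)) = QT_power g var - QT_power g (- var)"
      by (rule F)
  next
    fix f assume "f * (QT_power g 1 - QT_power g (- 1)) = QT_power g var - QT_power g (- var)"
    then have "f * (QT_power g 1 - QT_power g (- 1)) =
        taylor_at (brace_Q g) sinh_quotient * (QT_power g 1 - QT_power g (- 1))" unfolding F .
    then show "f = taylor_at (brace_Q g) sinh_quotient" using nz by (rule mult_right_cancel[THEN iffD1, rotated])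
  qed
  then show ?thesis by (simp add: sinh_quotient_eq taylor_at_const F_reduced_def)
qed

text \<open>The square of epsilon is exp(2 i pi / g); its k-th power is 1 only if g divides k. Hence
  the denominators in P do not vanish.\<close>

lemma root_eps_power_diff_nonzero:
  assumes "1 \<le> k" "k < g"
  shows "root_eps g ^ k - inverse (root_eps g ^ k) \<noteq> 0"
proof
  let ?z = "\<i> * of_real pi / of_nat g * of_nat k"
  assume "root_eps g ^ k - inverse (root_eps g ^ k) = 0"
  then have "root_eps g ^ k * root_eps g ^ k = inverse (root_eps g ^ k) * root_eps g ^ k" by simp
  also have "\<dots> = 1" by (simp add: root_eps_def)
  finally have 1: "root_eps g ^ k * root_eps g ^ k = 1" .
  have "root_eps g ^ k = exp ?z" by (simp add: root_eps_def exp_of_nat_mult[symmetric] mult.commute)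
  with 1 have "exp (?z + ?z) = 1" by (simp only: exp_add)
  then obtain n :: int where "Im (?z + ?z) = of_int (2 * n) * pi"
    unfolding exp_eq_1 by blast
  then have "2 * pi * real k / real g = 2 * of_int n * pi"
    by (simp add: field_simps)
  then have "real k = of_int n * real g" using assms by (simp add: field_simps)
  then have "real_of_int (int k) = real_of_int (n * int g)" by simp
  then have n: "int k = n * int g" by (simp only: of_int_eq_iff)
  have "n > 0"
  proof (rule ccontr)
    assume "\<not> n > 0"
    then have "n * int g \<le> 0" by (intro mult_nonpos_nonneg) auto
    with n assms show False by simp
  qed
  then have "1 * int g \<le> n * int g" by (intro mult_right_mono) auto
  with n assms show False by simp
qed

text \<open>This is P(1) = 1: at u = v = 1 each factor of the product is 1, and so is the average in
  front. Consequently h + h' {x} becomes h' at h = 0.\<close>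

lemma brace_Q_0: "fps_nth (brace_Q g) 0 = 1"
proof -
  have prod: "fps_nth (\<Prod>k\<in>A. f k) 0 = (\<Prod>k\<in>A. fps_nth (f k) 0)" for f :: "nat \<Rightarrow> complex poly fps" and A
    by (induction A rule: infinite_finite_induct) auto
  have E: "fps_nth (exp_h a) 0 = 1" for a by (simp add: exp_h_nth one_pCons)
  have "(\<Prod>k=1..<g. fps_nth ((fps_const [:root_eps g ^ k:] * exp_h var - fps_const [:inverse (root_eps g ^ k):] * exp_h (- var)) *
      fps_const [:inverse (root_eps g ^ k - inverse (root_eps g ^ k)):]) 0) = 1"
    using root_eps_power_diff_nonzero[of _ g] by (intro prod.neutral) (auto simp: E one_pCons)
  moreover have "Polynomial.smult (1 / 2) 2 = (1 :: complex poly)"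
    by (simp add: numeral_poly one_pCons)
  ultimately show ?thesis
    by (simp add: brace_Q_def laurent_P_def Let_def prod E fps_power_zeroth)
qed

text \<open>At h' = 0 only the zeroth Taylor term is left. At h = 0 the multiplier {x} is 1, so h'
  takes the role of h. Both parts about the one-parameter algebra rest on this agreement.\<close>

lemma F_reduced_nth:
  "fps_nth (F_reduced g) 0 = sinh_quotient_reduced"
  "fps_nth (fps_nth (F_reduced g) j) 0 = fps_nth sinh_quotient_reduced j"
  by (simp_all add: F_reduced_def taylor_at_nth taylor_nth_0 taylor_nth brace_Q_0 fps_power_zeroth)

section \<open>Substitution of elements of C[H, sqrt C] for x, and the commutator identity\<close>

lemma map_poly_hom_add:
  assumes "f 0 = 0" "\<And>a b. f (a + b) = f a + f b"
  shows "map_poly f (p + q) = map_poly f p + map_poly f q"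
  by (rule poly_eqI) (simp add: coeff_map_poly assms)

lemma map_poly_hom_smult:
  assumes "f 0 = 0" "\<And>a b. f (a * b) = f a * f b"
  shows "map_poly f (Polynomial.smult a p) = Polynomial.smult (f a) (map_poly f p)"
  by (rule poly_eqI) (simp add: coeff_map_poly assms)

lemma map_poly_hom_mult:
  fixes p q :: "'a::comm_ring_1 poly"
  assumes "f 0 = 0" "\<And>a b. f (a + b) = f a + f b" "\<And>a b. f (a * b) = f a * f b"
  shows "map_poly f (p * q) = map_poly f p * (map_poly f q :: 'b::comm_ring_1 poly)"
proof (induction p)
  case (pCons a p)
  have pc: "map_poly f (pCons b r) = pCons (f b) (map_poly f r)" for b r
    by (rule poly_eqI) (auto simp: coeff_map_poly coeff_pCons assms(1) split: nat.splits)
  show ?case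
    by (simp add: pc map_poly_hom_add map_poly_hom_smult assms pCons)
qed simp

definition poly_subst :: "complex poly poly \<Rightarrow> complex poly \<Rightarrow> complex poly poly" where
  "poly_subst p q = poly (map_poly (\<lambda>c. [:[:c:]:]) q) p"

lemma poly_subst_simps:
  "poly_subst p (q + r) = poly_subst p q + poly_subst p r"
  "poly_subst p (q * r) = poly_subst p q * poly_subst p r"
  "poly_subst p 0 = 0" "poly_subst p 1 = 1" "poly_subst p [:c:] = [:[:c:]:]" "poly_subst p var = p"
  by (simp_all add: poly_subst_def map_poly_hom_add map_poly_hom_mult map_poly_pCons one_pCons[symmetric])

lemma poly_subst_uminus: "poly_subst p (- q) = - poly_subst p q"
  using poly_subst_simps(1)[of p q "- q"] by (simp add: poly_subst_simps eq_neg_iff_add_eq_0 add.commute)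

lemma poly_subst_diff: "poly_subst p (q - r) = poly_subst p q - poly_subst p r"
  using poly_subst_simps(1)[of p q "- r"] by (simp add: poly_subst_uminus)

lemma poly_subst_power: "poly_subst p (q ^ n) = poly_subst p q ^ n"
  by (induction n) (simp_all add: poly_subst_simps)

lemma poly_subst_sum: "poly_subst p (sum f A) = (\<Sum>a\<in>A. poly_subst p (f a))"
  by (induction A rule: infinite_finite_induct) (simp_all add: poly_subst_simps)

lemma poly_subst_H: "poly_subst [:[:0, 1:]:] q = [:q:]"
proof (induction q)
  case (pCons a q)
  have "pCons a q = [:a:] + var * q" by simp
  then show ?case by (simp only: poly_subst_simps pCons) simp
qed (simp add: poly_subst_simps)

definition fps_subst :: "complex poly poly \<Rightarrow> complex poly fps \<Rightarrow> complex poly poly fps" where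
  "fps_subst p f = Abs_fps (\<lambda>n. poly_subst p (fps_nth f n))"

lemma fps_subst_nth: "fps_nth (fps_subst p f) n = poly_subst p (fps_nth f n)"
  by (simp add: fps_subst_def)

lemma fps_subst_mult: "fps_subst p (f * g) = fps_subst p f * fps_subst p g"
  by (rule fps_ext) (simp add: fps_subst_nth fps_mult_nth poly_subst_sum poly_subst_simps)

lemma fps_subst_diff: "fps_subst p (f - g) = fps_subst p f - fps_subst p g"
  by (rule fps_ext) (simp add: fps_subst_nth poly_subst_diff)

lemma fps_subst_const: "fps_subst p (fps_const c) = fps_const (poly_subst p c)"
  by (rule fps_ext) (simp add: fps_subst_nth poly_subst_simps)

definition exp_HC :: "complex poly poly \<Rightarrow> complex poly poly fps" where
  "exp_HC = exp_series (\<lambda>c. [:[:c:]:])"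

lemmas exp_HC_add = emb_poly_poly.exp_series_add[folded exp_HC_def]

lemma fps_subst_exp: "fps_subst p (exp_h a) = exp_HC (poly_subst p a)"
  by (rule fps_ext)
     (simp only: fps_subst_nth exp_h_nth exp_HC_def emb_poly_poly.exp_series_nth poly_subst_simps poly_subst_power)

definition sinh_HC :: "complex poly poly \<Rightarrow> complex poly poly fps" where
  "sinh_HC a = exp_HC a - exp_HC (- a)"

lemma fps_subst_sinh: "fps_subst p (sinh_h a) = sinh_HC (poly_subst p a)"
  by (simp add: sinh_h_def sinh_HC_def fps_subst_diff fps_subst_exp poly_subst_uminus)

lemma fps_subst_sinh_quotient: "fps_subst p sinh_quotient * sinh_HC 1 = sinh_HC p"
  using arg_cong[OF sinh_quotient_mult, of "fps_subst p"]
  by (simp add: fps_subst_mult fps_subst_sinh poly_subst_simps)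

lemma sinh_HC_1_nonzero: "sinh_HC 1 \<noteq> 0"
proof
  assume "sinh_HC 1 = 0"
  then have "fps_nth (sinh_HC 1) 1 = 0" by simp
  then show False by (simp add: sinh_HC_def exp_HC_def emb_poly_poly.exp_series_nth)
qed

lemma sinh_HC_mult:
  "sinh_HC a * sinh_HC b = exp_HC (a + b) + exp_HC (- (a + b)) - exp_HC (a - b) - exp_HC (- (a - b))"
  by (simp add: sinh_HC_def algebra_simps flip: exp_HC_add)

lemma H_arg_sum: "H_arg 1 s + H_arg (- 1) s = [:0, 1:]"
  and H_arg_diff: "H_arg 1 s - H_arg (- 1) s = [:[:- s, 1:]:]"
  by (simp_all add: H_arg_def one_pCons)

text \<open>The product formula for hyperbolic sines turns the difference of the two products into
  \<open>sinh(h H) sinh(h)\<close>.\<close>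

lemma sinh_quotient_commutator:
  "fps_subst (H_arg 1 1) sinh_quotient * fps_subst (H_arg (- 1) 1) sinh_quotient
   - fps_subst (H_arg 1 (- 1)) sinh_quotient * fps_subst (H_arg (- 1) (- 1)) sinh_quotient
   = fps_subst [:[:0, 1:]:] sinh_quotient" (is "?L = ?R")
proof -
  have S: "sinh_HC p = fps_subst p sinh_quotient * w" if "w = sinh_HC 1" for p w
    using that by (simp add: fps_subst_sinh_quotient)
  define w where "w = sinh_HC 1"
  have "?L * (w * w) =
    sinh_HC (H_arg 1 1) * sinh_HC (H_arg (- 1) 1) - sinh_HC (H_arg 1 (- 1)) * sinh_HC (H_arg (- 1) (- 1))"
    unfolding S[OF w_def] by (simp only: left_diff_distrib right_diff_distrib mult_ac)
  also have "\<dots> = sinh_HC [:[:0, 1:]:] * sinh_HC 1"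
  proof -
    \<comment> \<open>Both pairs of arguments have sum sqrt C, whose exponentials cancel in the
      difference. Their differences H - 1 and H + 1 are exactly what the same formula yields for H
      and 1.\<close>
    have 1: "[:[:0, 1:]:] + 1 = [:[:- (- 1), 1 :: complex:]:]" "[:[:0, 1:]:] - 1 = [:[:- 1, 1 :: complex:]:]"
      by (simp_all add: one_pCons)
    have "(a + b - c - d) - (a + b - e - f) = e + f - c - d" for a b c d e f :: "complex poly poly fps"
      by (simp add: algebra_simps)
    then show ?thesis unfolding sinh_HC_mult H_arg_sum H_arg_diff 1 .
  qed
  also have "\<dots> = ?R * (w * w)"
    unfolding S[OF w_def, of "[:[:0, 1:]:]"] w_def[symmetric] by (simp only: mult_ac)
  finally have "?L * (w * w) = ?R * (w * w)" .
  moreover have "w * w \<noteq> 0" using sinh_HC_1_nonzero by (simp add: w_def)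
  ultimately show ?thesis by (metis mult_right_cancel)
qed

text \<open>This is (C - (H - s)^2) / 4, the value of the product of X+ and X- in the undeformed
  algebra, with X+ on the left for s = 1 and X- on the left for s = -1.\<close>

definition casimir_factor :: "complex \<Rightarrow> complex poly poly" where
  "casimir_factor s = H_arg 1 s * H_arg (- 1) s"

text \<open>The coefficient of h^n in G(H_1) G(H_-1), where sinh(h x) / sinh(h) = x G(x); the twist
  of X+ in the one-parameter algebra.\<close>

definition \<gamma> :: "complex \<Rightarrow> nat \<Rightarrow> complex poly poly" where
  "\<gamma> s n = fps_nth (fps_subst (H_arg 1 s) sinh_quotient_reduced *
     fps_subst (H_arg (- 1) s) sinh_quotient_reduced) n"

lemma \<gamma>_commutator:
  "casimir_factor 1 * \<gamma> 1 n - casimir_factor (- 1) * \<gamma> (- 1) n = [:fps_nth sinh_quotient n:]"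
proof -
  have *: "fps_subst p sinh_quotient = fps_const p * fps_subst p sinh_quotient_reduced" for p
    by (simp add: sinh_quotient_eq fps_subst_mult fps_subst_const poly_subst_simps)
  have "fps_nth (fps_subst (H_arg 1 s) sinh_quotient * fps_subst (H_arg (- 1) s) sinh_quotient) n =
      casimir_factor s * \<gamma> s n" for s
  proof -
    have "fps_subst (H_arg 1 s) sinh_quotient * fps_subst (H_arg (- 1) s) sinh_quotient =
      fps_const (casimir_factor s) * (fps_subst (H_arg 1 s) sinh_quotient_reduced *
       fps_subst (H_arg (- 1) s) sinh_quotient_reduced)"
      unfolding * casimir_factor_def fps_const_mult[symmetric] by (simp only: mult_ac)
    then show ?thesis by (simp add: \<gamma>_def)
  qed
  then show ?thesis
    using arg_cong[OF sinh_quotient_commutator, of "\<lambda>f. fps_nth f n"]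
    by (simp add: fps_subst_nth poly_subst_H)
qed

lemma \<gamma>_0: "\<gamma> s 0 = 1"
  by (simp add: \<gamma>_def fps_subst_nth sinh_quotient_reduced poly_subst_simps)

definition F_reduced_at :: "nat \<Rightarrow> complex poly poly \<Rightarrow> complex poly poly fps fps" where
  "F_reduced_at g p = Abs_fps (\<lambda>j. fps_subst p (fps_nth (F_reduced g) j))"

definition \<Gamma> :: "nat \<Rightarrow> complex \<Rightarrow> nat \<Rightarrow> nat \<Rightarrow> complex poly poly" where
  "\<Gamma> g s i j = fps_nth (fps_nth (F_reduced_at g (H_arg 1 s) * F_reduced_at g (H_arg (- 1) s)) j) i"

lemma F_at_product_nth:
  "fps_nth (fps_nth (F_at g (H_arg 1 s) * F_at g (H_arg (- 1) s)) j) i = casimir_factor s * \<Gamma> g s i j"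
proof -
  have *: "F_at g p = fps_const (fps_const p) * F_reduced_at g p" for p
    by (intro fps_ext)
       (simp add: F_at_def F_series_eq F_reduced_at_def fps_subst_nth poly_subst_simps del: mult_pCons_left
         flip: poly_subst_def)
  have "F_at g (H_arg 1 s) * F_at g (H_arg (- 1) s) =
     fps_const (fps_const (casimir_factor s)) * (F_reduced_at g (H_arg 1 s) * F_reduced_at g (H_arg (- 1) s))"
    unfolding * casimir_factor_def fps_const_mult[symmetric] by (simp only: mult_ac)
  then show ?thesis by (simp add: \<Gamma>_def)
qed

lemma \<Gamma>_h: "\<Gamma> g s i 0 = \<gamma> s i"
  by (simp add: \<Gamma>_def \<gamma>_def F_reduced_at_def F_reduced_nth)

lemma \<Gamma>_h': "\<Gamma> g s 0 j = \<gamma> s j"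
proof -
  have 0: "fps_nth (sum f A) 0 = (\<Sum>a\<in>A. fps_nth (f a) 0)" for f :: "nat \<Rightarrow> complex poly poly fps" and A
    by (induction A rule: infinite_finite_induct) auto
  show ?thesis
    by (simp add: \<Gamma>_def \<gamma>_def F_reduced_at_def fps_mult_nth[of _ _ j] 0 fps_subst_nth F_reduced_nth)
qed

section \<open>Polynomials even in sqrt C, and the shift of H by 2\<close>

definition even_part :: "'a::zero poly \<Rightarrow> 'a poly" where
  "even_part r = Abs_poly (\<lambda>k. Polynomial.coeff r (2 * k))"

lemma coeff_even_part: "Polynomial.coeff (even_part r) k = Polynomial.coeff r (2 * k)"
proof -
  have "\<forall>\<^sub>\<infinity>k. Polynomial.coeff r (2 * k) = 0"
    by (rule MOST_nat[THEN iffD2, OF exI[of _ "Polynomial.degree r"]]) (auto intro: coeff_eq_0)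
  then show ?thesis by (simp add: even_part_def Abs_poly_inverse)
qed

lemma even_part_diff: "even_part (p - q) = even_part p - even_part (q :: 'a::ab_group_add poly)"
  by (rule poly_eqI) (simp add: coeff_even_part)

lemma even_part_const: "even_part [:a:] = [:a:]"
  by (rule poly_eqI) (simp add: coeff_even_part coeff_pCons split: nat.splits)

lemma even_part_1: "even_part 1 = (1 :: 'a::comm_semiring_1 poly)"
  by (simp add: one_pCons even_part_const)

text \<open>The even part is multiplicative when one factor is even in sqrt C, though not for
  arbitrary factors. \<open>casimir_factor\<close> has the shape required here.\<close>

lemma even_part_mult: "even_part ([:u, 0, v:] * r) = [:u, v:] * even_part (r :: 'a::comm_ring_1 poly)"
  by (rule poly_eqI) (auto simp: coeff_even_part coeff_pCons split: nat.splits)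

lemma casimir_factor_eq:
  "casimir_factor s = [:- ([:- s / 2, 1 / 2:] * [:- s / 2, 1 / 2:]), 0, [:1 / 4:]:]"
  by (simp add: casimir_factor_def H_arg_def)

text \<open>Records the commutation X- p(H) = p(H + 2) X-.\<close>

definition shift2 :: "complex poly \<Rightarrow> complex poly" where
  "shift2 p = pcompose p [:2, 1:]"

lemma shift2_simps: "shift2 0 = 0" "shift2 (p + q) = shift2 p + shift2 q" "shift2 (p * q) = shift2 p * shift2 q"
  "shift2 [:c:] = [:c:]" "shift2 var = [:2, 1:]"
  by (simp_all add: shift2_def pcompose_add pcompose_mult pcompose_pCons)

lemma map_shift2_poly_subst: "map_poly shift2 (poly_subst p q) = poly_subst (map_poly shift2 p) q"
proof (induction q)
  case (pCons a q)
  have *: "pCons a q = [:a:] + var * q" by simp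
  have "map_poly shift2 [:[:a:]:] = [:[:a:]:]" by (simp add: map_poly_pCons shift2_simps)
  then show ?case
    unfolding * by (simp only: poly_subst_simps pCons map_poly_hom_add map_poly_hom_mult shift2_simps)
qed (simp add: poly_subst_simps)

text \<open>Replacing H by H + 2 changes e H - e into e H + e, that is, the upper sign into the
  lower one. So carrying X- past the twist with upper sign produces the twist demanded by the
  relation for X- X+.\<close>

lemma map_shift2_H_arg: "map_poly shift2 (H_arg e 1) = H_arg e (- 1)"
proof -
  have "shift2 [:- e / 2, e / 2:] = [:- e / 2:] + [:e / 2:] * [:2, 1:]"
    by (simp add: shift2_def pcompose_pCons)
  then show ?thesis
    by (simp add: H_arg_def map_poly_pCons shift2_simps)
qed

lemma map_shift2_sum: "map_poly shift2 (sum f A) = (\<Sum>a\<in>A. map_poly shift2 (f a))"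
  by (induction A rule: infinite_finite_induct) (simp_all add: map_poly_hom_add shift2_simps)

lemma fps_nth_sum: "fps_nth (sum f A) n = (\<Sum>a\<in>A. fps_nth (f a) n)"
  by (induction A rule: infinite_finite_induct) auto

lemma map_shift2_\<gamma>: "map_poly shift2 (\<gamma> 1 n) = \<gamma> (- 1) n"
  by (simp add: \<gamma>_def fps_mult_nth map_shift2_sum fps_subst_nth map_poly_hom_mult shift2_simps
      map_shift2_poly_subst map_shift2_H_arg)

lemma map_shift2_\<Gamma>: "map_poly shift2 (\<Gamma> g 1 i j) = \<Gamma> g (- 1) i j"
  by (simp add: \<Gamma>_def F_reduced_at_def fps_mult_nth fps_nth_sum map_shift2_sum fps_subst_nth
      map_poly_hom_mult shift2_simps map_shift2_poly_subst map_shift2_H_arg)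

lemma even_part_map_shift2: "even_part (map_poly shift2 r) = map_poly shift2 (even_part r)"
  by (rule poly_eqI) (simp add: coeff_even_part coeff_map_poly shift2_simps)

section \<open>Evaluation of polynomials in noncommutative rings\<close>

definition eval_poly :: "('a::comm_ring_1 \<Rightarrow> 'r::ring_1) \<Rightarrow> 'r \<Rightarrow> 'a poly \<Rightarrow> 'r" where
  "eval_poly \<phi> c p = (\<Sum>k\<le>Polynomial.degree p. \<phi> (Polynomial.coeff p k) * c ^ k)"

locale poly_evaluation =
  fixes \<phi> :: "'a::comm_ring_1 \<Rightarrow> 'r::ring_1" and c :: 'r
  assumes hom_add: "\<phi> (a + b) = \<phi> a + \<phi> b"
    and hom_mult: "\<phi> (a * b) = \<phi> a * \<phi> b"
    and hom_one: "\<phi> 1 = 1"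
    and commute: "c * \<phi> a = \<phi> a * c"
begin

lemma hom_zero: "\<phi> 0 = 0"
  using hom_add[of 0 0] by simp

lemma eval_poly_superset:
  assumes "Polynomial.degree p \<le> n"
  shows "eval_poly \<phi> c p = (\<Sum>k\<le>n. \<phi> (Polynomial.coeff p k) * c ^ k)"
  unfolding eval_poly_def using assms
  by (intro sum.mono_neutral_left) (auto simp: hom_zero coeff_eq_0)

lemma eval_poly_0: "eval_poly \<phi> c 0 = 0"
  by (simp add: eval_poly_def hom_zero)

lemma eval_poly_add: "eval_poly \<phi> c (p + q) = eval_poly \<phi> c p + eval_poly \<phi> c q"
proof -
  let ?n = "max (Polynomial.degree p) (Polynomial.degree q)"
  have "Polynomial.degree (p + q) \<le> ?n" by (rule degree_add_le) auto
  then show ?thesis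
    by (simp add: eval_poly_superset[of _ ?n] hom_add distrib_right sum.distrib)
qed

lemma eval_poly_diff: "eval_poly \<phi> c (p - q) = eval_poly \<phi> c p - eval_poly \<phi> c q"
  using eval_poly_add[of "p - q" q] by simp

lemma eval_poly_pCons: "eval_poly \<phi> c (pCons a p) = \<phi> a + eval_poly \<phi> c p * c"
proof -
  let ?n = "Polynomial.degree p"
  have "eval_poly \<phi> c (pCons a p) = (\<Sum>k\<le>Suc ?n. \<phi> (Polynomial.coeff (pCons a p) k) * c ^ k)"
    by (rule eval_poly_superset) (rule degree_pCons_le)
  also have "\<dots> = \<phi> a + (\<Sum>k\<le>?n. \<phi> (Polynomial.coeff p k) * c ^ Suc k)"
    by (subst sum.atMost_Suc_shift) simp
  also have "\<dots> = \<phi> a + eval_poly \<phi> c p * c"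
    by (simp add: eval_poly_def sum_distrib_right power_Suc2 mult.assoc del: power_Suc)
  finally show ?thesis .
qed

lemma eval_poly_const: "eval_poly \<phi> c [:a:] = \<phi> a"
  by (simp add: eval_poly_def)

lemma eval_poly_smult: "eval_poly \<phi> c (Polynomial.smult a p) = \<phi> a * eval_poly \<phi> c p"
  by (induction p) (simp_all add: eval_poly_0 eval_poly_pCons hom_mult distrib_left mult.assoc)

lemma eval_poly_commute:
  assumes "x * c = c * x" "\<And>a. x * \<phi> a = \<phi> a * x"
  shows "x * eval_poly \<phi> c p = eval_poly \<phi> c p * x"
proof (induction p)
  case (pCons a p)
  have "x * (eval_poly \<phi> c p * c) = eval_poly \<phi> c p * c * x"
    by (metis assms(1) mult.assoc pCons.IH)
  then show ?case by (simp add: eval_poly_pCons assms(2) distrib_left distrib_right)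
qed (simp add: eval_poly_0)

lemma eval_poly_mult: "eval_poly \<phi> c (p * q) = eval_poly \<phi> c p * eval_poly \<phi> c q"
proof (induction p)
  case (pCons a p)
  have "c * eval_poly \<phi> c q = eval_poly \<phi> c q * c"
    by (rule eval_poly_commute) (simp_all add: commute)
  then have "eval_poly \<phi> c p * c * eval_poly \<phi> c q = eval_poly \<phi> c p * eval_poly \<phi> c q * c"
    by (simp add: mult.assoc)
  then show ?case
    by (simp add: eval_poly_add eval_poly_pCons eval_poly_smult hom_zero pCons distrib_right)
qed (simp add: eval_poly_0)

text \<open>An element that intertwines the two points and moves the coefficients by
  \<open>\<sigma>\<close> does the same to whole polynomials. It is applied to X-, with the Casimir
  element as both points and \<open>shift2\<close> on the coefficients.\<close>

lemma eval_poly_shift: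
  assumes "x * d = c * x" "\<And>a. x * \<psi> a = \<phi> (\<sigma> a) * x" "poly_evaluation \<psi> d" "\<sigma> 0 = 0"
  shows "x * eval_poly \<psi> d p = eval_poly \<phi> c (map_poly \<sigma> p) * x"
proof (induction p)
  case 0
  then show ?case by (simp add: eval_poly_0 poly_evaluation.eval_poly_0[OF assms(3)])
next
  case (pCons a p)
  have "x * (eval_poly \<psi> d p * d) = eval_poly \<phi> c (map_poly \<sigma> p) * c * x"
    by (metis assms(1) mult.assoc pCons.IH)
  moreover have "map_poly \<sigma> (pCons a p) = pCons (\<sigma> a) (map_poly \<sigma> p)"
    using pCons.hyps by (intro map_poly_pCons) (auto simp: assms(4))
  ultimately show ?case
    by (simp add: eval_poly_pCons poly_evaluation.eval_poly_pCons[OF assms(3)] assms(2) distrib_left distrib_right)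
qed

end

section \<open>Presentations of the deformed algebras\<close>

definition casimir :: usl2 where
  "casimir = 4 * (XM * XP) + (HH + 1) * (HH + 1)"

lemma small_numerals:
  fixes x :: "'a::ring_1"
  shows "2 * x = x + x" "x * 2 = x + x" "3 * x = x + x + x" "x * 3 = x + x + x"
    "4 * x = x + x + x + x" "x * 4 = x + x + x + x" "8 * x = 4 * x + 4 * x"
proof -
  have 3: "(3 :: 'a) = 1 + 1 + 1" and 4: "(4 :: 'a) = 1 + 1 + 1 + 1" by simp_all
  show "8 * x = 4 * x + 4 * x" by (simp flip: distrib_right)
  show "2 * x = x + x" "x * 2 = x + x" by (rule mult_2, rule mult_2_right)
  show "3 * x = x + x + x" "x * 3 = x + x + x" "4 * x = x + x + x + x" "x * 4 = x + x + x + x"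
    unfolding 3 4 by (simp_all only: distrib_left distrib_right mult_1_left mult_1_right)
qed

lemma usc_uminus: "usc (- c) = - usc c"
  using U.sc_add[of c "- c"] by (simp add: U.sc_zero eq_neg_iff_add_eq_0 add.commute)

lemma XM_HH: "XM * HH = HH * XM + 2 * XM" and XP_HH: "XP * HH = HH * XP - 2 * XP"
  by (simp_all add: usl2_relations)

lemma casimir_commute_HH: "HH * casimir = casimir * HH"
proof -
  have "HH * (XM * XP) = (XM * HH - 2 * XM) * XP" by (simp add: usl2_relations(2) flip: mult.assoc)
  also have "\<dots> = XM * (HH * XP) - 2 * (XM * XP)" by (simp add: left_diff_distrib mult.assoc)
  also have "\<dots> = XM * XP * HH"
    by (simp add: usl2_relations(1) distrib_left mult.assoc) (simp add: mult_2 mult_2_right distrib_left distrib_right)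
  finally have 1: "HH * (XM * XP) = XM * XP * HH" .
  have 4: "HH * (4 * x) = 4 * (HH * x)" for x :: usl2
    using mult_of_nat_commute[of 4 HH] by (simp flip: mult.assoc)
  show ?thesis
    unfolding casimir_def distrib_left[of HH] distrib_right[of _ _ HH] 4 1
    by (simp add: mult.assoc distrib_left distrib_right)
qed

lemma four_commute: "4 * x = x * (4 :: usl2)"
  using mult_of_nat_commute[of 4 x] by simp

text \<open>Moving X+ through (H + 1)^2 gives (H - 1)^2; the missing 4 H is the commutator arising
  when 4 X+ X- is rewritten as 4 X- X+ + 4 H.\<close>

lemma casimir_commute_XP: "XP * casimir = casimir * XP"
proof -
  have s: "XP * (HH + 1) = (HH - 1) * XP"
    by (simp add: distrib_left left_diff_distrib XP_HH) (simp add: mult_2)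
  have "XP * ((HH + 1) * (HH + 1)) = XP * (HH + 1) * (HH + 1)" by (simp only: mult.assoc)
  also have "\<dots> = (HH - 1) * (HH - 1) * XP" by (simp only: s mult.assoc)
  finally have 1: "XP * ((HH + 1) * (HH + 1)) = (HH - 1) * (HH - 1) * XP" .
  have "XP * (4 * (XM * XP)) = XP * 4 * (XM * XP)" by (simp only: mult.assoc)
  also have "\<dots> = 4 * ((XP * XM) * XP)" by (simp only: four_commute[of XP, symmetric] mult.assoc)
  finally have "XP * (4 * (XM * XP)) = 4 * ((XP * XM) * XP)" .
  then have "XP * casimir = (4 * (XM * XP + HH) + (HH - 1) * (HH - 1)) * XP"
    unfolding casimir_def distrib_left[of XP] 1 usl2_relations(3) by (simp add: distrib_right mult.assoc)
  also have "4 * (XM * XP + HH) + (HH - 1) * (HH - 1) = casimir"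
    by (simp add: casimir_def algebra_simps small_numerals)
  finally show ?thesis .
qed

lemma casimir_commute_XM: "XM * casimir = casimir * XM"
proof -
  have s: "XM * (HH + 1) = (HH + 3) * XM"
    by (simp add: distrib_left distrib_right XM_HH small_numerals)
  have "XM * ((HH + 1) * (HH + 1)) = XM * (HH + 1) * (HH + 1)" by (simp only: mult.assoc)
  also have "\<dots> = (HH + 3) * (HH + 3) * XM" by (simp only: s mult.assoc)
  finally have 1: "XM * ((HH + 1) * (HH + 1)) = (HH + 3) * (HH + 3) * XM" .
  have "XM * (4 * (XM * XP)) = XM * 4 * (XM * XP)" by (simp only: mult.assoc)
  also have "\<dots> = 4 * (XM * (XM * XP))" by (simp only: four_commute[of XM, symmetric] mult.assoc)
  finally have 2: "XM * (4 * (XM * XP)) = 4 * (XM * (XM * XP))" .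
  have "casimir * XM = 4 * (XM * (XP * XM)) + (HH + 1) * (HH + 1) * XM"
    by (simp add: casimir_def distrib_right mult.assoc)
  also have "\<dots> = 4 * (XM * (XM * XP)) + (4 * (HH + 2) + (HH + 1) * (HH + 1)) * XM"
    by (simp add: usl2_relations(3) distrib_left distrib_right XM_HH mult.assoc small_numerals)
  also have "4 * (HH + 2) + (HH + 1) * (HH + 1) = (HH + 3) * (HH + 3)"
    by (simp add: algebra_simps small_numerals)
  finally have "casimir * XM = 4 * (XM * (XM * XP)) + (HH + 3) * (HH + 3) * XM" .
  moreover have "XM * casimir = 4 * (XM * (XM * XP)) + (HH + 3) * (HH + 3) * XM"
    unfolding casimir_def distrib_left[of XM] 1 2 ..
  ultimately show ?thesis by simp
qed

interpretation eval_H: poly_evaluation usc HH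
  by standard (simp_all only: U.sc_add U.sc_mult U.sc_one U.sc_central[of _ HH])

abbreviation eval_H :: "complex poly \<Rightarrow> usl2" where
  "eval_H \<equiv> eval_poly usc HH"

interpretation eval_HC: poly_evaluation eval_H casimir
proof
  fix p q
  show "eval_H 1 = 1" using eval_H.eval_poly_const[of 1] by (simp add: one_pCons U.sc_one)
  show "casimir * eval_H p = eval_H p * casimir"
    by (rule eval_H.eval_poly_commute) (simp_all add: casimir_commute_HH U.sc_central[of _ casimir])
qed (simp_all add: eval_H.eval_poly_add eval_H.eval_poly_mult)

text \<open>Only C, and no square root of it, is given a value in the enveloping algebra, so the
  even part is taken before C is replaced by the Casimir element.\<close>

definition eval_U :: "complex poly poly \<Rightarrow> usl2" where
  "eval_U r = eval_poly eval_H casimir (even_part r)"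

lemma eval_U_const: "eval_U [:p:] = eval_H p"
  by (simp add: eval_U_def even_part_const eval_HC.eval_poly_const)

lemma eval_U_1: "eval_U 1 = 1"
  using eval_U_const[of 1] eval_HC.hom_one by (simp add: one_pCons)

lemma eval_U_diff: "eval_U (p - q) = eval_U p - eval_U q"
  by (simp add: eval_U_def even_part_diff eval_HC.eval_poly_diff)

lemma even_part_casimir_factor_mult:
  "even_part (casimir_factor s * r) = even_part (casimir_factor s) * even_part r"
  using even_part_mult[of _ _ 1] even_part_mult[of _ _ r]
  unfolding casimir_factor_eq by (metis even_part_1 mult_1_right)

lemma eval_U_casimir_factor_mult: "eval_U (casimir_factor s * r) = eval_U (casimir_factor s) * eval_U r"
  by (simp add: eval_U_def even_part_casimir_factor_mult eval_HC.eval_poly_mult)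

lemma eval_U_commute_HH: "HH * eval_U r = eval_U r * HH"
  unfolding eval_U_def
  by (rule eval_HC.eval_poly_commute)
     (simp_all add: casimir_commute_HH eval_H.eval_poly_commute U.sc_central[of _ HH])

lemma usc_left_commute: "(HH - usc c) * (usc d * x) = usc d * ((HH - usc c) * x)"
  by (metis U.sc_central mult.assoc)

text \<open>The factor is (C - (H - s)^2) / 4 with C = 4 X- X+ + (H + 1)^2. For s = -1 the squares
  cancel; for s = 1 they leave 4 H, which turns X- X+ into X+ X-.\<close>

lemma eval_U_casimir_factor:
  "eval_U (casimir_factor (- 1)) = XM * XP" "eval_U (casimir_factor 1) = XP * XM"
proof -
  have half: "usc (1 / 2) * usc (1 / 2) = usc (1 / 4)" by (simp flip: U.sc_mult)
  have ev: "eval_U (casimir_factor s) = usc (1 / 4) * (casimir - (HH - usc s) * (HH - usc s))" for s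
  proof -
    have q: "eval_H [:- s / 2, 1 / 2:] = usc (1 / 2) * (HH - usc s)"
      using U.sc_mult[of "1/2" s]
      by (simp add: eval_H.eval_poly_pCons eval_H.eval_poly_0 right_diff_distrib usc_uminus)
    define q where "q = [:- s / 2, 1 / 2:]"
    have "eval_H (- p) = - eval_H p" for p
      using eval_H.eval_poly_diff[of 0 p] by (simp add: eval_H.eval_poly_0)
    moreover have cf: "casimir_factor s = [:- (q * q), 0, [:1 / 4:]:]"
      by (simp only: casimir_factor_eq q_def)
    ultimately have "eval_U (casimir_factor s) = - (eval_H q * eval_H q) + usc (1 / 4) * casimir"
      using even_part_mult[of "- (q * q)" "[:1/4:]" 1]
      by (simp add: eval_U_def even_part_1 eval_HC.eval_poly_pCons eval_HC.eval_poly_0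
        eval_H.eval_poly_const eval_H.eval_poly_mult)
    also have "\<dots> = usc (1 / 4) * casimir - usc (1 / 4) * ((HH - usc s) * (HH - usc s))"
      unfolding q_def q half[symmetric] by (simp add: mult.assoc usc_left_commute)
    finally show ?thesis by (simp add: right_diff_distrib)
  qed
  have m1: "usc (- 1) = - 1" by (simp add: usc_uminus U.sc_one)
  have "usc (1 / 4) * usc (of_nat 4) = 1" by (simp add: U.sc_one flip: U.sc_mult)
  then have quarter: "usc (1 / 4) * (4 * x) = x" for x
    unfolding usc_of_nat by (simp flip: mult.assoc)
  show "eval_U (casimir_factor (- 1)) = XM * XP"
    by (simp add: ev m1 casimir_def quarter)
  have "casimir - (HH - 1) * (HH - 1) = 4 * (XM * XP + HH)" by (simp add: casimir_def algebra_simps small_numerals)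
  then show "eval_U (casimir_factor 1) = XP * XM"
    using quarter[of "XM * XP + HH"] by (simp only: ev U.sc_one usl2_relations(3))
qed

lemma XM_eval_H: "XM * eval_H p = eval_H (shift2 p) * XM"
proof (induction p)
  case (pCons a p)
  have s: "shift2 (pCons a p) = [:a:] + shift2 p * [:2, 1:]"
    by (simp add: shift2_def pcompose_pCons mult.commute)
  have two: "eval_H [:2, 1:] = HH + 2"
    by (simp add: eval_H.eval_poly_pCons eval_H.eval_poly_0 U.sc_one usc_2 add.commute)
  have "XM * (eval_H p * HH) = eval_H (shift2 p) * (XM * HH)" by (simp add: pCons.IH flip: mult.assoc)
  also have "XM * HH = (HH + 2) * XM" by (simp add: XM_HH distrib_right)
  finally have "XM * (eval_H p * HH) = eval_H (shift2 p) * ((HH + 2) * XM)" .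
  then show ?case
    unfolding s eval_H.eval_poly_add eval_H.eval_poly_mult two eval_H.eval_poly_const
    unfolding eval_H.eval_poly_pCons
    by (simp add: distrib_left distrib_right mult.assoc U.sc_central[of a XM])
qed (simp add: eval_H.eval_poly_0 shift2_simps)

lemma XM_eval_U: "XM * eval_U r = eval_U (map_poly shift2 r) * XM"
  unfolding eval_U_def even_part_map_shift2
  by (rule eval_HC.eval_poly_shift)
     (simp_all add: casimir_commute_XM XM_eval_H eval_HC.poly_evaluation_axioms shift2_simps)

text \<open>The product X+ X- is itself a polynomial in H and the Casimir element, hence commutes
  with \<open>eval_U r\<close>.\<close>

lemma XP_XM_eval_U: "eval_U r * XP * XM = eval_U (casimir_factor 1 * r)"
proof -
  have "eval_U r * (XP * XM) = (XP * XM) * eval_U r"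
  proof -
    have "casimir * eval_U r = eval_U r * casimir"
      unfolding eval_U_def by (rule eval_HC.eval_poly_commute) (simp_all add: eval_HC.commute)
    then have "eval_U (casimir_factor 1) * eval_U r = eval_U r * eval_U (casimir_factor 1)"
      unfolding eval_U_def by (simp add: mult.commute flip: eval_HC.eval_poly_mult)
    then show ?thesis by (simp add: eval_U_casimir_factor)
  qed
  then show ?thesis by (simp add: eval_U_casimir_factor_mult eval_U_casimir_factor mult.assoc)
qed

lemma XM_XP_eval_U: "XM * (eval_U r * XP) = eval_U (casimir_factor (- 1) * map_poly shift2 r)"
proof -
  have "XM * (eval_U r * XP) = eval_U (map_poly shift2 r) * (XM * XP)"
    by (simp add: XM_eval_U flip: mult.assoc)
  also have "\<dots> = eval_U (map_poly shift2 r) * eval_U (casimir_factor (- 1))"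
    by (simp add: eval_U_casimir_factor)
  also have "\<dots> = eval_U (casimir_factor (- 1) * map_poly shift2 r)"
    unfolding eval_U_casimir_factor_mult unfolding eval_U_def by (simp add: mult.commute flip: eval_HC.eval_poly_mult)
  finally show ?thesis .
qed

context scalars begin

lemma free_hom_eval_free: "free_hom sc \<phi> (eval_free p q) = eval_poly sc (free_hom sc \<phi> q) p"
  by (simp add: eval_free_def eval_poly_def free_hom_sum free_hom_mult free_hom_power)

end

lemma eval_poly_cser: "eval_poly (\<lambda>c. cser (\<phi> c)) (cser x) p = cser (eval_poly \<phi> x p)"
proof -
  have s: "cser (sum f A) = (\<Sum>a\<in>A. cser (f a))" for f and A :: "nat set"
    by (induction A rule: infinite_finite_induct) (simp_all add: cser_simps)
  have p: "cser (x ^ n) = cser x ^ n" for n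
    by (induction n) (simp_all add: cser_simps)
  show ?thesis by (simp add: eval_poly_def s p cser_simps)
qed

text \<open>The elements that \<open>lift_kernel\<close> asks to be liftable. They form an ideal of
  the free algebra, so liftability needs to be checked on generators only.\<close>

definition constant_terms :: "(('s::finite \<Rightarrow> nat) \<Rightarrow> 'x free) set \<Rightarrow> 'x free set" where
  "constant_terms rels = (\<lambda>r. mcoeff r (\<lambda>_. 0)) ` free.ideal_span rels"

lemma constant_terms:
  shows "0 \<in> constant_terms rels"
    and "p \<in> constant_terms rels \<Longrightarrow> q \<in> constant_terms rels \<Longrightarrow> p + q \<in> constant_terms rels"
    and "p \<in> constant_terms rels \<Longrightarrow> p * q \<in> constant_terms rels"
    and "p \<in> constant_terms rels \<Longrightarrow> q * p \<in> constant_terms rels"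
    and "r \<in> rels \<Longrightarrow> r (\<lambda>_. 0) \<in> constant_terms rels"
proof -
  show "0 \<in> constant_terms rels"
    unfolding constant_terms_def by (rule image_eqI[OF _ free.ideal_span(1)]) simp
  show "p \<in> constant_terms rels \<Longrightarrow> q \<in> constant_terms rels \<Longrightarrow> p + q \<in> constant_terms rels"
    unfolding constant_terms_def by (auto intro!: image_eqI[OF _ free.ideal_span(2)])
  show "p \<in> constant_terms rels \<Longrightarrow> p * q \<in> constant_terms rels"
    unfolding constant_terms_def
    by (auto intro!: image_eqI[OF _ free.ideal_span(3)[of _ _ "cser q"]])
  show "p \<in> constant_terms rels \<Longrightarrow> q * p \<in> constant_terms rels"
    unfolding constant_terms_def
    by (auto intro!: image_eqI[OF _ free.ideal_span(4)[of _ _ "cser q"]])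
  show "r \<in> rels \<Longrightarrow> r (\<lambda>_. 0) \<in> constant_terms rels"
    unfolding constant_terms_def by (rule image_eqI[OF _ free.ideal_span(5)]) simp_all
qed

lemma constant_terms_diff:
  "p \<in> constant_terms rels \<Longrightarrow> q \<in> constant_terms rels \<Longrightarrow> p - q \<in> constant_terms rels"
  using constant_terms(2)[of p rels "- q"] constant_terms(4)[of q rels "- 1"] by simp

lemma const_series_free_zero: "const_series free_algebra p (\<lambda>_. 0) = p"
  by (simp add: const_series_def)

text \<open>The image of \<open>X\<^sup>+\<close> in the power series over the enveloping algebra, twisted by a series in \<open>H\<close> and
  the Casimir element.\<close>

definition XP_series :: "(('s::finite \<Rightarrow> nat) \<Rightarrow> complex poly poly) \<Rightarrow> ('s, usl2) mser" where
  "XP_series c = Mser (\<lambda>m. eval_U (c m) * XP)"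

lemma XP_series_weight: "cser HH * XP_series c - XP_series c * cser HH - cser (usc 2) * XP_series c = 0"
proof (rule mser_eqI)
  fix m
  have "HH * (eval_U (c m) * XP) = eval_U (c m) * (HH * XP)"
    by (simp add: eval_U_commute_HH flip: mult.assoc)
  then show "mcoeff (cser HH * XP_series c - XP_series c * cser HH - cser (usc 2) * XP_series c) m = mcoeff 0 m"
    unfolding usl2_relations(1)
    by (simp add: XP_series_def distrib_left usc_2) (simp add: small_numerals distrib_left distrib_right mult.assoc)
qed

lemma XM_weight: "cser HH * cser XM - cser XM * cser HH + cser (usc 2) * cser XM = (0 :: ('s::finite, usl2) mser)"
proof -
  have "HH * XM - XM * HH + usc 2 * XM = 0" by (simp add: usl2_relations usc_2)
  then show ?thesis by (simp add: cser_simps[symmetric])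
qed

lemma mcoeff_XP_series_XM: "mcoeff (XP_series c * cser XM) m = eval_U (casimir_factor 1 * c m)"
  by (simp add: XP_series_def XP_XM_eval_U)

lemma mcoeff_XM_XP_series: "mcoeff (cser XM * XP_series c) m = eval_U (casimir_factor (- 1) * map_poly shift2 (c m))"
  by (simp add: XP_series_def XM_XP_eval_U)

section \<open>The presentation of the one-parameter algebra\<close>

primrec Uh_img :: "sl2_gen \<Rightarrow> (unit, usl2) mser" where
  "Uh_img Xp = XP_series (\<lambda>m. \<gamma> 1 (m ()))"
| "Uh_img Xm = cser XM"
| "Uh_img Hgen = cser HH"

lemma Mser_const_series: "Mser (const_series free_algebra p) = cser p"
  by (simp add: free_algebra_eq)

interpretation cU: scalars "\<lambda>c. cser (usc c) :: ('s::finite, usl2) mser"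
  by (rule U.scalars_cser)

interpretation Uh: series_hom usc Uh_img ..

lemma eval_free_var: "eval_free var a = (a :: 'x free)"
proof -
  have "scalar 0 = (0 :: 'x free)" "scalar 1 = (1 :: 'x free)" by (simp_all add: scalar_def single_Nil_one)
  then show ?thesis by (simp add: eval_free_def)
qed

lemma Uh_img_0: "mcoeff (Uh_img x) (\<lambda>_. 0) = ugen x"
  by (cases x) (simp_all add: XP_series_def \<gamma>_0 eval_U_1 mcoeff_mono)

lemma Uh_kills: "r \<in> Uh_rels \<Longrightarrow> Uh.ext (Mser r) = 0"
proof -
  assume "r \<in> Uh_rels"
  then consider "r = (\<lambda>m. const_series free_algebra (gen Xp * gen Xm - gen Xm * gen Xp) m
        - eval_free (fps_nth sinh_quotient (m ())) (gen Hgen))"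
    | p where "p \<in> weight_rels Hgen Xp Xm" "r = const_series free_algebra p"
    by (auto simp: Uh_rels_def)
  then show ?thesis
  proof cases
    case 1
    let ?E = "Mser (\<lambda>m :: unit \<Rightarrow> nat. eval_free (fps_nth sinh_quotient (m ())) (gen Hgen))"
    have r: "Mser r = cser (gen Xp * gen Xm - gen Xm * gen Xp) - ?E"
      by (rule mser_eqI) (simp add: 1 free_algebra_eq)
    have E: "Uh.ext ?E = Mser (\<lambda>m. eval_H (fps_nth sinh_quotient (m ())))"
      by (rule Uh.ext_diagonal) (simp add: cU.free_hom_eval_free eval_poly_cser)
    \<comment> \<open>Moving X- past the twist turns \<open>\<gamma> 1\<close> into
      \<open>\<gamma> (- 1)\<close>; the difference is then
      \<open>\<gamma>_commutator\<close>.\<close>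
    have "mcoeff (Uh_img Xp * Uh_img Xm - Uh_img Xm * Uh_img Xp) m = eval_H (fps_nth sinh_quotient (m ()))" for m
      by (simp add: mcoeff_XP_series_XM mcoeff_XM_XP_series map_shift2_\<gamma>
          del: mcoeff_cser_mult mcoeff_mult_cser flip: eval_U_diff)
         (simp add: \<gamma>_commutator eval_U_const)
    then have "Uh_img Xp * Uh_img Xm - Uh_img Xm * Uh_img Xp = Mser (\<lambda>m. eval_H (fps_nth sinh_quotient (m ())))"
      by (intro mser_eqI) (simp only: mcoeff_Mser)
    then show ?thesis
      unfolding r Uh.ext_diff Uh.ext_cser E by (simp add: cU.free_hom_diff cU.free_hom_mult)
  next
    case 2
    then show ?thesis
      unfolding 2(2) Mser_const_series Uh.ext_cser weight_rels_def using XP_series_weight XM_weight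
      by (auto simp: cU.free_hom_diff cU.free_hom_mult cU.free_hom_add)
  qed
qed

text \<open>sinh(h x) / sinh(h) has constant term x, so at h = 0 the commutator relation becomes the
  one of the enveloping algebra.\<close>

lemma sl2_rels_subset_Uh: "sl2_rels Hgen Xp Xm \<subseteq> constant_terms Uh_rels"
proof
  have f0: "fps_nth sinh_quotient 0 = var" by (simp add: sinh_quotient_eq sinh_quotient_reduced)
  fix p assume "p \<in> sl2_rels Hgen Xp Xm"
  then consider "p = gen Xp * gen Xm - gen Xm * gen Xp - gen Hgen" | "p \<in> weight_rels Hgen Xp Xm"
    by (auto simp: sl2_rels_def)
  then show "p \<in> constant_terms Uh_rels"
  proof cases
    case 1
    have "(\<lambda>m. const_series free_algebra (gen Xp * gen Xm - gen Xm * gen Xp) m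
        - eval_free (fps_nth sinh_quotient (m ())) (gen Hgen)) \<in> Uh_rels" by (simp add: Uh_rels_def)
    from constant_terms(5)[OF this] show ?thesis by (simp add: 1 const_series_free_zero f0 eval_free_var)
  next
    case 2
    then have "const_series free_algebra p \<in> Uh_rels" by (simp add: Uh_rels_def)
    from constant_terms(5)[OF this] show ?thesis by (simp add: const_series_free_zero)
  qed
qed

interpretation Uh: presentation usc Uh_img Uh_rels
proof
  have img: "(\<lambda>x. mcoeff (Uh_img x) (\<lambda>_. 0)) = ugen" by (simp add: Uh_img_0 fun_eq_iff)
  show "\<exists>p. free_hom usc (\<lambda>x. mcoeff (Uh_img x) (\<lambda>_. 0)) p = y" for y
    unfolding img by (rule free_hom_ugen_surj)
  fix p assume "free_hom usc (\<lambda>x. mcoeff (Uh_img x) (\<lambda>_. 0)) p = 0"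
  then have "p \<in> U_rel_ideal" unfolding img free_hom_ugen_eq_0 .
  moreover have "U_rel_ideal \<subseteq> constant_terms Uh_rels"
    unfolding U_rel_ideal_eq
    by (rule free.genideal_type_minimal) (auto intro: constant_terms subsetD[OF sl2_rels_subset_Uh])
  ultimately show "\<exists>r\<in>free.ideal_span Uh_rels. mcoeff r (\<lambda>_. 0) = p"
    unfolding constant_terms_def by auto
qed (rule Uh_kills)

section \<open>The presentation of the two-parameter algebra\<close>

primrec Uhh_img :: "nat \<Rightarrow> sl2_gen_C \<Rightarrow> (two_params, usl2) mser" where
  "Uhh_img g Xp_C = XP_series (\<lambda>m. \<Gamma> g 1 (m param_h) (m param_h'))"
| "Uhh_img g Xm_C = cser XM"
| "Uhh_img g H_C = cser HH"
| "Uhh_img g C_C = cser casimir"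

interpretation Uhh: series_hom usc "Uhh_img g" for g ..

lemma even_to_free_eq: "even_to_free r = (\<Sum>k\<le>Polynomial.degree r.
    eval_free (Polynomial.coeff (even_part r) k) (gen H_C) * gen C_C ^ k)"
  by (simp add: even_to_free_def coeff_even_part)

lemma degree_even_part: "Polynomial.degree (even_part r) \<le> Polynomial.degree r"
  by (rule degree_le) (auto simp: coeff_even_part intro: coeff_eq_0)

lemma Uhh_H_even_to_free: "Uhh.H g (even_to_free r) = cser (eval_U r)"
proof -
  have s: "cser (sum f A) = (\<Sum>a\<in>A. cser (f a))" for f :: "nat \<Rightarrow> usl2" and A
    by (induction A rule: infinite_finite_induct) (simp_all add: cser_simps)
  have p: "cser (x ^ n) = cser x ^ n" for x :: usl2 and n
    by (induction n) (simp_all add: cser_simps)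
  show ?thesis
    unfolding even_to_free_eq eval_U_def eval_HC.eval_poly_superset[OF degree_even_part]
    by (simp add: cU.free_hom_sum cU.free_hom_mult cU.free_hom_power cU.free_hom_eval_free eval_poly_cser s p cser_simps)
qed

lemma Uhh_F_product: "Uhh.ext g (Mser (F_product g s)) =
    Mser (\<lambda>m. eval_U (casimir_factor s * \<Gamma> g s (m param_h) (m param_h')))"
  by (rule Uhh.ext_diagonal) (simp add: F_product_def F_at_product_nth Uhh_H_even_to_free)

lemma casimir_series_commute: "cser casimir * XP_series c = XP_series c * cser casimir"
proof (rule mser_eqI)
  fix m
  have "casimir * eval_U (c m) = eval_U (c m) * casimir"
    unfolding eval_U_def by (rule eval_HC.eval_poly_commute) (simp_all add: eval_HC.commute)
  then show "mcoeff (cser casimir * XP_series c) m = mcoeff (XP_series c * cser casimir) m"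
    using casimir_commute_XP by (simp add: XP_series_def mult.assoc) (metis mult.assoc)
qed

lemma Uhh_kills: "r \<in> Uhh_rels g \<Longrightarrow> Uhh.ext g (Mser r) = 0"
proof -
  assume "r \<in> Uhh_rels g"
  then consider p where "p \<in> weight_rels H_C Xp_C Xm_C" "r = const_series free_algebra p"
    | x where "x \<in> {Xp_C, Xm_C, H_C}" "r = const_series free_algebra (gen C_C * gen x - gen x * gen C_C)"
    | "r = (\<lambda>m. const_series free_algebra (gen Xp_C * gen Xm_C) m - F_product g 1 m)"
    | "r = (\<lambda>m. const_series free_algebra (gen Xm_C * gen Xp_C) m - F_product g (- 1) m)"
    by (auto simp: Uhh_rels_def)
  then show ?thesis
  proof cases
    case 1
    then show ?thesis
      unfolding 1(2) Mser_const_series Uhh.ext_cser weight_rels_def using XP_series_weight XM_weight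
      by (auto simp: cU.free_hom_diff cU.free_hom_mult cU.free_hom_add)
  next
    case 2
    have "Uhh_img g C_C * Uhh_img g x - Uhh_img g x * Uhh_img g C_C = 0"
      using 2(1) casimir_commute_XM casimir_commute_HH
      by (auto simp: casimir_series_commute cser_simps[symmetric])
    then show ?thesis
      unfolding 2(2) Mser_const_series Uhh.ext_cser by (simp add: cU.free_hom_diff cU.free_hom_mult)
  next
    case 3
    have r: "Mser r = cser (gen Xp_C * gen Xm_C) - Mser (F_product g 1)"
      by (rule mser_eqI) (simp add: 3 free_algebra_eq)
    show ?thesis
      unfolding r Uhh.ext_diff Uhh.ext_cser Uhh_F_product
      by (rule mser_eqI) (simp add: cU.free_hom_mult mcoeff_XP_series_XM del: mcoeff_cser_mult mcoeff_mult_cser)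
  next
    case 4
    have r: "Mser r = cser (gen Xm_C * gen Xp_C) - Mser (F_product g (- 1))"
      by (rule mser_eqI) (simp add: 4 free_algebra_eq)
    show ?thesis
      unfolding r Uhh.ext_diff Uhh.ext_cser Uhh_F_product
      by (rule mser_eqI) (simp add: cU.free_hom_mult mcoeff_XM_XP_series map_shift2_\<Gamma> del: mcoeff_cser_mult mcoeff_mult_cser)
  qed
qed

text \<open>The two-parameter algebra has the additional generator C. The kernel modulo the
  parameters is reduced to the relation ideal of the enveloping algebra by eliminating C in favour
  of these three generators.\<close>

primrec gen_C :: "sl2_gen \<Rightarrow> sl2_gen_C" where
  "gen_C Xp = Xp_C"
| "gen_C Xm = Xm_C"
| "gen_C Hgen = H_C"

abbreviation free_C :: "sl2_gen free \<Rightarrow> sl2_gen_C free" where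
  "free_C \<equiv> free_hom scalar (\<lambda>x. gen (gen_C x))"

lemma Uhh_img_0: "mcoeff (Uhh_img g (gen_C x)) (\<lambda>_. 0) = ugen x"
  by (cases x) (simp_all add: XP_series_def \<Gamma>_h \<gamma>_0 eval_U_1 mcoeff_mono)

lemma free_hom_free_C: "free_hom usc (\<lambda>x. mcoeff (Uhh_img g x) (\<lambda>_. 0)) (free_C p) = free_hom usc ugen p"
  using free_hom_comp[of "free_hom usc (\<lambda>x. mcoeff (Uhh_img g x) (\<lambda>_. 0))" scalar usc "\<lambda>x. gen (gen_C x)" p]
  by (simp add: U.free_hom_add U.free_hom_mult U.free_hom_one Uhh_img_0)

definition square_term :: "complex \<Rightarrow> complex poly" where
  "square_term s = - ([:- s / 2, 1 / 2:] * [:- s / 2, 1 / 2:])"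

lemma even_to_free_casimir_factor:
  "even_to_free (casimir_factor s) = eval_free (square_term s) (gen H_C) + scalar (1 / 4) * gen C_C"
proof -
  have z: "eval_free 0 a = (0 :: 'y free)" "eval_free [:c:] a = scalar c" for a :: "'y free" and c
    by (simp_all add: eval_free_def scalar_def)
  show ?thesis
    unfolding even_to_free_def casimir_factor_eq square_term_def[symmetric]
    by (simp add: z numeral_2_eq_2 coeff_pCons)
qed

lemma Uhh_constant_terms:
  "x \<in> {Xp_C, Xm_C, H_C} \<Longrightarrow> gen C_C * gen x - gen x * gen C_C \<in> constant_terms (Uhh_rels g)"
  "p \<in> weight_rels H_C Xp_C Xm_C \<Longrightarrow> p \<in> constant_terms (Uhh_rels g)"
  "gen Xp_C * gen Xm_C - (eval_free (square_term 1) (gen H_C) + scalar (1 / 4) * gen C_C) \<in> constant_terms (Uhh_rels g)"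
  "gen Xm_C * gen Xp_C - (eval_free (square_term (- 1)) (gen H_C) + scalar (1 / 4) * gen C_C) \<in> constant_terms (Uhh_rels g)"
proof -
  have F0: "F_product g s (\<lambda>_. 0) = eval_free (square_term s) (gen H_C) + scalar (1 / 4) * gen C_C" for s
    by (simp only: F_product_def F_at_product_nth \<Gamma>_h \<gamma>_0 mult_1_right even_to_free_casimir_factor)
  show "x \<in> {Xp_C, Xm_C, H_C} \<Longrightarrow> gen C_C * gen x - gen x * gen C_C \<in> constant_terms (Uhh_rels g)"
    using constant_terms(5)[of "const_series free_algebra (gen C_C * gen x - gen x * gen C_C)" "Uhh_rels g"]
    by (auto simp: Uhh_rels_def const_series_free_zero)
  show "p \<in> weight_rels H_C Xp_C Xm_C \<Longrightarrow> p \<in> constant_terms (Uhh_rels g)"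
    using constant_terms(5)[of "const_series free_algebra p" "Uhh_rels g"]
    by (auto simp: Uhh_rels_def const_series_free_zero)
  show "gen Xp_C * gen Xm_C - (eval_free (square_term 1) (gen H_C) + scalar (1 / 4) * gen C_C) \<in> constant_terms (Uhh_rels g)"
    using constant_terms(5)[of "\<lambda>m. const_series free_algebra (gen Xp_C * gen Xm_C) m - F_product g 1 m" "Uhh_rels g"]
    unfolding F0 const_series_free_zero by (simp add: Uhh_rels_def)
  show "gen Xm_C * gen Xp_C - (eval_free (square_term (- 1)) (gen H_C) + scalar (1 / 4) * gen C_C) \<in> constant_terms (Uhh_rels g)"
    using constant_terms(5)[of "\<lambda>m. const_series free_algebra (gen Xm_C * gen Xp_C) m - F_product g (- 1) m" "Uhh_rels g"]
    unfolding F0 const_series_free_zero by (simp add: Uhh_rels_def)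
qed

interpretation eval_free: poly_evaluation scalar "p :: 'x free" for p
  by standard (simp_all only: free.sc_add free.sc_mult free.sc_one free.sc_central[of _ p])

lemma eval_free_eq: "eval_free q p = eval_poly scalar p q"
  by (simp add: eval_free_def eval_poly_def)

text \<open>Subtracting the two product relations at the origin cancels C / 4, and ((H + 1)^2 - (H -
  1)^2) / 4 = H leaves the commutator relation of the enveloping algebra.\<close>

lemma free_C_U_rel_ideal: "p \<in> U_rel_ideal \<Longrightarrow> free_C p \<in> constant_terms (Uhh_rels g)"
proof -
  let ?I = "constant_terms (Uhh_rels g)"
  have "square_term (- 1) - square_term 1 = - var" by (simp add: square_term_def)
  then have H: "eval_free (square_term (- 1)) (gen H_C) - eval_free (square_term 1) (gen H_C) = - gen H_C"
    using eval_free.eval_poly_diff[of "gen H_C" "square_term (- 1)" "square_term 1"]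
      eval_free.eval_poly_diff[of "gen H_C" 0 var] eval_free_var[of "gen H_C"]
    by (simp add: eval_free_eq eval_free.eval_poly_0)
  have "(gen Xp_C * gen Xm_C - (eval_free (square_term 1) (gen H_C) + scalar (1 / 4) * gen C_C)) -
     (gen Xm_C * gen Xp_C - (eval_free (square_term (- 1)) (gen H_C) + scalar (1 / 4) * gen C_C)) \<in> ?I"
    by (rule constant_terms_diff[OF Uhh_constant_terms(3,4)])
  also have "(gen Xp_C * gen Xm_C - (eval_free (square_term 1) (gen H_C) + scalar (1 / 4) * gen C_C)) -
     (gen Xm_C * gen Xp_C - (eval_free (square_term (- 1)) (gen H_C) + scalar (1 / 4) * gen C_C)) =
     gen Xp_C * gen Xm_C - gen Xm_C * gen Xp_C +
     (eval_free (square_term (- 1)) (gen H_C) - eval_free (square_term 1) (gen H_C))"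
    by (simp add: algebra_simps)
  finally have c: "gen Xp_C * gen Xm_C - gen Xm_C * gen Xp_C - gen H_C \<in> ?I"
    unfolding H by simp
  have "U_rel_ideal \<subseteq> {p. free_C p \<in> ?I}"
    unfolding U_rel_ideal_eq
  proof (rule free.genideal_type_minimal)
    show "sl2_rels Hgen Xp Xm \<subseteq> {p. free_C p \<in> ?I}"
      using c Uhh_constant_terms(2)[of _ g]
      by (auto simp: sl2_rels_def weight_rels_def free.free_hom_diff free.free_hom_mult free.free_hom_add)
  qed (auto simp: free.free_hom_zero free.free_hom_add free.free_hom_mult intro: constant_terms)
  then show "p \<in> U_rel_ideal \<Longrightarrow> free_C p \<in> ?I" by blast
qed

text \<open>At the origin the relation for X- X+ can be solved for C. The replacement passes from
  generators to words and sums because the constant terms form an ideal.\<close>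

lemma free_C_surj_mod: "\<exists>y. p - free_C y \<in> constant_terms (Uhh_rels g)"
proof (induction p rule: poly_mapping_single_induct)
  case zero
  show ?case using constant_terms(1) by (intro exI[of _ 0]) (simp add: free.free_hom_zero)
next
  case (single w c)
  have mult: "\<exists>y. p * q - free_C y \<in> constant_terms (Uhh_rels g)"
    if "p - free_C x \<in> constant_terms (Uhh_rels g)" "q - free_C z \<in> constant_terms (Uhh_rels g)" for p q x z
  proof -
    have "(p - free_C x) * q + free_C x * (q - free_C z) \<in> constant_terms (Uhh_rels g)"
      using that by (intro constant_terms(2-4))
    then show ?thesis
      by (intro exI[of _ "x * z"]) (simp add: free.free_hom_mult algebra_simps)
  qed
  have gen: "\<exists>y. gen i - free_C y \<in> constant_terms (Uhh_rels g)" for i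
  proof (cases i)
    case C_C
    \<comment> \<open>This is 4 X- X+ + (H + 1)^2, since \<open>square_term (- 1)\<close> stands for
      -(H + 1)^2 / 4.\<close>
    let ?y = "scalar 4 * (gen Xm * gen Xp - eval_free (square_term (- 1)) (gen Hgen))"
    have y: "free_C ?y = scalar 4 * (gen Xm_C * gen Xp_C - eval_free (square_term (- 1)) (gen H_C))"
      by (simp add: free.free_hom_mult free.free_hom_diff free.free_hom_eval_free)
        (simp add: eval_free_eq)
    have "scalar 4 * scalar (1 / 4) = (1 :: sl2_gen_C free)"
      by (simp add: free.sc_one flip: free.sc_mult)
    then have q: "scalar 4 * (scalar (1 / 4) * x) = x" for x :: "sl2_gen_C free"
      by (simp flip: mult.assoc)
    have "(- scalar 4) * (gen Xm_C * gen Xp_C - (eval_free (square_term (- 1)) (gen H_C) + scalar (1 / 4) * gen C_C))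
        \<in> constant_terms (Uhh_rels g)"
      by (rule constant_terms(4)[OF Uhh_constant_terms(4)])
    then have "gen i - free_C ?y \<in> constant_terms (Uhh_rels g)"
      unfolding y C_C by (simp add: right_diff_distrib distrib_left q algebra_simps)
    then show ?thesis ..
  next
    case Xp_C then show ?thesis using constant_terms(1) by (intro exI[of _ "gen Xp"]) simp
  next
    case Xm_C then show ?thesis using constant_terms(1) by (intro exI[of _ "gen Xm"]) simp
  next
    case H_C then show ?thesis using constant_terms(1) by (intro exI[of _ "gen Hgen"]) simp
  qed
  have "\<exists>y. Poly_Mapping.single w 1 - free_C y \<in> constant_terms (Uhh_rels g)"
  proof (induction w)
    case Nil
    show ?case using constant_terms(1) by (intro exI[of _ 1]) (simp add: free.free_hom_one single_Nil_one)
  next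
    case (Cons i w)
    have "Poly_Mapping.single (i # w) 1 = gen i * Poly_Mapping.single w 1"
      by (simp add: gen_def mult_single plus_list_def)
    then show ?case using mult gen Cons by metis
  qed
  moreover have "scalar c - free_C (scalar c) \<in> constant_terms (Uhh_rels g)"
    using constant_terms(1) by simp
  moreover have "Poly_Mapping.single w c = scalar c * Poly_Mapping.single w 1"
    by (simp add: scalar_def mult_single plus_list_def)
  ultimately show ?case using mult by metis
next
  case (add p q)
  then obtain x y where "p - free_C x \<in> constant_terms (Uhh_rels g)" "q - free_C y \<in> constant_terms (Uhh_rels g)"
    by blast
  from constant_terms(2)[OF this] show ?case
    by (intro exI[of _ "x + y"]) (simp add: free.free_hom_add algebra_simps)
qed

interpretation Uhh: presentation usc "Uhh_img g" "Uhh_rels g" for g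
proof
  let ?h = "free_hom usc (\<lambda>x. mcoeff (Uhh_img g x) (\<lambda>_. 0))"
  show "\<exists>p. ?h p = y" for y
    using free_hom_ugen_surj[of y] free_hom_free_C by metis
  fix p assume p: "?h p = 0"
  obtain y where y: "p - free_C y \<in> constant_terms (Uhh_rels g)" using free_C_surj_mod by blast
  then obtain r where r: "r \<in> free.ideal_span (Uhh_rels g)" "p - free_C y = mcoeff r (\<lambda>_. 0)"
    by (auto simp: constant_terms_def)
  \<comment> \<open>Constant terms of the ideal of relations are killed at the origin. So
    \<open>free_C y\<close> is killed together with \<open>p\<close>, which makes \<open>y\<close> a
    relation of the enveloping algebra and \<open>free_C y\<close> liftable.\<close>
  have "?h (p - free_C y) = mcoeff (Uhh.ext g r) (\<lambda>_. 0)"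
    using Uhh.ext_lowest[of r 0 "\<lambda>_. 0" g] by (simp add: r(2))
  then have "?h (free_C y) = 0"
    using Uhh.ext_ideal_span_zero[OF Uhh_kills r(1)] p by (simp add: U.free_hom_diff)
  then have "free_C y \<in> constant_terms (Uhh_rels g)"
    by (intro free_C_U_rel_ideal) (simp add: free_hom_free_C free_hom_ugen_eq_0)
  from constant_terms(2)[OF y this] show "\<exists>r\<in>free.ideal_span (Uhh_rels g). mcoeff r (\<lambda>_. 0) = p"
    by (auto simp: constant_terms_def)
qed (rule Uhh_kills)

section \<open>Triviality of the deformations\<close>

declare Uh_img.simps(1) [simp del] Uhh_img.simps(1) [simp del]

text \<open>A linear map into series that is the inclusion modulo the parameters. Its extension to
  series is unitriangular for the order on multi-indices.\<close>

locale triangular_map = scalars sc for sc :: "complex \<Rightarrow> 'm::ring_1" +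
  fixes \<Lambda> :: "'m \<Rightarrow> ('s::finite, 'm) mser"
  assumes map_add: "\<Lambda> (x + y) = \<Lambda> x + \<Lambda> y"
    and map_scale: "\<Lambda> (sc c * x) = cser (sc c) * \<Lambda> x"
    and map_constant: "mcoeff (\<Lambda> x) (\<lambda>_. 0) = x"
begin

definition lin_ext :: "('s, 'm) mser \<Rightarrow> ('s, 'm) mser" where
  "lin_ext f = Mser (\<lambda>m. \<Sum>a\<in>{a. a \<le> m}. mcoeff (\<Lambda> (mcoeff f a)) (m - a))"

lemma map_zero: "\<Lambda> 0 = 0"
  using map_add[of 0 0] by simp

lemma map_sum: "\<Lambda> (sum f A) = (\<Sum>a\<in>A. \<Lambda> (f a))"
  by (induction A rule: infinite_finite_induct) (simp_all add: map_zero map_add)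

lemma lin_ext_add: "lin_ext (f + g) = lin_ext f + lin_ext g"
  by (rule mser_eqI) (simp add: lin_ext_def map_add sum.distrib)

lemma lin_ext_diff: "lin_ext (f - g) = lin_ext f - lin_ext g"
  using lin_ext_add[of "f - g" g] by simp

lemma lin_ext_cser: "lin_ext (cser x) = \<Lambda> x"
proof (rule mser_eqI)
  fix m
  have "mcoeff (lin_ext (cser x)) m = (\<Sum>a\<in>{a. a \<le> m}. if (\<lambda>_. 0) = a then mcoeff (\<Lambda> x) m else 0)"
    unfolding lin_ext_def mcoeff_mono mcoeff_Mser by (intro sum.cong) (auto simp: map_zero)
  then show "mcoeff (lin_ext (cser x)) m = mcoeff (\<Lambda> x) m" by simp
qed

lemma lin_ext_scalar: "lin_ext (Mser (\<lambda>m. sc (k m)) * f) = Mser (\<lambda>m. sc (k m)) * lin_ext f"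
proof (rule mser_eqI)
  fix m
  have "mcoeff (lin_ext (Mser (\<lambda>m. sc (k m)) * f)) m =
    (\<Sum>a\<in>{a. a \<le> m}. \<Sum>b\<in>{b. b \<le> a}. sc (k b) * mcoeff (\<Lambda> (mcoeff f (a - b))) (m - a))"
    by (simp add: lin_ext_def mcoeff_mult[of "Mser _"] map_sum map_scale mcoeff_sum)
  also have "\<dots> = (\<Sum>a\<in>{a. a \<le> m}. \<Sum>b\<in>{b. b \<le> m - a}. sc (k a) * mcoeff (\<Lambda> (mcoeff f b)) (m - a - b))"
    by (rule sum_convolution_assoc)
  also have "\<dots> = mcoeff (Mser (\<lambda>m. sc (k m)) * lin_ext f) m"
    by (simp add: lin_ext_def mcoeff_mult sum_distrib_left)
  finally show "mcoeff (lin_ext (Mser (\<lambda>m. sc (k m)) * f)) m = mcoeff (Mser (\<lambda>m. sc (k m)) * lin_ext f) m" .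
qed

lemma mcoeff_lin_ext:
  "mcoeff (lin_ext f) m = mcoeff f m + (\<Sum>a\<in>{a. a < m}. mcoeff (\<Lambda> (mcoeff f a)) (m - a))"
  using map_constant by (simp add: lin_ext_def multiindex_le_split zero_fun_def)

lemma lin_ext_constant: "mcoeff (lin_ext f) (\<lambda>_. 0) = mcoeff f (\<lambda>_. 0)"
  by (simp add: lin_ext_def map_constant zero_fun_def)

text \<open>Coefficient \<open>m\<close> of the image is coefficient \<open>m\<close> of the
  argument plus a function of smaller coefficients. Injectivity is an induction along that order and
  surjectivity a recursion.\<close>

lemma bij_lin_ext: "bij lin_ext"
proof (rule bijI)
  show "inj lin_ext"
  proof (rule injI)
    fix f g assume "lin_ext f = lin_ext g"
    then have 0: "lin_ext (f - g) = 0" by (simp add: lin_ext_diff)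
    have "mcoeff (f - g) m = 0" for m
      using wf_multiindex_less
    proof (induction m rule: wf_induct_rule)
      case (less m)
      have "\<Lambda> (mcoeff (f - g) a) = 0" if "a < m" for a
        using less[of a] that map_zero by (simp only: mem_Collect_eq prod.case)
      then have "(\<Sum>a\<in>{a. a < m}. mcoeff (\<Lambda> (mcoeff (f - g) a)) (m - a)) = 0"
        by (intro sum.neutral ballI) (simp only: mem_Collect_eq mcoeff_simps(1))
      then show ?case using mcoeff_lin_ext[of "f - g" m] 0 by simp
    qed
    then show "f = g" by (intro mser_eqI) simp
  qed
  show "surj lin_ext"
    unfolding surj_def
  proof
    fix y
    define P where "P = (\<lambda>f m r. r = mcoeff y m - (\<Sum>a\<in>{a. a < m}. mcoeff (\<Lambda> (f a)) (m - a)))"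
    have adm: "P f m r = P g m r" if "\<And>a. a < m \<Longrightarrow> f a = g a" for f g m r
      unfolding P_def using that by (intro arg_cong[where f = "\<lambda>s. r = mcoeff y m - s"] sum.cong) auto
    have ex: "\<exists>r. P f m r" for f m unfolding P_def by (rule exI) (rule refl)
    have "\<exists>f. \<forall>m. P f m (f m)"
    proof (rule triangular_solution[of P])
      fix f assume "\<And>m. P f m (f m)"
      then show "\<exists>f. \<forall>m. P f m (f m)" by (intro exI allI)
    qed (rule adm, assumption, rule ex)
    then obtain f where f: "\<forall>m. P f m (f m)" ..
    have "lin_ext (Mser f) = y"
    proof (rule mser_eqI)
      fix m show "mcoeff (lin_ext (Mser f)) m = mcoeff y m"
        using spec[OF f, of m] by (simp only: P_def mcoeff_lin_ext mcoeff_Mser eq_diff_eq)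
    qed
    then show "\<exists>x. y = lin_ext x" by blast
  qed
qed

definition series_map :: "(('s \<Rightarrow> nat) \<Rightarrow> 'm) \<Rightarrow> ('s \<Rightarrow> nat) \<Rightarrow> 'm" where
  "series_map f = mcoeff (lin_ext (Mser f))"

lemma series_map_module_iso:
  "series_map \<in> module_iso (series_ring complex_ring) (series_algebra (type_algebra sc)) (series_algebra (type_algebra sc))"
proof (rule module_isoI)
  show "bij_betw series_map (carrier (series_algebra (type_algebra sc))) (carrier (series_algebra (type_algebra sc)))"
    unfolding series_type_simps
  proof (rule bij_betw_byWitness)
    have "inv_into UNIV lin_ext (lin_ext x) = x" "lin_ext (inv_into UNIV lin_ext x) = x" for x
      using bij_lin_ext by (simp_all add: bij_is_inj bij_is_surj surj_f_inv_f)
    then show "\<forall>f\<in>UNIV. mcoeff (inv_into UNIV lin_ext (Mser (series_map f))) = f"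
      "\<forall>f\<in>UNIV. series_map (mcoeff (inv_into UNIV lin_ext (Mser f))) = f"
      by (simp_all add: series_map_def)
  qed auto
qed (unfold series_type_simps series_map_def, simp_all only: Mser_mcoeff lin_ext_add lin_ext_scalar)

end

section \<open>The linear map that matches the PBW bases\<close>

definition pbw_series :: "('s::finite, usl2) mser \<Rightarrow> nat \<times> nat \<times> nat \<Rightarrow> ('s, usl2) mser" where
  "pbw_series x = (\<lambda>(a, b, c). cser XM ^ a * cser HH ^ b * x ^ c)"

lemma pbw_map_ex:
  fixes x :: "('s::finite, usl2) mser"
  shows "\<exists>f. (\<forall>y z. f (y + z) = f y + f z) \<and> (\<forall>c y. f (usc c * y) = cser (usc c) * f y) \<and>
     (\<forall>i. f (pbw_monomial i) = pbw_series x i)"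
proof -
  interpret svs: vector_space "\<lambda>c y. cser (usc c) * y :: ('s, usl2) mser"
    by standard (simp_all only: U.sc_add U.sc_mult U.sc_one cser_simps distrib_left distrib_right mult.assoc mult_1_left)
  interpret vsp: vector_space_pair "\<lambda>c y. usc c * y" "\<lambda>c y. cser (usc c) * y :: ('s, usl2) mser" ..
  obtain f where f: "Vector_Spaces.linear (\<lambda>c y. usc c * y) (\<lambda>c y. cser (usc c) * y) f"
    "\<forall>y\<in>range pbw_monomial. f y = pbw_series x (inv_into UNIV pbw_monomial y)"
    using vsp.linear_independent_extend[OF independent_pbw, of "\<lambda>y. pbw_series x (inv_into UNIV pbw_monomial y)"]
    by (elim exE conjE)
  have "f (pbw_monomial i) = pbw_series x i" for i
    using bspec[OF f(2) rangeI, of i] by (simp only: inv_into_f_f[OF inj_pbw UNIV_I])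
  then show ?thesis
    by (intro exI[of _ f] conjI allI vsp.linear_add[OF f(1)] vsp.linear_scale[OF f(1)])
qed

text \<open>The linear map \<open>(X\<^sup>-)\<^sup>a H\<^sup>b (X\<^sup>+)\<^sup>c \<mapsto> (X\<^sup>-)\<^sup>a H\<^sup>b x\<^sup>c\<close>; it identifies the PBW bases.\<close>

definition pbw_map :: "('s::finite, usl2) mser \<Rightarrow> usl2 \<Rightarrow> ('s, usl2) mser" where
  "pbw_map x = (SOME f. (\<forall>y z. f (y + z) = f y + f z) \<and> (\<forall>c y. f (usc c * y) = cser (usc c) * f y) \<and>
     (\<forall>i. f (pbw_monomial i) = pbw_series x i))"

lemma pbw_map:
  "pbw_map x (y + z) = pbw_map x y + pbw_map x z"
  "pbw_map x (usc c * y) = cser (usc c) * pbw_map x y"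
  "pbw_map x (pbw_monomial i) = pbw_series x i"
proof -
  have *: "(\<forall>y z. pbw_map x (y + z) = pbw_map x y + pbw_map x z) \<and>
     (\<forall>c y. pbw_map x (usc c * y) = cser (usc c) * pbw_map x y) \<and>
     (\<forall>i. pbw_map x (pbw_monomial i) = pbw_series x i)"
    unfolding pbw_map_def by (rule someI_ex[OF pbw_map_ex])
  show "pbw_map x (y + z) = pbw_map x y + pbw_map x z"
    by (rule *[THEN conjunct1, rule_format])
  show "pbw_map x (usc c * y) = cser (usc c) * pbw_map x y"
    by (rule *[THEN conjunct2, THEN conjunct1, rule_format])
  show "pbw_map x (pbw_monomial i) = pbw_series x i"
    by (rule *[THEN conjunct2, THEN conjunct2, rule_format])
qed

lemma pbw_induct [case_names monomial add scale]:
  assumes "\<And>i. P (pbw_monomial i)" "\<And>x y. P x \<Longrightarrow> P y \<Longrightarrow> P (x + y)" "\<And>c x. P x \<Longrightarrow> P (usc c * x)"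
  shows "P x"
proof -
  have "x \<in> uvs.span (range pbw_monomial)" by (simp add: span_pbw)
  then show ?thesis
  proof (induction rule: uvs.span_induct_alt)
    case base
    show ?case using assms(3)[OF assms(1), of 0] by (simp only: U.sc_zero mult_zero_left)
  next
    case (step c y z)
    then show ?case by (auto intro: assms)
  qed
qed

lemma pbw_map_constant:
  assumes "mcoeff x (\<lambda>_. 0) = XP"
  shows "mcoeff (pbw_map x y) (\<lambda>_. 0) = y"
proof (induction y rule: pbw_induct)
  case (monomial i)
  have p: "mcoeff (z ^ n) (\<lambda>_. 0) = mcoeff z (\<lambda>_. 0) ^ n" for z :: "('a, usl2) mser" and n
    by (induction n) (simp_all add: mcoeff_one mcoeff_mult_zero)
  show ?case
    unfolding pbw_map(3)
    by (cases i) (simp add: pbw_series_def pbw_monomial_def mcoeff_mult_zero p mcoeff_mono assms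
      del: mcoeff_cser_mult mcoeff_mult_cser)
qed (simp_all add: pbw_map)

lemma triangular_pbw_map:
  "mcoeff x (\<lambda>_. 0) = XP \<Longrightarrow> triangular_map usc (pbw_map x)"
  by standard (simp_all add: pbw_map pbw_map_constant)

interpretation Uh: triangular_map usc "pbw_map (Uh_img Xp)"
  by (rule triangular_pbw_map[OF Uh_img_0])

interpretation Uhh: triangular_map usc "pbw_map (Uhh_img g Xp_C)" for g
  using Uhh_img_0[of g Xp] by (intro triangular_pbw_map) (simp only: gen_C.simps)

lemma pbw_hom:
  assumes f: "f \<in> algebra_iso K M N" and "monoid M" "monoid N" "x \<in> carrier M" "h \<in> carrier M" "y \<in> carrier M"
  shows "f (pbw M x h y i) = pbw N (f x) (f h) (f y) i" "pbw M x h y i \<in> carrier M"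
proof -
  interpret M: monoid M by fact
  interpret N: monoid N by fact
  note hom = algebra_isoD(2,5,6)[OF f]
  have pow: "f (z [^]\<^bsub>M\<^esub> n) = f z [^]\<^bsub>N\<^esub> n" if "z \<in> carrier M" for z and n :: nat
    using that by (induction n) (simp_all add: hom)
  show "f (pbw M x h y i) = pbw N (f x) (f h) (f y) i" "pbw M x h y i \<in> carrier M"
    using assms(4-6) by (cases i, simp add: pbw_def hom pow)+
qed

lemma pbw_zero: "monoid M \<Longrightarrow> pbw M x h y (0, 0, 0) = \<one>\<^bsub>M\<^esub>"
  by (simp add: pbw_def monoid.nat_pow_0 monoid.l_one monoid.one_closed)

lemma assoc_algebra_monoid: "assoc_algebra K M \<Longrightarrow> monoid M"
  by (simp add: assoc_algebra_def ring_def)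

lemma pbw_type: "pbw (type_algebra usc) XM HH XP = pbw_monomial"
proof -
  interpret monoid "type_algebra usc" using assoc_algebra_monoid[OF U.assoc_algebra_type] .
  have "x [^]\<^bsub>type_algebra usc\<^esub> n = x ^ n" for x and n :: nat
    by (induction n) (simp_all add: power_Suc2 del: power_Suc)
  then show ?thesis by (auto simp: pbw_def pbw_monomial_def fun_eq_iff)
qed

lemma pbw_series_type:
  "pbw (series_algebra (type_algebra usc)) (mcoeff (cser XM)) (mcoeff (cser HH)) (mcoeff x) i =
     mcoeff (pbw_series (x :: ('s::finite, usl2) mser) i)"
proof -
  let ?S = "series_algebra (type_algebra usc) :: (('s \<Rightarrow> nat) \<Rightarrow> complex, ('s \<Rightarrow> nat) \<Rightarrow> usl2) module"
  interpret monoid ?S using assoc_algebra_monoid[OF U.assoc_algebra_series_type] .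
  have "mcoeff y [^]\<^bsub>?S\<^esub> n = mcoeff (y ^ n)" for y and n :: nat
    by (induction n) (simp_all only: nat_pow_0 nat_pow_Suc U.series_type_simps Mser_mcoeff power_Suc2 power_0)
  then show ?thesis
    by (cases i) (simp only: pbw_def prod.case U.series_type_simps Mser_mcoeff pbw_series_def)
qed

lemma U_basis: "U_basis i \<in> carrier U_sl2" "U_iso (U_basis i) = pbw_monomial i" "U_basis (0, 0, 0) = \<one>\<^bsub>U_sl2\<^esub>"
proof -
  note m = assoc_algebra_monoid[OF assoc_algebra_U_sl2] assoc_algebra_monoid[OF U.assoc_algebra_type]
  show "U_basis i \<in> carrier U_sl2" "U_iso (U_basis i) = pbw_monomial i"
    using pbw_hom[OF U_iso m U_gen_closed U_gen_closed U_gen_closed] by (simp_all add: U_basis_def U_iso_gen pbw_type)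
  show "U_basis (0, 0, 0) = \<one>\<^bsub>U_sl2\<^esub>" using m by (simp add: U_basis_def pbw_zero)
qed

lemma Uh_basis: "Uh_basis i \<in> carrier Uh_sl2" "Uh.iso (Uh_basis i) = mcoeff (pbw_series (Uh_img Xp) i)"
   "Uh_basis (0, 0, 0) = \<one>\<^bsub>Uh_sl2\<^esub>"
proof -
  note m = assoc_algebra_monoid[OF Uh.assoc_algebra_top_generated] assoc_algebra_monoid[OF U.assoc_algebra_series_type]
  show "Uh_basis i \<in> carrier Uh_sl2" "Uh.iso (Uh_basis i) = mcoeff (pbw_series (Uh_img Xp) i)"
    using pbw_hom[OF Uh.iso m Uh.top_gen_closed Uh.top_gen_closed Uh.top_gen_closed]
    by (simp_all add: Uh_basis_def Uh_sl2_def Uh.iso_top_gen pbw_series_type)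
  show "Uh_basis (0, 0, 0) = \<one>\<^bsub>Uh_sl2\<^esub>" using m by (simp add: Uh_basis_def pbw_zero Uh_sl2_def)
qed

lemma Uhh_basis: "Uhh_basis g i \<in> carrier (Uhh_sl2 g)"
  "Uhh.iso g (Uhh_basis g i) = mcoeff (pbw_series (Uhh_img g Xp_C) i)"
  "Uhh_basis g (0, 0, 0) = \<one>\<^bsub>Uhh_sl2 g\<^esub>"
proof -
  note m = assoc_algebra_monoid[OF Uhh.assoc_algebra_top_generated] assoc_algebra_monoid[OF U.assoc_algebra_series_type]
  show "Uhh_basis g i \<in> carrier (Uhh_sl2 g)" "Uhh.iso g (Uhh_basis g i) = mcoeff (pbw_series (Uhh_img g Xp_C) i)"
    using pbw_hom[OF Uhh.iso m Uhh.top_gen_closed Uhh.top_gen_closed Uhh.top_gen_closed]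
    by (simp_all add: Uhh_basis_def Uhh_sl2_def Uhh.iso_top_gen pbw_series_type)
  show "Uhh_basis g (0, 0, 0) = \<one>\<^bsub>Uhh_sl2 g\<^esub>" using m by (simp add: Uhh_basis_def pbw_zero Uhh_sl2_def)
qed

lemma trivial_deformation_U: "trivial_deformation_via_bases complex_ring U_sl2 U_basis (Uhh_sl2 g) (Uhh_basis g)"
proof -
  interpret B: assoc_algebra "series_ring complex_ring" "Uhh_sl2 g"
    unfolding Uhh_sl2_def by (rule Uhh.assoc_algebra_top_generated)
  show ?thesis
  proof (rule trivial_deformation_via_basesI)
    show "Uhh.iso g \<in> algebra_iso (series_ring complex_ring) (Uhh_sl2 g) (series_algebra (type_algebra usc))"
      unfolding Uhh_sl2_def by (rule Uhh.iso)
    show "Uhh.series_map g \<in> module_iso (series_ring complex_ring) (series_algebra (type_algebra usc)) (series_algebra (type_algebra usc))"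
      by (rule Uhh.series_map_module_iso)
    show "Uhh.series_map g f (\<lambda>_. 0) = f (\<lambda>_. 0)" for f
      by (simp add: Uhh.series_map_def Uhh.lin_ext_constant)
    show "Uhh.series_map g (const_series (type_algebra usc) (U_iso (U_basis i))) = Uhh.iso g (Uhh_basis g i)" for i
      by (simp add: Uhh.series_map_def Uhh.lin_ext_cser U_basis Uhh_basis pbw_map)
    show "k \<odot>\<^bsub>Uhh_sl2 g\<^esub> x \<in> carrier (Uhh_sl2 g)"
      if "k \<in> carrier (series_ring complex_ring)" "x \<in> carrier (Uhh_sl2 g)" for k x
      using that by (rule B.smult_closed)
    show "U_basis i \<in> carrier U_sl2" "U_basis (0, 0, 0) = \<one>\<^bsub>U_sl2\<^esub>" for i by (rule U_basis)+
    show "Uhh_basis g i \<in> carrier (Uhh_sl2 g)" "Uhh_basis g (0, 0, 0) = \<one>\<^bsub>Uhh_sl2 g\<^esub>" for i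
      by (rule Uhh_basis)+
  qed (rule assoc_algebra_U_sl2 U.assoc_algebra_type U_iso B.ring_axioms)+
qed

section \<open>Series in two parameters as iterated series, and the two statements on the
  one-parameter algebra\<close>

definition pair_index :: "two_params \<Rightarrow> (unit \<Rightarrow> nat) \<Rightarrow> (unit \<Rightarrow> nat) \<Rightarrow> two_params \<Rightarrow> nat" where
  "pair_index p a b = (\<lambda>x. if x = p then a () else b ())"

lemma two_params_cases: "p \<noteq> q \<Longrightarrow> (x :: two_params) = p \<or> x = q"
  by (cases p; cases q; cases x) auto

lemma pair_index_apply: "p \<noteq> q \<Longrightarrow> pair_index p a b p = a ()" "p \<noteq> q \<Longrightarrow> pair_index p a b q = b ()"
  by (auto simp: pair_index_def)

lemma pair_index_diff: "pair_index p a b - pair_index p a' b' = pair_index p (a - a') (b - b')"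
  by (auto simp: pair_index_def fun_eq_iff)

lemma pair_index_split: "p \<noteq> q \<Longrightarrow> pair_index p (\<lambda>_. m p) (\<lambda>_. m q) = m"
  using two_params_cases[of p q] by (auto simp: pair_index_def fun_eq_iff)

lemma pair_index_zero: "p \<noteq> q \<Longrightarrow> pair_index p a b = (\<lambda>_. 0) \<longleftrightarrow> a = (\<lambda>_. 0) \<and> b = (\<lambda>_. 0)"
  by (auto simp: pair_index_def fun_eq_iff)

text \<open>The multi-indices below a pair form a rectangle; this turns the product of two-parameter
  series into an iterated convolution.\<close>

lemma sum_pair_index:
  fixes t :: "(two_params \<Rightarrow> nat) \<Rightarrow> 'a::comm_monoid_add"
  assumes "p \<noteq> q"
  shows "(\<Sum>c\<in>{c. c \<le> pair_index p a b}. t c) = (\<Sum>a'\<in>{a'. a' \<le> a}. \<Sum>b'\<in>{b'. b' \<le> b}. t (pair_index p a' b'))"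
proof -
  have "bij_betw (\<lambda>(a', b'). pair_index p a' b') ({a'. a' \<le> a} \<times> {b'. b' \<le> b}) {c. c \<le> pair_index p a b}"
  proof (rule bij_betw_byWitness[of _ "\<lambda>c. (\<lambda>_. c p, \<lambda>_. c q)"])
    show "\<forall>c\<in>{c. c \<le> pair_index p a b}. (case (\<lambda>_. c p, \<lambda>_. c q) of (a', b') \<Rightarrow> pair_index p a' b') = c"
      using assms by (simp add: pair_index_split)
    show "\<forall>x\<in>{a'. a' \<le> a} \<times> {b'. b' \<le> b}. (\<lambda>_. (case x of (a', b') \<Rightarrow> pair_index p a' b') p,
        \<lambda>_. (case x of (a', b') \<Rightarrow> pair_index p a' b') q) = x"
      using assms by (auto simp: pair_index_apply)
    show "(\<lambda>(a', b'). pair_index p a' b') ` ({a'. a' \<le> a} \<times> {b'. b' \<le> b}) \<subseteq> {c. c \<le> pair_index p a b}"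
      by (auto simp: pair_index_def le_fun_def)
    show "(\<lambda>c. (\<lambda>_. c p, \<lambda>_. c q)) ` {c. c \<le> pair_index p a b} \<subseteq> {a'. a' \<le> a} \<times> {b'. b' \<le> b}"
    proof clarsimp
      fix c assume c: "c \<le> pair_index p a b"
      show "(\<lambda>_. c p) \<le> a \<and> (\<lambda>_. c q) \<le> b"
        using le_funD[OF c, of p] le_funD[OF c, of q] assms by (auto simp: le_fun_def pair_index_apply)
    qed
  qed
  from sum.reindex_bij_betw[OF this, of t] show ?thesis
    by (simp add: sum.cartesian_product case_prod_beta)
qed

definition split_series :: "two_params \<Rightarrow> ((two_params \<Rightarrow> nat) \<Rightarrow> 'a) \<Rightarrow> (unit \<Rightarrow> nat) \<Rightarrow> (unit \<Rightarrow> nat) \<Rightarrow> 'a" where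
  "split_series p f = (\<lambda>a b. f (pair_index p a b))"

context scalars begin

lemma finsum_series_type:
  "finsum (series_algebra (type_algebra sc)) f A b = (\<Sum>a\<in>A. f a (b :: 's::finite \<Rightarrow> nat))"
proof -
  let ?S = "series_algebra (type_algebra sc) :: (('s \<Rightarrow> nat) \<Rightarrow> complex, ('s \<Rightarrow> nat) \<Rightarrow> 'a) module"
  interpret S: assoc_algebra "series_ring complex_ring" ?S by (rule assoc_algebra_series_type)
  interpret T: assoc_algebra complex_ring "type_algebra sc" by (rule assoc_algebra_type)
  have "(\<lambda>x. x b) (finsum ?S f A) = finsum (type_algebra sc) (\<lambda>a. f a b) A"
    by (rule hom_finsum[OF S.abelian_monoid_axioms T.abelian_monoid_axioms]) (auto simp: series_type_simps)
  then show ?thesis by (simp add: finsum_eq_sum[OF T.abelian_monoid_axioms] fun_eq_iff)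
qed

lemma split_series_iso:
  assumes "p \<noteq> q"
  shows "split_series p \<in> algebra_iso (series_ring (series_ring complex_ring))
    (restrict_scalars (join_series p q) (series_algebra (type_algebra sc)))
    (series_algebra (series_algebra (type_algebra sc)))"
proof -
  let ?S = "series_algebra (type_algebra sc) :: ((unit \<Rightarrow> nat) \<Rightarrow> complex, (unit \<Rightarrow> nat) \<Rightarrow> 'a) module"
  interpret S: K_algebra "series_ring complex_ring" ?S
    using assoc_algebra_series_type by (simp add: K_algebra_def)
  have join: "join_series p q k (pair_index p a b) = k a b" for k and a b :: "unit \<Rightarrow> nat"
    using assms by (simp add: join_series_def pair_index_apply)
  show ?thesis
  proof (rule algebra_isoI)
    show "bij_betw (split_series p)
      (carrier (restrict_scalars (join_series p q) (series_algebra (type_algebra sc)))) (carrier (series_algebra ?S))"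
      using assms
      by (intro bij_betw_byWitness[of _ "\<lambda>f m. f (\<lambda>_. m p) (\<lambda>_. m q)"])
         (auto simp: restrict_scalars_def series_type_simps split_series_def pair_index_split pair_index_apply)
    show "split_series p \<one>\<^bsub>restrict_scalars (join_series p q) (series_algebra (type_algebra sc))\<^esub> = \<one>\<^bsub>series_algebra ?S\<^esub>"
      using assms
      by (auto simp: restrict_scalars_def series_type_simps split_series_def S.one_series_algebra const_series_def
          mcoeff_one pair_index_zero intro!: ext)
  qed (auto simp: restrict_scalars_def series_type_simps split_series_def S.mult_series_algebra
      S.smult_series_algebra conv_def finsum_series_type mcoeff_mult sum_pair_index[OF assms] pair_index_diff join
      intro!: ext)
qed

end

lemma restrict_scalars_simps:
  "carrier (restrict_scalars \<sigma> M) = carrier M"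
  "x \<oplus>\<^bsub>restrict_scalars \<sigma> M\<^esub> y = x \<oplus>\<^bsub>M\<^esub> y"
  "x \<otimes>\<^bsub>restrict_scalars \<sigma> M\<^esub> y = x \<otimes>\<^bsub>M\<^esub> y"
  "\<one>\<^bsub>restrict_scalars \<sigma> M\<^esub> = \<one>\<^bsub>M\<^esub>"
  "k \<odot>\<^bsub>restrict_scalars \<sigma> M\<^esub> x = \<sigma> k \<odot>\<^bsub>M\<^esub> x"
  by (simp_all add: restrict_scalars_def)

lemma restrict_scalars_module_iso:
  assumes "f \<in> module_iso K M N" "\<And>k. k \<in> carrier K' \<Longrightarrow> \<sigma> k \<in> carrier K"
  shows "f \<in> module_iso K' (restrict_scalars \<sigma> M) (restrict_scalars \<sigma> N)"
  using module_isoD[OF assms(1)] assms(2) by (intro module_isoI) (auto simp: restrict_scalars_simps)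

lemma restrict_scalars_algebra_iso:
  assumes "f \<in> algebra_iso K M N" "\<And>k. k \<in> carrier K' \<Longrightarrow> \<sigma> k \<in> carrier K"
  shows "f \<in> algebra_iso K' (restrict_scalars \<sigma> M) (restrict_scalars \<sigma> N)"
  using algebra_isoD[OF assms(1)] assms(2) by (intro algebra_isoI) (auto simp: restrict_scalars_simps)

text \<open>The specialisation at 0 of the parameter \<open>p\<close>, as a series in the other
  one.\<close>

definition restrict_series :: "two_params \<Rightarrow> (two_params, 'a::ring_1) mser \<Rightarrow> (unit, 'a) mser" where
  "restrict_series p f = Mser (\<lambda>d. mcoeff f (pair_index p (\<lambda>_. 0) d))"

lemma restrict_series_add: "restrict_series p (f + g) = restrict_series p f + restrict_series p g"
  by (rule mser_eqI) (simp add: restrict_series_def)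

lemma restrict_series_mult:
  assumes "p \<noteq> q"
  shows "restrict_series p (f * g) = restrict_series p f * restrict_series p g"
  by (rule mser_eqI) (simp add: restrict_series_def mcoeff_mult sum_pair_index[OF assms] pair_index_diff zero_fun_def)

lemma restrict_series_cser:
  assumes "p \<noteq> q"
  shows "restrict_series p (cser x) = cser x"
  using pair_index_zero[OF assms] by (intro mser_eqI) (simp add: restrict_series_def mcoeff_mono)

lemma restrict_series_power:
  assumes "p \<noteq> q"
  shows "restrict_series p (f ^ n) = restrict_series p f ^ n"
proof (induction n)
  case 0
  then show ?case using restrict_series_cser[OF assms, of 1] by (simp add: cser_simps)
qed (simp add: restrict_series_mult[OF assms])

lemma restrict_pbw_map:
  assumes "p \<noteq> q"
  shows "restrict_series p (pbw_map x y) = pbw_map (restrict_series p x) y"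
proof (induction y rule: pbw_induct)
  case (monomial i)
  show ?case
    unfolding pbw_map(3)
    by (cases i) (simp add: pbw_series_def restrict_series_mult[OF assms] restrict_series_power[OF assms] restrict_series_cser[OF assms])
qed (simp_all add: pbw_map restrict_series_add restrict_series_mult[OF assms] restrict_series_cser[OF assms])

text \<open>Setting either parameter to 0 turns the two-parameter twist into the same one-parameter
  twist, by \<open>\<Gamma>_h\<close> and \<open>\<Gamma>_h'\<close>.\<close>

lemma restrict_Uhh_img:
  assumes "p \<noteq> q"
  shows "restrict_series p (Uhh_img g Xp_C) = Uh_img Xp"
  by (cases p; rule mser_eqI)
     (simp_all add: restrict_series_def Uhh_img.simps(1) Uh_img.simps(1) XP_series_def pair_index_def \<Gamma>_h \<Gamma>_h')

lemma restrict_lin_ext: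
  assumes "p \<noteq> q"
  shows "restrict_series p (Uhh.lin_ext g f) = Uh.lin_ext (restrict_series p f)"
proof (rule mser_eqI)
  fix b
  have "mcoeff (restrict_series p (Uhh.lin_ext g f)) b =
    (\<Sum>b'\<in>{b'. b' \<le> b}. mcoeff (restrict_series p (pbw_map (Uhh_img g Xp_C) (mcoeff (restrict_series p f) b'))) (b - b'))"
    by (simp add: restrict_series_def Uhh.lin_ext_def sum_pair_index[OF assms] pair_index_diff zero_fun_def)
  then show "mcoeff (restrict_series p (Uhh.lin_ext g f)) b = mcoeff (Uh.lin_ext (restrict_series p f)) b"
    by (simp add: Uh.lin_ext_def restrict_pbw_map[OF assms] restrict_Uhh_img[OF assms])
qed

text \<open>Here \<open>p\<close> is the deformation parameter and \<open>q\<close> the one in the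
  scalars. The model of the one-parameter algebra is U[[q]], in which its basis is already twisted.
  So \<open>L\<close> first undoes the one-parameter PBW map on each coefficient in \<open>p\<close>
  (this is \<open>G\<close>), then joins the two parameters, applies the two-parameter PBW map and
  splits them again.\<close>

lemma trivial_deformation_Uh:
  assumes pq: "p \<noteq> q"
  shows "trivial_deformation_via_bases (series_ring complex_ring) Uh_sl2 Uh_basis
    (restrict_scalars (join_series p q) (Uhh_sl2 g)) (Uhh_basis g)"
proof -
  let ?K = "series_ring complex_ring :: ((unit \<Rightarrow> nat) \<Rightarrow> complex) ring"
  let ?KK = "series_ring ?K :: ((unit \<Rightarrow> nat) \<Rightarrow> (unit \<Rightarrow> nat) \<Rightarrow> complex) ring"
  let ?S = "series_algebra (type_algebra usc) :: ((unit \<Rightarrow> nat) \<Rightarrow> complex, (unit \<Rightarrow> nat) \<Rightarrow> usl2) module"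
  let ?SS = "series_algebra ?S :: ((unit \<Rightarrow> nat) \<Rightarrow> (unit \<Rightarrow> nat) \<Rightarrow> complex,
     (unit \<Rightarrow> nat) \<Rightarrow> (unit \<Rightarrow> nat) \<Rightarrow> usl2) module"
  let ?S2 = "series_algebra (type_algebra usc) :: ((two_params \<Rightarrow> nat) \<Rightarrow> complex, (two_params \<Rightarrow> nat) \<Rightarrow> usl2) module"
  let ?R2 = "restrict_scalars (join_series p q) ?S2"
  let ?B = "restrict_scalars (join_series p q) (Uhh_sl2 g)"
  interpret S: K_algebra ?K ?S using U.assoc_algebra_series_type by (simp add: K_algebra_def)
  interpret SS: assoc_algebra ?KK ?SS by (rule S.assoc_algebra_series)
  interpret B: assoc_algebra "series_ring complex_ring" "Uhh_sl2 g"
    unfolding Uhh_sl2_def by (rule Uhh.assoc_algebra_top_generated)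
  interpret C: ring complex_ring by (rule ring_type_ring)
  have join: "join_series p q k \<in> carrier (series_ring complex_ring)" for k by simp
  have split: "split_series p \<in> algebra_iso ?KK ?R2 ?SS" by (rule U.split_series_iso[OF pq])
  define J where "J = inv_into (carrier ?R2) (split_series p)"
  have J: "J \<in> module_iso ?KK ?SS ?R2"
    unfolding J_def
    by (rule module_iso_inv[OF algebra_isoD(7)[OF split]]) (simp_all add: restrict_scalars_simps U.series_type_simps)
  have carr: "carrier ?R2 = UNIV" "carrier ?S = UNIV" "carrier ?SS = UNIV"
    by (simp_all add: restrict_scalars_simps U.series_type_simps)
  have split_bij: "bij_betw (split_series p) (carrier ?R2) (carrier ?SS)" by (rule algebra_isoD(1)[OF split])
  have J_split: "J (split_series p x) = x" for x :: "(two_params \<Rightarrow> nat) \<Rightarrow> usl2"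
    using split_bij unfolding J_def carr by (simp add: bij_betw_def)
  have split_J: "split_series p (J x) = x" for x :: "(unit \<Rightarrow> nat) \<Rightarrow> (unit \<Rightarrow> nat) \<Rightarrow> usl2"
    using split_bij unfolding J_def carr by (simp add: bij_betw_def f_inv_into_f)
  define G where "G = inv_into (carrier ?S) Uh.series_map"
  have G: "G \<in> module_iso ?K ?S ?S"
    unfolding G_def by (rule module_iso_inv[OF Uh.series_map_module_iso]) (simp_all add: U.series_type_simps)
  have bij: "bij_betw Uh.series_map (carrier ?S) (carrier ?S)" by (rule module_isoD(1)[OF Uh.series_map_module_iso])
  have G_map: "G (Uh.series_map x) = x" "Uh.series_map (G x) = x" for x
    using bij unfolding G_def carr by (simp_all add: bij_betw_def f_inv_into_f)
  define L where "L = split_series p \<circ> Uhh.series_map g \<circ> J \<circ> (\<lambda>f m. G (f m))"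
  have map: "Uhh.series_map g \<in> module_iso ?KK ?R2 ?R2"
    by (rule restrict_scalars_module_iso[OF Uhh.series_map_module_iso]) (rule join)
  have L: "L \<in> module_iso ?KK ?SS ?SS"
    unfolding L_def
    by (rule module_iso_trans[OF series_module_iso[OF S.assoc_algebra_axioms S.assoc_algebra_axioms G]
        module_iso_trans[OF J module_iso_trans[OF map algebra_isoD(7)[OF split]]]])
  have iso: "split_series p \<circ> Uhh.iso g \<in> algebra_iso ?KK ?B ?SS"
    unfolding Uhh_sl2_def
    by (rule algebra_iso_trans[OF restrict_scalars_algebra_iso[OF Uhh.iso] split]) (rule join)
  \<comment> \<open>At \<open>p\<close> = 0 the two-parameter PBW map becomes the one-parameter map
    that \<open>G\<close> inverts, by \<open>restrict_lin_ext\<close>.\<close>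
  have L0: "L f (\<lambda>_. 0) = f (\<lambda>_. 0)" for f
  proof -
    let ?x = "J (\<lambda>m. G (f m))"
    have "L f (\<lambda>_. 0) = mcoeff (restrict_series p (Uhh.lin_ext g (Mser ?x)))"
      by (simp add: L_def split_series_def Uhh.series_map_def restrict_series_def fun_eq_iff)
    also have "\<dots> = mcoeff (Uh.lin_ext (restrict_series p (Mser ?x)))"
      by (simp add: restrict_lin_ext[OF pq])
    also have "restrict_series p (Mser ?x) = Mser (split_series p ?x (\<lambda>_. 0))"
      by (simp add: restrict_series_def split_series_def)
    also have "mcoeff (Uh.lin_ext \<dots>) = f (\<lambda>_. 0)"
      using G_map(2)[of "f (\<lambda>_. 0)"] by (simp add: split_J Uh.series_map_def)
    finally show ?thesis .
  qed
  have Le: "L (const_series ?S (Uh.iso (Uh_basis i))) = (split_series p \<circ> Uhh.iso g) (Uhh_basis g i)" for i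
  proof -
    \<comment> \<open>The image of the one-parameter basis is the one-parameter PBW map on
      monomials. So \<open>G\<close> gives back the untwisted monomials, which the two-parameter map
      sends to the two-parameter basis.\<close>
    have "Uh.iso (Uh_basis i) = Uh.series_map (mcoeff (cser (pbw_monomial i)))"
      by (simp add: Uh_basis Uh.series_map_def Uh.lin_ext_cser pbw_map)
    moreover have "G \<zero>\<^bsub>?S\<^esub> = \<zero>\<^bsub>?S\<^esub>"
      using module_isoD[OF G] by (intro hom_zero[of ?S ?S G] S.M.abelian_group_axioms)
    ultimately have "(\<lambda>m. G (const_series ?S (Uh.iso (Uh_basis i)) m)) = const_series ?S (mcoeff (cser (pbw_monomial i)))"
      by (auto simp: const_series_def G_map)
    also have "\<dots> = split_series p (mcoeff (cser (pbw_monomial i)))"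
      using pair_index_zero[OF pq]
      by (auto simp: const_series_def split_series_def mcoeff_mono U.series_type_simps intro!: ext)
    finally show ?thesis
      by (simp add: L_def J_split Uhh.series_map_def Uhh.lin_ext_cser pbw_map Uhh_basis)
  qed
  show ?thesis
  proof (rule trivial_deformation_via_basesI)
    show "assoc_algebra ?K Uh_sl2" "Uh.iso \<in> algebra_iso ?K Uh_sl2 ?S"
      unfolding Uh_sl2_def by (rule Uh.assoc_algebra_top_generated, rule Uh.iso)
    show "assoc_algebra ?K ?S" by (rule S.assoc_algebra_axioms)
    show "ring ?B" unfolding restrict_scalars_def by (rule ring_with_smult[OF B.ring_axioms])
    show "k \<odot>\<^bsub>?B\<^esub> x \<in> carrier ?B" if "k \<in> carrier ?KK" "x \<in> carrier ?B" for k x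
      using that B.smult_closed[OF join[of k]] by (simp only: restrict_scalars_simps)
    show "split_series p \<circ> Uhh.iso g \<in> algebra_iso ?KK ?B ?SS" by (rule iso)
    show "L \<in> module_iso ?KK ?SS ?SS" by (rule L)
    show "L f (\<lambda>_. 0) = f (\<lambda>_. 0)" for f by (rule L0)
    show "L (const_series ?S (Uh.iso (Uh_basis i))) = (split_series p \<circ> Uhh.iso g) (Uhh_basis g i)" for i by (rule Le)
    show "Uh_basis i \<in> carrier Uh_sl2" "Uh_basis (0, 0, 0) = \<one>\<^bsub>Uh_sl2\<^esub>" for i by (rule Uh_basis)+
    show "Uhh_basis g i \<in> carrier ?B" for i unfolding restrict_scalars_simps by (rule Uhh_basis)
    show "Uhh_basis g (0, 0, 0) = \<one>\<^bsub>?B\<^esub>" unfolding restrict_scalars_simps by (rule Uhh_basis)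
  qed
qed

theorem mainTheorem15:
  fixes g :: nat
  assumes "g \<ge> 1"
  shows
    "trivial_deformation_via_bases complex_ring U_sl2 U_basis (Uhh_sl2 g) (Uhh_basis g) \<and>
     trivial_deformation_via_bases (series_ring complex_ring) Uh_sl2 Uh_basis
       (restrict_scalars (join_series param_h' param_h) (Uhh_sl2 g)) (Uhh_basis g) \<and>
     trivial_deformation_via_bases (series_ring complex_ring) Uh_sl2 Uh_basis
       (restrict_scalars (join_series param_h param_h') (Uhh_sl2 g)) (Uhh_basis g)"
  using trivial_deformation_U trivial_deformation_Uh by simp

end
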